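(* Let $\Theta_1,\Theta_2$ be minimal L-systems (input-output space $\mathbb C$, $J=1$) satisfying Hypothesis II, and let $\Theta=\Theta_1\cdot\Theta_2$ be their (general) coupling. Suppose that $V_{\Theta_1}\in\mathfrak M_{\kappa_1}^{-1}$ and $V_{\Theta_2}\in\mathfrak M_{\kappa_2}^{-1}$, $0\le\kappa_1,\kappa_2<1$. Then $\Theta$ satisfies Hypothesis I and $V_\Theta\in\mathfrak M_{\kappa_1\kappa_2}$.
   Context: L-systems. Let $\dot A$ be a closed, densely defined symmetric operator with deficiency indices $(1,1)$ in a Hilbert space $\mathcal H$. Let $\mathcal H_+=\mathrm{Dom}(\dot A^* )$ with inner product $(f,g)_+=(f,g)+(\dot A^*f,\dot A^*g)$, and let $\mathcal H_+\subset\mathcal H\subset\mathcal H_-$ be the associated rigged Hilbert space ($\mathcal H_-$ is the dual of $\mathcal H_+$ with respect to the pairing extending the inner product of $\mathcal H$). For a bounded $\mathbb A:\mathcal H_+\to\mathcal H_-$ the adjoint $\mathbb A^*$ is again bounded $\mathcal H_+\to\mathcal H_-$; $\mathrm{Re}\,\mathbb A=(\mathbb A+\mathbb A^* )/2$, $\mathrm{Im}\,\mathbb A=(\mathbb A-\mathbb A^* )/(2i)$. An operator $T$ with $\dot A\subset T\subset\dot A^*$ belongs to $\Lambda(\dot A)$ if $\rho(T)\neq\emptyset$ and $\mathrm{Dom}(\dot A)=\mathrm{Dom}(T)\cap\mathrm{Dom}(T^* )$. A bounded $\mathbb A:\mathcal H_+\to\mathcal H_-$ is a $( * )$-extension of $T$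 if $\mathbb A\supset T\supset\dot A$, $\mathbb A^*\supset T^*\supset\dot A$, and the quasi-kernel $\hat A$ of $\mathrm{Re}\,\mathbb A$ (the restriction of $\mathrm{Re}\,\mathbb A$ to $\{f\in\mathcal H_+:\mathrm{Re}\,\mathbb A f\in\mathcal H\}$) is self-adjoint in $\mathcal H$. An L-system is an array $\Theta=\begin{pmatrix}\mathbb A&K&1\\ \mathcal H_+\subset\mathcal H\subset\mathcal H_-&&\mathbb C\end{pmatrix}$, where $\mathbb A$ is a $( * )$-extension of some $T\in\Lambda(\dot A)$ (the main operator), $K:\mathbb C\to\mathcal H_-$ is bounded with adjoint $K^*:\mathcal H_+\to\mathbb C$, $\mathrm{Im}\,\mathbb A=KK^*$, $\mathrm{Ran}(K)=\mathrm{Ran}(\mathrm{Im}\,\mathbb A)$. It is minimal if $\dot A$ is prime (no nontrivial reducing subspace on which $\dot A$ induces a self-adjoint operator). Transfer function: $W_\Theta(z)=1-2iK^*(\mathbb A-zI)^{-1}K$, $z\in\rho(T)$; impedance function: $V_\Theta(z)=K^*(\mathrm{Re}\,\mathbb A-zI)^{-1}K$, $z\in\rho(\hat A)$ (both well defined). Von Neumann parameter and Hypotheses I, II. The main operator $T$ is a maximal dissipative extension of $\dot A$, and there are $g_\pm\in\ker(\dot A^*\mp iI)$, $\|g_\pm\|=1$, with $g_+-\kappa g_-\in\mathrm{Dom}(T)$, $0\le\kappa<1$; $\kappa$ is the von Neumann parameter of $T$. The L-system satisfies Hypothesis I if such $g_\pm$ can be chosen with $g_+-g_-\in\mathrm{Dom}(\hat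 A)$, and Hypothesis II if they can be chosen with $g_++g_-\in\mathrm{Dom}(\hat A)$. Classes ($0\le\kappa<1$): $\mathfrak M_\kappa$ (resp. $\mathfrak M_\kappa^{-1}$) is the set of all analytic $M:\mathbb C_+\to\mathbb C_+$ of the form $M(z)=\int_{\mathbb R}\left(\frac1{\lambda-z}-\frac{\lambda}{1+\lambda^2}\right)d\mu(\lambda)$ with $\mu$ an infinite Borel measure with $\int_{\mathbb R}\frac{d\mu(\lambda)}{1+\lambda^2}=\frac{1-\kappa}{1+\kappa}$ (resp. $=\frac{1+\kappa}{1-\kappa}$). Coupling under Hypothesis I. For $k=1,2$ let $\Theta_k$ act in $\mathcal H_k$, with symmetric operator $\dot A_k$, main operator $T_k$, and $g^k_\pm,\kappa_k$ as in Hypothesis I. Define $\alpha\in(0,\pi/2]$ by $\tan\alpha=\frac1{\kappa_2}\sqrt{\frac{1-\kappa_2^2}{1-\kappa_1^2}}$ if $\kappa_2\ne0$ and $\alpha=\pi/2$ if $\kappa_2=0$; define $\beta$ by $\sin\beta=\kappa_1\sin\alpha$, $\cos\beta=\frac1{\kappa_2}\cos\alpha$ if $\kappa_2\neq0$, and $\sin\beta=\kappa_1$, $\cos\beta=\sqrt{1-\kappa_1^2}$ if $\kappa_2=0$. Let $\dot A$ be the restriction of $(\dot A_1\oplus\dot A_2)^*$ to $\mathrm{Dom}(\dot A_1\oplus\dot A_2)\dot+\mathcal L_0$, where $\mathcal L_0$ is spanned by $\sin\alpha\,(g_+^1-\kappa_1g_-^1)\oplus\cos\alpha\,(g_+^2-\frac1{\kappa_2}g_-^2)$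 if $\kappa_2\ne0$, and by $(g_+^1-\kappa_1g_-^1)\oplus(-\sqrt{1-\kappa_1^2}\,g_-^2)$ if $\kappa_2=0$. Then $\dot A$ is symmetric with deficiency indices $(1,1)$ in $\mathcal H_1\oplus\mathcal H_2$, with normalized deficiency vectors $G_+=\cos\alpha\,g_+^1-\sin\alpha\,g_+^2\in\ker(\dot A^*-iI)$ and $G_-=\cos\beta\,g_-^1-\sin\beta\,g_-^2\in\ker(\dot A^*+iI)$. The operator coupling $T=T_1\uplus T_2$ is the restriction of $(\dot A_1\oplus\dot A_2)^*$ to $\mathrm{Dom}(\dot A)\dot+\mathrm{span}\{G_+-\kappa_1\kappa_2G_-\}$, a maximal dissipative extension of $\dot A$. The coupling $\Theta_1\cdot\Theta_2$ is the L-system with symmetric operator $\dot A$, main operator $T$, rigging $\mathcal H_+=\mathrm{Dom}(\dot A^* )\subset\mathcal H_1\oplus\mathcal H_2\subset\mathcal H_-$, state-space operator $\mathbb A$ the (unique) $( * )$-extension of $T$ such that the quasi-kernel of $\mathrm{Re}\,\mathbb A$ is the self-adjoint extension $\hat A$ of $\dot A$ with $G_+-G_-\in\mathrm{Dom}(\hat A)$, and $Kc=c\chi$ with $\mathrm{Im}\,\mathbb A=(\cdot,\chi)\chi$ ($\chi$ is determined up to a unimodular factor). General coupling. For arbitrary minimal L-systems $\Theta_1,\Theta_2$ with main operators $T_k$ of von Neumann parameters $\kappa_k$, let $\Theta_k'$ be the L-system with the same $\dot A_k,T_k$ whose quasi-kernel satisfies Hypothesis I (with the same $\kappa_k$; when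 $\Theta_k$ satisfies Hypothesis II with deficiency vectors $g_\pm^k$, the same $g_\pm^k$ are used). Then $W_{\Theta_k'}=\nu_kW_{\Theta_k}$ with $|\nu_k|=1$ (when $\Theta_k$ satisfies Hypothesis II, $\nu_k=-1$). Let $\Theta'=\Theta_1'\cdot\Theta_2'$. The coupling $\Theta=\Theta_1\cdot\Theta_2$ is the L-system that has the same symmetric operator and main operator as $\Theta'$ (so it differs from $\Theta'$ only by the choice of the quasi-kernel, with the corresponding $\mathbb A$, $K$) and transfer function $W_\Theta=(\nu_1\nu_2)^{-1}W_{\Theta'}$. *)

theory Defs
  imports "HOL-Analysis.Analysis"
begin

section \<open>Complex Hilbert spaces\<close>

text \<open>The inner product is linear in the \<^emph>\<open>first\<close> argument.\<close>

class complex_inner = real_inner +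
  fixes scaleC :: "complex \<Rightarrow> 'a \<Rightarrow> 'a" (infixr "*\<^sub>C" 75)
    and cinner :: "'a \<Rightarrow> 'a \<Rightarrow> complex"
  assumes scaleR_eq_scaleC: "scaleR r x = complex_of_real r *\<^sub>C x"
    and scaleC_add_right: "a *\<^sub>C (x + y) = a *\<^sub>C x + a *\<^sub>C y"
    and scaleC_add_left: "(a + b) *\<^sub>C x = a *\<^sub>C x + b *\<^sub>C x"
    and scaleC_scaleC: "a *\<^sub>C b *\<^sub>C x = (a * b) *\<^sub>C x"
    and cinner_commute: "cinner x y = cnj (cinner y x)"
    and cinner_add_left: "cinner (x + y) z = cinner x z + cinner y z"
    and cinner_scaleC_left: "cinner (a *\<^sub>C x) y = a * cinner x y"
    and inner_eq_Re_cinner: "inner x y = Re (cinner x y)"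

class chilbert_space = complex_inner + complete_space

interpretation cvec: vector_space "scaleC :: complex \<Rightarrow> 'a \<Rightarrow> 'a :: complex_inner"
proof
  show "1 *\<^sub>C x = x" for x :: 'a
    using scaleR_eq_scaleC[of 1 x] by simp
qed (simp_all add: scaleC_add_right scaleC_add_left scaleC_scaleC)

text \<open>The product type carries the orthogonal sum of two Hilbert spaces.\<close>

instantiation prod :: (complex_inner, complex_inner) complex_inner
begin

definition scaleC_prod :: "complex \<Rightarrow> 'a \<times> 'b \<Rightarrow> 'a \<times> 'b" where
  "scaleC_prod c x = (c *\<^sub>C fst x, c *\<^sub>C snd x)"

definition cinner_prod :: "'a \<times> 'b \<Rightarrow> 'a \<times> 'b \<Rightarrow> complex" where
  "cinner_prod x y = cinner (fst x) (fst y) + cinner (snd x) (snd y)"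

instance
proof
  fix r :: real and a b :: complex and x y z :: "'a \<times> 'b"
  show "scaleR r x = complex_of_real r *\<^sub>C x"
    by (simp add: scaleC_prod_def scaleR_prod_def scaleR_eq_scaleC)
  show "a *\<^sub>C (x + y) = a *\<^sub>C x + a *\<^sub>C y"
    by (simp add: scaleC_prod_def scaleC_add_right)
  show "(a + b) *\<^sub>C x = a *\<^sub>C x + b *\<^sub>C x"
    by (simp add: scaleC_prod_def scaleC_add_left)
  show "a *\<^sub>C b *\<^sub>C x = (a * b) *\<^sub>C x"
    by (simp add: scaleC_prod_def scaleC_scaleC)
  show "cinner x y = cnj (cinner y x)"
    unfolding cinner_prod_def complex_cnj_add
    by (simp only: cinner_commute[symmetric])
  show "cinner (x + y) z = cinner x z + cinner y z"
    by (simp add: cinner_prod_def cinner_add_left)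
  show "cinner (a *\<^sub>C x) y = a * cinner x y"
    by (simp add: cinner_prod_def scaleC_prod_def cinner_scaleC_left distrib_left)
  show "inner x y = Re (cinner x y)"
    by (simp add: cinner_prod_def inner_prod_def inner_eq_Re_cinner)
qed

end

instance prod :: (chilbert_space, chilbert_space) chilbert_space ..


section \<open>Unbounded operators\<close>

text \<open>
  An operator is identified with its graph, so that \<open>Domain T\<close> is its domain, \<open>S \<subseteq> T\<close> means
  that \<open>T\<close> extends \<open>S\<close>, and \<open>closed T\<close> means that \<open>T\<close> is a closed operator.
\<close>

type_synonym 'a graph = "('a \<times> 'a) set"

definition is_operator :: "'a::complex_inner graph \<Rightarrow> bool" where
  "is_operator T \<longleftrightarrow> cvec.subspace T \<and> single_valued T"

definition op_app :: "'a graph \<Rightarrow> 'a \<Rightarrow> 'a" where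
  "op_app T f = (THE h. (f, h) \<in> T)"

definition restrict_op :: "'a graph \<Rightarrow> 'a set \<Rightarrow> 'a graph" where
  "restrict_op T D = {(f, h). (f, h) \<in> T \<and> f \<in> D}"

text \<open>The adjoint, relative to a subspace \<open>N\<close> in which \<open>T\<close> acts.\<close>

definition adjoint_in :: "'a::complex_inner set \<Rightarrow> 'a graph \<Rightarrow> 'a graph" where
  "adjoint_in N T = {(g, h). g \<in> N \<and> h \<in> N \<and> (\<forall>(f, k)\<in>T. cinner k g = cinner f h)}"

abbreviation adjoint_op :: "'a::complex_inner graph \<Rightarrow> 'a graph" where
  "adjoint_op \<equiv> adjoint_in UNIV"

definition densely_defined_in :: "'a::complex_inner set \<Rightarrow> 'a graph \<Rightarrow> bool" where
  "densely_defined_in N T \<longleftrightarrow> Domain T \<subseteq> N \<and> N \<subseteq> closure (Domain T)"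

definition self_adjoint_in :: "'a::complex_inner set \<Rightarrow> 'a graph \<Rightarrow> bool" where
  "self_adjoint_in N T \<longleftrightarrow> is_operator T \<and> densely_defined_in N T \<and> T = adjoint_in N T"

definition symmetric_op :: "'a::complex_inner graph \<Rightarrow> bool" where
  "symmetric_op A \<longleftrightarrow> is_operator A \<and> densely_defined_in UNIV A \<and> A \<subseteq> adjoint_op A"

text \<open>\<open>defect_space A z\<close> is the kernel of \<open>A\<^sup>* - zI\<close>.\<close>

definition defect_space :: "'a::complex_inner graph \<Rightarrow> complex \<Rightarrow> 'a set" where
  "defect_space A z = {g. (g, z *\<^sub>C g) \<in> adjoint_op A}"

definition deficiency_indices_1_1 :: "'a::complex_inner graph \<Rightarrow> bool" where
  "deficiency_indices_1_1 A \<longleftrightarrow>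
     cvec.dim (defect_space A \<i>) = 1 \<and> cvec.dim (defect_space A (- \<i>)) = 1"

definition resolvent_set :: "'a::complex_inner graph \<Rightarrow> complex set" where
  "resolvent_set T = {z. \<exists>R. bounded_linear R \<and>
     (\<forall>h. (R h, h + z *\<^sub>C R h) \<in> T) \<and> (\<forall>(f, k)\<in>T. R (k - z *\<^sub>C f) = f)}"

definition dissipative :: "'a::complex_inner graph \<Rightarrow> bool" where
  "dissipative T \<longleftrightarrow> is_operator T \<and> (\<forall>(f, h)\<in>T. 0 \<le> Im (cinner h f))"

definition maximal_dissipative :: "'a::complex_inner graph \<Rightarrow> bool" where
  "maximal_dissipative T \<longleftrightarrow> dissipative T \<and> (\<forall>S. dissipative S \<and> T \<subseteq> S \<longrightarrow> S = T)"

definition orth_compl :: "'a::complex_inner set \<Rightarrow> 'a set" where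
  "orth_compl N = {x. \<forall>y\<in>N. cinner x y = 0}"

definition reducing_subspace :: "'a::complex_inner graph \<Rightarrow> 'a set \<Rightarrow> bool" where
  "reducing_subspace A N \<longleftrightarrow> cvec.subspace N \<and> closed N \<and>
     (\<forall>p\<in>A. \<exists>q\<in>A \<inter> N \<times> N. \<exists>r\<in>A \<inter> orth_compl N \<times> orth_compl N. p = q + r)"

definition prime_op :: "'a::complex_inner graph \<Rightarrow> bool" where
  "prime_op A \<longleftrightarrow>
     \<not> (\<exists>N. N \<noteq> {0} \<and> reducing_subspace A N \<and> self_adjoint_in N (A \<inter> N \<times> N))"

definition direct_sum_op :: "'a graph \<Rightarrow> 'b graph \<Rightarrow> ('a \<times> 'b) graph" where
  "direct_sum_op S T = {((f1, f2), (h1, h2)). (f1, h1) \<in> S \<and> (f2, h2) \<in> T}"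


section \<open>Rigged Hilbert spaces\<close>

definition Hplus :: "'a::complex_inner graph \<Rightarrow> 'a set" where
  "Hplus A = Domain (adjoint_op A)"

definition cinner_plus :: "'a::complex_inner graph \<Rightarrow> 'a \<Rightarrow> 'a \<Rightarrow> complex" where
  "cinner_plus A f g = cinner f g + cinner (op_app (adjoint_op A) f) (op_app (adjoint_op A) g)"

definition norm_plus :: "'a::complex_inner graph \<Rightarrow> 'a \<Rightarrow> real" where
  "norm_plus A f = sqrt (Re (cinner_plus A f f))"

text \<open>
  An element \<open>\<phi>\<close> of \<open>\<H>\<^sub>-\<close> is represented by the bounded antilinear functional \<open>f \<mapsto> (\<phi>, f)\<close>
  on \<open>\<H>\<^sub>+\<close>, extended by zero off \<open>\<H>\<^sub>+\<close>; this makes \<open>\<phi> \<mapsto> (\<phi>, \<cdot>)\<close> linear. The space \<open>\<H>\<close> is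
  embedded by \<open>h \<mapsto> (h, \<cdot>)\<close>.
\<close>

definition Hminus :: "'a::complex_inner graph \<Rightarrow> ('a \<Rightarrow> complex) set" where
  "Hminus A = {\<phi>.
     (\<forall>f. f \<notin> Hplus A \<longrightarrow> \<phi> f = 0) \<and>
     (\<forall>f\<in>Hplus A. \<forall>g\<in>Hplus A. \<phi> (f + g) = \<phi> f + \<phi> g) \<and>
     (\<forall>c. \<forall>f\<in>Hplus A. \<phi> (c *\<^sub>C f) = cnj c * \<phi> f) \<and>
     (\<exists>C. \<forall>f\<in>Hplus A. cmod (\<phi> f) \<le> C * norm_plus A f)}"

definition norm_minus :: "'a::complex_inner graph \<Rightarrow> ('a \<Rightarrow> complex) \<Rightarrow> real" where
  "norm_minus A \<phi> = Sup {cmod (\<phi> f) | f. f \<in> Hplus A \<and> norm_plus A f \<le> 1}"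

definition embed :: "'a::complex_inner graph \<Rightarrow> 'a \<Rightarrow> 'a \<Rightarrow> complex" where
  "embed A h = (\<lambda>f. if f \<in> Hplus A then cinner h f else 0)"

text \<open>
  An operator \<open>\<A> : \<H>\<^sub>+ \<rightarrow> \<H>\<^sub>-\<close> has the type \<open>'a \<Rightarrow> 'a \<Rightarrow> complex\<close>, where \<open>\<A> f g\<close> is the pairing
  \<open>(\<A>f, g)\<close>; it is likewise extended by zero off \<open>\<H>\<^sub>+\<close>.
\<close>

definition bounded_plus_minus :: "'a::complex_inner graph \<Rightarrow> ('a \<Rightarrow> 'a \<Rightarrow> complex) \<Rightarrow> bool" where
  "bounded_plus_minus A \<A> \<longleftrightarrow>
     (\<forall>f. f \<notin> Hplus A \<longrightarrow> \<A> f = (\<lambda>_. 0)) \<and>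
     (\<forall>f\<in>Hplus A. \<A> f \<in> Hminus A) \<and>
     (\<forall>f\<in>Hplus A. \<forall>g\<in>Hplus A. \<A> (f + g) = (\<lambda>x. \<A> f x + \<A> g x)) \<and>
     (\<forall>c. \<forall>f\<in>Hplus A. \<A> (c *\<^sub>C f) = (\<lambda>x. c * \<A> f x)) \<and>
     (\<exists>C. \<forall>f\<in>Hplus A. norm_minus A (\<A> f) \<le> C * norm_plus A f)"

text \<open>\<open>(\<A>\<^sup>*f, g) = (f, \<A>g)\<close>, which is the conjugate of \<open>(\<A>g, f)\<close>.\<close>

definition adjoint_pm :: "('a \<Rightarrow> 'a \<Rightarrow> complex) \<Rightarrow> 'a \<Rightarrow> 'a \<Rightarrow> complex" where
  "adjoint_pm \<A> f g = cnj (\<A> g f)"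

definition Re_op :: "('a \<Rightarrow> 'a \<Rightarrow> complex) \<Rightarrow> 'a \<Rightarrow> 'a \<Rightarrow> complex" where
  "Re_op \<A> f g = (\<A> f g + adjoint_pm \<A> f g) / 2"

definition Im_op :: "('a \<Rightarrow> 'a \<Rightarrow> complex) \<Rightarrow> 'a \<Rightarrow> 'a \<Rightarrow> complex" where
  "Im_op \<A> f g = (\<A> f g - adjoint_pm \<A> f g) / (2 * \<i>)"

definition extends_op ::
    "'a::complex_inner graph \<Rightarrow> ('a \<Rightarrow> 'a \<Rightarrow> complex) \<Rightarrow> 'a graph \<Rightarrow> bool" where
  "extends_op A \<A> T \<longleftrightarrow> (\<forall>(f, h)\<in>T. f \<in> Hplus A \<and> \<A> f = embed A h)"

definition quasi_kernel ::
    "'a::complex_inner graph \<Rightarrow> ('a \<Rightarrow> 'a \<Rightarrow> complex) \<Rightarrow> 'a graph" where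
  "quasi_kernel A \<B> = {(f, h). f \<in> Hplus A \<and> \<B> f = embed A h}"

text \<open>\<open>solve_pm A \<B> z \<phi>\<close> is \<open>(\<B> - zI)\<^sup>-\<^sup>1\<phi>\<close> for \<open>\<phi>\<close> in \<open>\<H>\<^sub>-\<close>.\<close>

definition solve_pm ::
    "'a::complex_inner graph \<Rightarrow> ('a \<Rightarrow> 'a \<Rightarrow> complex) \<Rightarrow> complex \<Rightarrow> ('a \<Rightarrow> complex) \<Rightarrow> 'a" where
  "solve_pm A \<B> z \<phi> = (THE f. f \<in> Hplus A \<and> (\<lambda>g. \<B> f g - z * embed A f g) = \<phi>)"


section \<open>L-systems\<close>

definition Lambda_class :: "'a::complex_inner graph \<Rightarrow> 'a graph set" where
  "Lambda_class A = {T. is_operator T \<and> A \<subseteq> T \<and> T \<subseteq> adjoint_op A \<and>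
     resolvent_set T \<noteq> {} \<and> Domain A = Domain T \<inter> Domain (adjoint_op T)}"

definition star_extension ::
    "'a::complex_inner graph \<Rightarrow> 'a graph \<Rightarrow> ('a \<Rightarrow> 'a \<Rightarrow> complex) \<Rightarrow> bool" where
  "star_extension A T \<A> \<longleftrightarrow> bounded_plus_minus A \<A> \<and>
     extends_op A \<A> T \<and> A \<subseteq> T \<and>
     extends_op A (adjoint_pm \<A>) (adjoint_op T) \<and> A \<subseteq> adjoint_op T \<and>
     self_adjoint_in UNIV (quasi_kernel A (Re_op \<A>))"

definition bounded_channel ::
    "'a::complex_inner graph \<Rightarrow> (complex \<Rightarrow> 'a \<Rightarrow> complex) \<Rightarrow> bool" where
  "bounded_channel A K \<longleftrightarrow>
     (\<forall>c. K c \<in> Hminus A) \<and>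
     (\<forall>c d. K (c + d) = (\<lambda>x. K c x + K d x)) \<and>
     (\<forall>c d. K (c * d) = (\<lambda>x. c * K d x)) \<and>
     (\<exists>C. \<forall>c. norm_minus A (K c) \<le> C * cmod c)"

text \<open>The adjoint \<open>K\<^sup>*\<close> is determined by \<open>(Kc, f) = c \<cdot> cnj (K\<^sup>*f)\<close>.\<close>

definition channel_adjoint :: "(complex \<Rightarrow> 'a \<Rightarrow> complex) \<Rightarrow> 'a \<Rightarrow> complex" where
  "channel_adjoint K f = cnj (K 1 f)"

record 'a l_system =
  sym_op :: "'a graph"
  main_op :: "'a graph"
  state_op :: "'a \<Rightarrow> 'a \<Rightarrow> complex"
  channel :: "complex \<Rightarrow> 'a \<Rightarrow> complex"

definition L_system :: "'a::chilbert_space l_system \<Rightarrow> bool" where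
  "L_system \<Theta> \<longleftrightarrow>
     symmetric_op (sym_op \<Theta>) \<and> closed (sym_op \<Theta>) \<and> deficiency_indices_1_1 (sym_op \<Theta>) \<and>
     main_op \<Theta> \<in> Lambda_class (sym_op \<Theta>) \<and>
     star_extension (sym_op \<Theta>) (main_op \<Theta>) (state_op \<Theta>) \<and>
     bounded_channel (sym_op \<Theta>) (channel \<Theta>) \<and>
     (\<forall>f\<in>Hplus (sym_op \<Theta>).
        Im_op (state_op \<Theta>) f = channel \<Theta> (channel_adjoint (channel \<Theta>) f)) \<and>
     range (channel \<Theta>) = Im_op (state_op \<Theta>) ` Hplus (sym_op \<Theta>)"

definition minimal_L_system :: "'a::chilbert_space l_system \<Rightarrow> bool" where
  "minimal_L_system \<Theta> \<longleftrightarrow> L_system \<Theta> \<and> prime_op (sym_op \<Theta>)"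

abbreviation quasi_kernel_of :: "'a::chilbert_space l_system \<Rightarrow> 'a graph" where
  "quasi_kernel_of \<Theta> \<equiv> quasi_kernel (sym_op \<Theta>) (Re_op (state_op \<Theta>))"

text \<open>Meaningful for \<open>z\<close> in the resolvent set of the main operator.\<close>

definition transfer_fun :: "'a::chilbert_space l_system \<Rightarrow> complex \<Rightarrow> complex" where
  "transfer_fun \<Theta> z = 1 - 2 * \<i> *
     channel_adjoint (channel \<Theta>) (solve_pm (sym_op \<Theta>) (state_op \<Theta>) z (channel \<Theta> 1))"

text \<open>Meaningful for \<open>z\<close> in the resolvent set of the quasi-kernel of the real part.\<close>

definition impedance_fun :: "'a::chilbert_space l_system \<Rightarrow> complex \<Rightarrow> complex" where
  "impedance_fun \<Theta> z =
     channel_adjoint (channel \<Theta>) (solve_pm (sym_op \<Theta>) (Re_op (state_op \<Theta>)) z (channel \<Theta> 1))"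


section \<open>The von Neumann parameter and the two hypotheses\<close>

definition von_neumann_vectors ::
    "'a::complex_inner graph \<Rightarrow> 'a graph \<Rightarrow> real \<Rightarrow> 'a \<Rightarrow> 'a \<Rightarrow> bool" where
  "von_neumann_vectors A T \<kappa> gp gm \<longleftrightarrow>
     maximal_dissipative T \<and> A \<subseteq> T \<and> 0 \<le> \<kappa> \<and> \<kappa> < 1 \<and>
     gp \<in> defect_space A \<i> \<and> gm \<in> defect_space A (- \<i>) \<and> norm gp = 1 \<and> norm gm = 1 \<and>
     gp - \<kappa> *\<^sub>R gm \<in> Domain T"

definition hypothesis_I_with :: "'a::chilbert_space l_system \<Rightarrow> real \<Rightarrow> 'a \<Rightarrow> 'a \<Rightarrow> bool" where
  "hypothesis_I_with \<Theta> \<kappa> gp gm \<longleftrightarrow>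
     von_neumann_vectors (sym_op \<Theta>) (main_op \<Theta>) \<kappa> gp gm \<and>
     gp - gm \<in> Domain (quasi_kernel_of \<Theta>)"

definition hypothesis_II_with :: "'a::chilbert_space l_system \<Rightarrow> real \<Rightarrow> 'a \<Rightarrow> 'a \<Rightarrow> bool" where
  "hypothesis_II_with \<Theta> \<kappa> gp gm \<longleftrightarrow>
     von_neumann_vectors (sym_op \<Theta>) (main_op \<Theta>) \<kappa> gp gm \<and>
     gp + gm \<in> Domain (quasi_kernel_of \<Theta>)"

definition hypothesis_I :: "'a::chilbert_space l_system \<Rightarrow> bool" where
  "hypothesis_I \<Theta> \<longleftrightarrow> (\<exists>\<kappa> gp gm. hypothesis_I_with \<Theta> \<kappa> gp gm)"

definition hypothesis_II :: "'a::chilbert_space l_system \<Rightarrow> bool" where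
  "hypothesis_II \<Theta> \<longleftrightarrow> (\<exists>\<kappa> gp gm. hypothesis_II_with \<Theta> \<kappa> gp gm)"


section \<open>Classes of impedance functions\<close>

text \<open>
  Elements are functions on the upper half-plane; values elsewhere are irrelevant.
  \<open>M_functions m\<close> collects those whose measure has normalisation \<open>m\<close>.
\<close>

definition M_functions :: "real \<Rightarrow> (complex \<Rightarrow> complex) set" where
  "M_functions m = {M.
     M holomorphic_on {z. 0 < Im z} \<and> (\<forall>z. 0 < Im z \<longrightarrow> 0 < Im (M z)) \<and>
     (\<exists>\<mu> :: real measure. sets \<mu> = sets borel \<and> emeasure \<mu> UNIV = \<infinity> \<and>
        has_bochner_integral \<mu> (\<lambda>t. 1 / (1 + t\<^sup>2)) m \<and>
        (\<forall>z. 0 < Im z \<longrightarrow>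
           has_bochner_integral \<mu>
             (\<lambda>t. 1 / (of_real t - z) - of_real t / (1 + (of_real t)\<^sup>2)) (M z)))}"

definition M_class :: "real \<Rightarrow> (complex \<Rightarrow> complex) set" where
  "M_class \<kappa> = M_functions ((1 - \<kappa>) / (1 + \<kappa>))"

definition M_inv_class :: "real \<Rightarrow> (complex \<Rightarrow> complex) set" where
  "M_inv_class \<kappa> = M_functions ((1 + \<kappa>) / (1 - \<kappa>))"


section \<open>Coupling of L-systems\<close>

definition coupling_angles :: "real \<Rightarrow> real \<Rightarrow> real \<Rightarrow> real \<Rightarrow> bool" where
  "coupling_angles \<kappa>1 \<kappa>2 \<alpha> \<beta> \<longleftrightarrow> 0 < \<alpha> \<and> \<alpha> \<le> pi / 2 \<and>
     (if \<kappa>2 \<noteq> 0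
      then tan \<alpha> = 1 / \<kappa>2 * sqrt ((1 - \<kappa>2\<^sup>2) / (1 - \<kappa>1\<^sup>2)) \<and>
           sin \<beta> = \<kappa>1 * sin \<alpha> \<and> cos \<beta> = 1 / \<kappa>2 * cos \<alpha>
      else \<alpha> = pi / 2 \<and> sin \<beta> = \<kappa>1 \<and> cos \<beta> = sqrt (1 - \<kappa>1\<^sup>2))"

definition coupling_vector ::
    "real \<Rightarrow> real \<Rightarrow> real \<Rightarrow> 'a \<Rightarrow> 'a \<Rightarrow> 'b \<Rightarrow> 'b \<Rightarrow> 'a::complex_inner \<times> 'b::complex_inner" where
  "coupling_vector \<kappa>1 \<kappa>2 \<alpha> gp1 gm1 gp2 gm2 =
     (if \<kappa>2 \<noteq> 0
      then (sin \<alpha> *\<^sub>R (gp1 - \<kappa>1 *\<^sub>R gm1), cos \<alpha> *\<^sub>R (gp2 - (1 / \<kappa>2) *\<^sub>R gm2))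
      else (gp1 - \<kappa>1 *\<^sub>R gm1, - (sqrt (1 - \<kappa>1\<^sup>2) *\<^sub>R gm2)))"

definition coupling_sym_op ::
    "'a::complex_inner graph \<Rightarrow> 'b::complex_inner graph \<Rightarrow> 'a \<times> 'b \<Rightarrow> ('a \<times> 'b) graph" where
  "coupling_sym_op A1 A2 l = restrict_op (adjoint_op (direct_sum_op A1 A2))
     {f + x | f x. f \<in> Domain (direct_sum_op A1 A2) \<and> x \<in> cvec.span {l}}"

definition coupling_main_op ::
    "'a::complex_inner graph \<Rightarrow> 'b::complex_inner graph \<Rightarrow> 'a \<times> 'b \<Rightarrow> 'a \<times> 'b \<Rightarrow>
     ('a \<times> 'b) graph" where
  "coupling_main_op A1 A2 l t = restrict_op (adjoint_op (direct_sum_op A1 A2))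
     {f + x | f x. f \<in> Domain (coupling_sym_op A1 A2 l) \<and> x \<in> cvec.span {t}}"

text \<open>
  The state-space operator and the channel of a coupling are determined, the latter up to a
  unimodular factor, by the symmetric operator, the main operator and the quasi-kernel. The
  vectors \<open>g\<^sub>\<plusminus>\<close> of each factor are also fixed only up to a common unimodular factor. Hence
  coupling is a relation rather than a function.
\<close>

definition coupling_I ::
    "'a::chilbert_space l_system \<Rightarrow> 'b::chilbert_space l_system \<Rightarrow> ('a \<times> 'b) l_system \<Rightarrow> bool" where
  "coupling_I \<Theta>1 \<Theta>2 \<Theta> \<longleftrightarrow>
     (\<exists>\<kappa>1 \<kappa>2 gp1 gm1 gp2 gm2 \<alpha> \<beta>.
        hypothesis_I_with \<Theta>1 \<kappa>1 gp1 gm1 \<and> hypothesis_I_with \<Theta>2 \<kappa>2 gp2 gm2 \<and>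
        coupling_angles \<kappa>1 \<kappa>2 \<alpha> \<beta> \<and>
        (let l = coupling_vector \<kappa>1 \<kappa>2 \<alpha> gp1 gm1 gp2 gm2;
             Gp = (cos \<alpha> *\<^sub>R gp1, - (sin \<alpha> *\<^sub>R gp2));
             Gm = (cos \<beta> *\<^sub>R gm1, - (sin \<beta> *\<^sub>R gm2))
         in L_system \<Theta> \<and>
            sym_op \<Theta> = coupling_sym_op (sym_op \<Theta>1) (sym_op \<Theta>2) l \<and>
            main_op \<Theta> = coupling_main_op (sym_op \<Theta>1) (sym_op \<Theta>2) l (Gp - (\<kappa>1 * \<kappa>2) *\<^sub>R Gm) \<and>
            Gp - Gm \<in> Domain (quasi_kernel_of \<Theta>)))"

text \<open>
  \<open>companion_I \<Theta> \<Theta>' \<nu>\<close>: the system \<open>\<Theta>'\<close> has the symmetric and main operators of \<open>\<Theta>\<close>, satisfies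
  Hypothesis I, and its transfer function is \<open>\<nu>\<close> times that of \<open>\<Theta>\<close>. If the von Neumann parameter
  is zero, the main operator does not fix the relative phase of \<open>g\<^sub>\<plusminus>\<close>, whence the clause that
  the vectors of Hypothesis II are kept.
\<close>

definition companion_I ::
    "'a::chilbert_space l_system \<Rightarrow> 'a l_system \<Rightarrow> complex \<Rightarrow> bool" where
  "companion_I \<Theta> \<Theta>' \<nu> \<longleftrightarrow>
     L_system \<Theta>' \<and> sym_op \<Theta>' = sym_op \<Theta> \<and> main_op \<Theta>' = main_op \<Theta> \<and>
     (\<exists>\<kappa> gp gm. hypothesis_I_with \<Theta>' \<kappa> gp gm \<and>
        (hypothesis_II \<Theta> \<longrightarrow> hypothesis_II_with \<Theta> \<kappa> gp gm)) \<and>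
     cmod \<nu> = 1 \<and>
     (\<forall>z\<in>resolvent_set (main_op \<Theta>). transfer_fun \<Theta>' z = \<nu> * transfer_fun \<Theta> z)"

definition coupling ::
    "'a::chilbert_space l_system \<Rightarrow> 'b::chilbert_space l_system \<Rightarrow> ('a \<times> 'b) l_system \<Rightarrow> bool" where
  "coupling \<Theta>1 \<Theta>2 \<Theta> \<longleftrightarrow>
     (\<exists>\<Theta>1' \<Theta>2' \<Theta>' \<nu>1 \<nu>2.
        companion_I \<Theta>1 \<Theta>1' \<nu>1 \<and> companion_I \<Theta>2 \<Theta>2' \<nu>2 \<and> coupling_I \<Theta>1' \<Theta>2' \<Theta>' \<and>
        L_system \<Theta> \<and> sym_op \<Theta> = sym_op \<Theta>' \<and> main_op \<Theta> = main_op \<Theta>' \<and>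
        (\<forall>z\<in>resolvent_set (main_op \<Theta>).
           transfer_fun \<Theta> z = inverse (\<nu>1 * \<nu>2) * transfer_fun \<Theta>' z))"

end

(*
  An L-system with von Neumann parameter k that satisfies Hypothesis I has
    V(z) = m (z + (1 + z^2) (R(z) g, g)),   m = (1 - k) / (1 + k),
  where g = g_+ and R is the resolvent of the quasi-kernel; Hypothesis II is the same with
  g_- and k replaced by their negatives. The Herglotz measure of V comes from the spectral
  measure of the Cayley transform of the quasi-kernel (Fejer means and Helly selection); it has
  no atom at infinity because the quasi-kernel is densely defined, and it is infinite because
  the symmetric operator is. So the theorem needs no multiplication formula for transfer
  functions: it suffices to find the von Neumann parameter of the coupling and to show that
  its quasi-kernel contains G_+ - G_-. Both are read off from V(i) = i m and W(-i) = k, which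
  also give nu_1 = nu_2 = -1 unless k1 k2 = 0, in which case the phase of G_- is free.
*)

theory Submission
  imports Defs "HOL-Probability.Probability"
begin

text \<open>The channel vector lies only in the negative space, and the inverses in V and W are not
  constructed there. Instead g_+ and g_- are themselves, up to scalars, the solutions at i and at
  -i: on g_+ - g_- the real part is known from the quasi-kernel, on g_+ - k g_- the whole operator
  is known from T, and eliminating one of the two vectors leaves a multiple of the channel vector. A
  resolvent identity then carries the solution at i to every nonreal z, using only the resolvent of
  the quasi-kernel in the Hilbert space. The obstacle is that the quasi-kernel of the coupling is
  given only through its transfer function: a priori its domain contains G_+ - u G_- for an unknown
  unimodular u. Absorbing u into G_- turns the parameter k = k1 k2 into k times the conjugate of u,
  which is why the locales below admit any complex parameter of modulus less than one. The relation
  between the parameter and W(-i) is proved in that generality; for nonzero k it is compatible with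
  W(-i) = k only if u = 1. The negative parameters that come from Hypothesis II fit the same
  locales.\<close>

section \<open>Complex inner products\<close>

lemma scaleC_one [simp]: "1 *\<^sub>C (x::'a::complex_inner) = x"
  by (rule cvec.scale_one)

lemmas scaleC_simps = cvec.scale_right_diff_distrib cvec.scale_left_diff_distrib
  cvec.scale_scale cvec.scale_right_distrib cvec.scale_left_distrib

lemma cinner_scaleC_right: "cinner x (a *\<^sub>C y) = cnj a * cinner x y"
  by (metis cinner_commute cinner_scaleC_left complex_cnj_mult)

lemma cinner_add_right: "cinner x (y + z) = cinner x y + cinner x z"
  by (metis cinner_commute cinner_add_left complex_cnj_add)

lemma cinner_zero_left [simp]: "cinner 0 x = 0"
  using cinner_add_left[of 0 0 x] by simp

lemma cinner_zero_right [simp]: "cinner x 0 = 0"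
  using cinner_add_right[of x 0 0] by simp

lemma cinner_minus_left: "cinner (- x) y = - cinner x y"
  by (metis add.inverse_unique add.right_inverse cinner_add_left cinner_zero_left)

lemma cinner_minus_right: "cinner x (- y) = - cinner x y"
  by (metis add.inverse_unique add.right_inverse cinner_add_right cinner_zero_right)

lemma cinner_diff_left: "cinner (x - y) z = cinner x z - cinner y z"
  by (simp add: cinner_add_left cinner_minus_left diff_conv_add_uminus del: add_uminus_conv_diff)

lemma cinner_diff_right: "cinner x (y - z) = cinner x y - cinner x z"
  by (simp add: cinner_add_right cinner_minus_right diff_conv_add_uminus del: add_uminus_conv_diff)

lemma cinner_scaleR_left: "cinner (r *\<^sub>R x) y = of_real r * cinner x y"
  by (simp add: scaleR_eq_scaleC cinner_scaleC_left)

lemma cinner_scaleR_right: "cinner x (r *\<^sub>R y) = of_real r * cinner x y"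
  by (simp add: scaleR_eq_scaleC cinner_scaleC_right)

lemma cinner_sum_left: "cinner (sum f S) y = (\<Sum>i\<in>S. cinner (f i) y)"
  by (induction S rule: infinite_finite_induct) (auto simp: cinner_add_left)

lemma cinner_sum_right: "cinner y (sum f S) = (\<Sum>i\<in>S. cinner y (f i))"
  by (induction S rule: infinite_finite_induct) (auto simp: cinner_add_right)

lemmas cinner_simps = cinner_add_left cinner_add_right cinner_diff_left cinner_diff_right
  cinner_minus_left cinner_minus_right cinner_scaleC_left cinner_scaleC_right
  cinner_scaleR_left cinner_scaleR_right

lemma cinner_self: "cinner x x = of_real ((norm x)\<^sup>2)"
proof -
  have "Im (cinner x x) = 0"
    by (metis cinner_commute cnj.simps(2) neg_equal_zero)
  moreover have "Re (cinner x x) = (norm x)\<^sup>2"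
    by (simp add: inner_eq_Re_cinner[symmetric] power2_norm_eq_inner)
  ultimately show ?thesis
    by (simp add: complex_eq_iff)
qed

lemma norm_scaleC: "norm (a *\<^sub>C x) = cmod a * norm x"
proof -
  have "complex_of_real ((norm (a *\<^sub>C x))\<^sup>2) = of_real ((cmod a * norm x)\<^sup>2)"
    unfolding cinner_self[symmetric] power_mult_distrib of_real_mult
    by (simp only: cinner_simps complex_norm_square mult_ac)
  then show ?thesis
    unfolding of_real_eq_iff by (simp add: power2_eq_iff_nonneg)
qed

lemma cmod_cinner_le: "cmod (cinner x y) \<le> norm x * norm y"
proof (cases "cinner x y = 0")
  case False
  define a where "a = cnj (sgn (cinner x y))"
  have "cmod a = 1"
    using False by (simp add: a_def norm_sgn)
  have "a * cinner x y = of_real (cmod (cinner x y))"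
    using False unfolding a_def sgn_eq
    by (simp add: complex_norm_square[symmetric] power2_eq_square mult.commute)
  then have "cmod (cinner x y) = inner (a *\<^sub>C x) y"
    by (simp add: inner_eq_Re_cinner cinner_simps)
  also have "\<dots> \<le> norm (a *\<^sub>C x) * norm y"
    by (rule norm_cauchy_schwarz)
  finally show ?thesis
    by (simp add: norm_scaleC \<open>cmod a = 1\<close>)
qed simp

lemma bounded_bilinear_cinner: "bounded_bilinear cinner"
  by standard
    (auto simp: cinner_simps scaleR_conv_of_real intro!: exI[of _ 1] cmod_cinner_le)

lemmas tendsto_cinner [tendsto_intros] = bounded_bilinear.tendsto[OF bounded_bilinear_cinner]
lemmas continuous_on_cinner [continuous_intros] =
  bounded_bilinear.continuous_on[OF bounded_bilinear_cinner]

lemma bounded_linear_scaleC: "bounded_linear (\<lambda>x. a *\<^sub>C x)"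
  by (rule bounded_linear_intro[where K = "cmod a"])
    (auto simp: scaleC_add_right scaleR_eq_scaleC scaleC_scaleC mult.commute norm_scaleC)

lemmas tendsto_scaleC [tendsto_intros] = bounded_linear.tendsto[OF bounded_linear_scaleC]

lemma dense_cinner_eq_zero:
  assumes "UNIV \<subseteq> closure D" and "\<And>f. f \<in> D \<Longrightarrow> cinner f h = 0"
  shows "h = 0"
proof -
  obtain f where f: "\<And>n. f n \<in> D" "f \<longlonglongrightarrow> h"
    using assms(1) by (metis UNIV_I closure_sequential subsetD)
  have "(\<lambda>n. cinner (f n) h) \<longlonglongrightarrow> cinner h h"
    by (intro tendsto_intros f)
  then have "cinner h h = 0"
    using f(1) assms(2) by (simp add: LIMSEQ_const_iff)
  then show ?thesis
    by (simp add: cinner_self)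
qed

text \<open>A minimising sequence for the distance from \<open>h\<close> to \<open>N\<close>
  converges, and minimality of its limit makes the remainder orthogonal to \<open>N\<close>.\<close>

lemma closed_subspace_projection:
  fixes N :: "'a::chilbert_space set"
  assumes N: "cvec.subspace N" "closed N"
  obtains p where "p \<in> N" "\<And>y. y \<in> N \<Longrightarrow> cinner (h - p) y = 0"
proof -
  have ne: "N \<noteq> {}"
    using N(1) cvec.subspace_0 by blast
  define d where "d = infdist h N"
  have d0: "0 \<le> d"
    by (simp add: d_def infdist_nonneg)
  have le: "d \<le> norm (h - y)" if "y \<in> N" for y
    using infdist_le[OF that, of h] by (simp add: d_def dist_norm)
  have "\<exists>y\<in>N. (norm (h - y))\<^sup>2 < d\<^sup>2 + e" if "0 < e" for e
  proof -
    have "d < sqrt (d\<^sup>2 + e)"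
      using that d0 by (simp add: real_less_rsqrt)
    then obtain y where y: "y \<in> N" "dist h y < sqrt (d\<^sup>2 + e)"
      unfolding d_def infdist_notempty[OF ne] by (subst (asm) cINF_less_iff) (auto simp: ne)
    then have "(norm (h - y))\<^sup>2 < (sqrt (d\<^sup>2 + e))\<^sup>2"
      by (intro power_strict_mono) (auto simp: dist_norm)
    then show ?thesis
      using y(1) that by auto
  qed
  note * = this
  obtain y where y: "y n \<in> N" "(norm (h - y n))\<^sup>2 < d\<^sup>2 + 1 / real (Suc n)" for n
  proof -
    from * have "\<forall>n. \<exists>y\<in>N. (norm (h - y))\<^sup>2 < d\<^sup>2 + 1 / real (Suc n)"
      by simp
    then show ?thesis
      using that by metis
  qed
  \<comment> \<open>The midpoint of \<open>y n\<close> and \<open>y m\<close> lies in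
    \<open>N\<close>, hence at distance at least \<open>d\<close> from \<open>h\<close>; the
    parallelogram law turns this into a bound on the gap.\<close>
  have "(norm (y n - y m))\<^sup>2 \<le> 2 / real (Suc n) + 2 / real (Suc m)" for n m
  proof -
    have "(1/2) *\<^sub>R (y n + y m) \<in> N"
      by (simp add: scaleR_eq_scaleC N(1) cvec.subspace_add cvec.subspace_scale y(1))
    then have "d\<^sup>2 \<le> (norm (h - (1/2) *\<^sub>R (y n + y m)))\<^sup>2"
      using le d0 by (intro power_mono) auto
    also have "4 * \<dots> = 2 * (norm (h - y n))\<^sup>2 + 2 * (norm (h - y m))\<^sup>2 - (norm (y n - y m))\<^sup>2"
      by (simp add: power2_norm_eq_inner inner_simps inner_commute algebra_simps)
    finally show ?thesis
      using y(2)[of n] y(2)[of m] by linarith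
  qed
  note par = this
  have "Cauchy y"
  proof (rule metric_CauchyI)
    fix e :: real
    assume "0 < e"
    then obtain M where M: "inverse (real (Suc M)) < e\<^sup>2 / 4"
      using reals_Archimedean[of "e\<^sup>2/4"] by auto
    show "\<exists>M. \<forall>m\<ge>M. \<forall>n\<ge>M. dist (y m) (y n) < e"
    proof (intro exI allI impI)
      fix m n
      assume "m \<ge> M" "n \<ge> M"
      then have "inverse (real (Suc m)) \<le> inverse (real (Suc M))"
        "inverse (real (Suc n)) \<le> inverse (real (Suc M))"
        by auto
      then have "(norm (y m - y n))\<^sup>2 < e\<^sup>2"
        using par[of m n, unfolded divide_inverse] M by linarith
      then show "dist (y m) (y n) < e"
        using \<open>0 < e\<close> by (simp add: dist_norm power_less_imp_less_base)
    qed
  qed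
  then obtain p where p: "y \<longlonglongrightarrow> p"
    using Cauchy_convergent convergent_def by blast
  have pN: "p \<in> N"
    using closed_sequentially[OF N(2)] y(1) p by blast
  have "(\<lambda>n. (norm (h - y n))\<^sup>2) \<longlonglongrightarrow> (norm (h - p))\<^sup>2"
    by (intro tendsto_intros p)
  moreover have "(\<lambda>n. d\<^sup>2 + 1 / real (Suc n)) \<longlonglongrightarrow> d\<^sup>2 + 0"
    by (intro tendsto_intros LIMSEQ_Suc[OF lim_1_over_n])
  ultimately have "(norm (h - p))\<^sup>2 \<le> d\<^sup>2 + 0"
    by (rule LIMSEQ_le) (use y(2) less_imp_le in blast)
  then have pd: "(norm (h - p))\<^sup>2 \<le> d\<^sup>2"
    by simp
  have "cinner (h - p) x = 0" if "x \<in> N" for x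
  proof (cases "x = 0")
    case False
    define c where "c = cinner (h - p) x"
    \<comment> \<open>\<open>q\<close> is the point nearest to \<open>h\<close> on the complex line
      through \<open>p\<close> in direction \<open>x\<close>. Its squared distance is smaller by
      |c|^2 / |x|^2, which minimality of \<open>p\<close> forbids unless
      \<open>c = 0\<close>.\<close>
    define q where "q = p + (c / of_real ((norm x)\<^sup>2)) *\<^sub>C x"
    have "q \<in> N"
      unfolding q_def using N(1) pN that by (simp add: cvec.subspace_add cvec.subspace_scale)
    have *: "cinner x (h - p) = cnj c"
      unfolding c_def by (rule cinner_commute)
    have **: "h - q = (h - p) - (c / of_real ((norm x)\<^sup>2)) *\<^sub>C x"
      by (simp add: q_def)
    have "complex_of_real ((norm (h - q))\<^sup>2) = of_real ((norm (h - p))\<^sup>2 - (cmod c)\<^sup>2 / (norm x)\<^sup>2)"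
      unfolding cinner_self[symmetric] **
      unfolding cinner_diff_left[of _ "_ *\<^sub>C _"] cinner_diff_right[of _ _ "_ *\<^sub>C _"]
        cinner_scaleC_left cinner_scaleC_right
      using False
      by (simp add: * c_def[symmetric] cinner_self field_simps power2_eq_square)
        (metis complex_norm_square of_real_power power2_eq_square)
    then have "(norm (h - q))\<^sup>2 = (norm (h - p))\<^sup>2 - (cmod c)\<^sup>2 / (norm x)\<^sup>2"
      unfolding of_real_eq_iff .
    moreover have "d\<^sup>2 \<le> (norm (h - q))\<^sup>2"
      using le[OF \<open>q \<in> N\<close>] d0 by (intro power_mono)
    ultimately have "(cmod c)\<^sup>2 / (norm x)\<^sup>2 \<le> 0"
      using pd by linarith
    then show ?thesis
      using False by (simp add: c_def divide_le_0_iff)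
  qed simp
  then show ?thesis
    using that pN by blast
qed

section \<open>Symmetric operators and their extensions\<close>

lemma is_operatorD:
  assumes "is_operator T"
  shows "(0, 0) \<in> T"
    and "\<And>f h f' h'. (f, h) \<in> T \<Longrightarrow> (f', h') \<in> T \<Longrightarrow> (f + f', h + h') \<in> T"
    and "\<And>f h f' h'. (f, h) \<in> T \<Longrightarrow> (f', h') \<in> T \<Longrightarrow> (f - f', h - h') \<in> T"
    and "\<And>c f h. (f, h) \<in> T \<Longrightarrow> (c *\<^sub>C f, c *\<^sub>C h) \<in> T"
    and "\<And>f h h'. (f, h) \<in> T \<Longrightarrow> (f, h') \<in> T \<Longrightarrow> h = h'"
proof -
  have T: "cvec.subspace T"
    using assms by (simp add: is_operator_def)
  show "(0, 0) \<in> T"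
    using cvec.subspace_0[OF T] by (simp add: zero_prod_def)
  show "(f + f', h + h') \<in> T" if "(f, h) \<in> T" "(f', h') \<in> T" for f h f' h'
    using cvec.subspace_add[OF T that] by simp
  show "(f - f', h - h') \<in> T" if "(f, h) \<in> T" "(f', h') \<in> T" for f h f' h'
    using cvec.subspace_diff[OF T that] by simp
  show "(c *\<^sub>C f, c *\<^sub>C h) \<in> T" if "(f, h) \<in> T" for c f h
    using cvec.subspace_scale[OF T that, of c] by (simp add: scaleC_prod_def)
  show "h = h'" if "(f, h) \<in> T" "(f, h') \<in> T" for f h h'
    using assms that by (auto simp: is_operator_def single_valued_def)
qed

lemma adjoint_opD: "(g, h) \<in> adjoint_op T \<Longrightarrow> (f, k) \<in> T \<Longrightarrow> cinner k g = cinner f h"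
  by (auto simp: adjoint_in_def)

lemma adjoint_op_iff:
  "(g, h) \<in> adjoint_op T \<longleftrightarrow> (\<forall>f k. (f, k) \<in> T \<longrightarrow> cinner k g = cinner f h)"
  by (auto simp: adjoint_in_def)

lemma adjoint_op_antimono: "S \<subseteq> T \<Longrightarrow> adjoint_op T \<subseteq> adjoint_op S"
  by (auto simp: adjoint_in_def)

lemma subspace_adjoint_op: "cvec.subspace (adjoint_op T)"
  by (rule cvec.subspaceI)
    (auto simp: adjoint_op_iff zero_prod_def scaleC_prod_def cinner_simps)

lemma is_operator_adjoint_op:
  assumes "densely_defined_in UNIV T"
  shows "is_operator (adjoint_op T)"
proof -
  have "h = h'" if "(g, h) \<in> adjoint_op T" "(g, h') \<in> adjoint_op T" for g h h'
  proof -
    have "cinner f (h - h') = 0" if "f \<in> Domain T" for f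
      using that adjoint_opD[OF \<open>(g, h) \<in> _\<close>] adjoint_opD[OF \<open>(g, h') \<in> _\<close>]
      by (fastforce simp: cinner_simps)
    then have "h - h' = 0"
      using assms dense_cinner_eq_zero unfolding densely_defined_in_def by metis
    then show ?thesis
      by simp
  qed
  then show ?thesis
    by (auto simp: is_operator_def subspace_adjoint_op single_valued_def)
qed

lemma closed_adjoint_op: "closed (adjoint_op T)"
proof -
  have "adjoint_op T = (\<Inter>q\<in>T. {p. cinner (snd q) (fst p) = cinner (fst q) (snd p)})"
    by (fastforce simp: adjoint_in_def)
  then show ?thesis
    by (auto intro!: closed_INT closed_Collect_eq continuous_intros)
qed

section \<open>Deficiency spaces and ranges\<close>

lemma defect_spaceD: "g \<in> defect_space A z \<Longrightarrow> (g, z *\<^sub>C g) \<in> adjoint_op A"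
  by (simp add: defect_space_def)

lemma subspace_defect_space: "cvec.subspace (defect_space A z)"
proof (rule cvec.subspaceI)
  note sub = subspace_adjoint_op[of A]
  show "0 \<in> defect_space A z"
    using cvec.subspace_0[OF sub] by (simp add: defect_space_def zero_prod_def)
  show "x + y \<in> defect_space A z" if "x \<in> defect_space A z" "y \<in> defect_space A z" for x y
    using cvec.subspace_add[OF sub that[THEN defect_spaceD]]
    by (simp add: defect_space_def scaleC_add_right)
  show "c *\<^sub>C x \<in> defect_space A z" if "x \<in> defect_space A z" for c x
    using cvec.subspace_scale[OF sub defect_spaceD[OF that], of c]
    by (simp add: defect_space_def scaleC_prod_def mult.commute)
qed

lemma one_dim_subspace:
  assumes "cvec.dim V = 1" "cvec.subspace V" "v \<in> V" "v \<noteq> 0" "x \<in> V"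
  obtains c where "x = c *\<^sub>C v"
proof -
  obtain B where B: "B \<subseteq> V" "V \<subseteq> cvec.span B" "card B = 1"
    using cvec.basis_exists[of V] assms(1) by metis
  then obtain b where b: "B = {b}"
    by (meson card_1_singletonE)
  obtain k l where k: "v = k *\<^sub>C b" "x = l *\<^sub>C b"
    using B(2) assms(3,5) unfolding b cvec.span_singleton by blast
  then have "x = (l / k) *\<^sub>C v"
    using assms(4) by (auto simp: cvec.scale_scale)
  then show ?thesis
    using that by blast
qed

text \<open>Symmetry makes \<open>cinner k f\<close> real, so the imaginary part of
  \<open>cinner (k - z *\<^sub>C f) f\<close> comes from \<open>z\<close> alone; then
  Cauchy-Schwarz. The bound later serves for closed ranges, for uniqueness of resolvents and for
  their norm estimate.\<close>

lemma cinner_symmetric_diff: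
  assumes "A \<subseteq> adjoint_op A" "(f, k) \<in> A"
  shows "\<bar>Im z\<bar> * norm f \<le> norm (k - z *\<^sub>C f)"
proof -
  have "cinner k f = cnj (cinner k f)"
    using adjoint_opD[of f k A f k] assms by (metis cinner_commute subsetD)
  then have "Im (cinner k f) = 0"
    by (metis cnj.simps(2) neg_equal_zero)
  then have "\<bar>Im z\<bar> * (norm f)\<^sup>2 = \<bar>Im (cinner (k - z *\<^sub>C f) f)\<bar>"
    by (simp add: cinner_simps cinner_self abs_mult)
  also have "\<dots> \<le> norm (k - z *\<^sub>C f) * norm f"
    by (meson abs_Im_le_cmod cmod_cinner_le order_trans)
  finally show ?thesis
    by (cases "f = 0") (auto simp: power2_eq_square)
qed

text \<open>The lower bound on A - z and the closedness of \<open>A\<close> make the range of A - z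
  closed. The remainder of \<open>h\<close> after projection onto it is orthogonal to that range,
  which is exactly membership in the deficiency space at \<open>cnj z\<close>.\<close>

lemma range_plus_defect:
  fixes A :: "'a::chilbert_space graph"
  assumes A: "is_operator A" "closed A" "A \<subseteq> adjoint_op A" and z: "Im z \<noteq> 0"
  obtains f k g where "(f, k) \<in> A" "g \<in> defect_space A (cnj z)" "h = k - z *\<^sub>C f + g"
proof -
  note op = is_operatorD[OF A(1)]
  define N where "N = (\<lambda>(f, k). k - z *\<^sub>C f) ` A"
  have NI: "k - z *\<^sub>C f \<in> N" if "(f, k) \<in> A" for f k
    using that by (force simp: N_def)
  have NE: "\<exists>f k. (f, k) \<in> A \<and> x = k - z *\<^sub>C f" if "x \<in> N" for x
    using that by (force simp: N_def)
  have "cvec.subspace N"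
  proof (rule cvec.subspaceI)
    show "0 \<in> N"
      using NI[OF op(1)] by simp
    show "x + y \<in> N" if "x \<in> N" "y \<in> N" for x y
    proof -
      obtain f k where "(f, k) \<in> A" "x = k - z *\<^sub>C f"
        using NE[OF \<open>x \<in> N\<close>] by blast
      moreover obtain f' k' where "(f', k') \<in> A" "y = k' - z *\<^sub>C f'"
        using NE[OF \<open>y \<in> N\<close>] by blast
      moreover have "k + k' - z *\<^sub>C (f + f') = (k - z *\<^sub>C f) + (k' - z *\<^sub>C f')"
        by (simp add: scaleC_simps algebra_simps)
      ultimately show ?thesis
        using NI[OF op(2)[of f k f' k']] by (simp only:)
    qed
    show "c *\<^sub>C x \<in> N" if "x \<in> N" for c x
    proof -
      obtain f k where "(f, k) \<in> A" "x = k - z *\<^sub>C f"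
        using NE[OF \<open>x \<in> N\<close>] by blast
      then show ?thesis
        using NI[OF op(4)[of f k c]] by (simp add: scaleC_simps mult.commute)
    qed
  qed
  moreover have "closed N"
    unfolding closed_sequential_limits
  proof (intro allI impI, elim conjE)
    fix x l
    assume x: "\<forall>n. x n \<in> N" "x \<longlonglongrightarrow> l"
    then have "\<forall>n. \<exists>p. p \<in> A \<and> x n = snd p - z *\<^sub>C fst p"
      by (fastforce simp: N_def)
    then obtain p where p: "\<And>n. p n \<in> A" "\<And>n. x n = snd (p n) - z *\<^sub>C fst (p n)"
      by metis
    have "Cauchy (\<lambda>n. fst (p n))"
    proof (rule metric_CauchyI)
      fix e :: real
      assume "0 < e"
      then have "0 < e * \<bar>Im z\<bar>"
        using z by simp
      moreover have "Cauchy x"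
        using x(2) LIMSEQ_imp_Cauchy by blast
      ultimately obtain M where M: "dist (x m) (x n) < e * \<bar>Im z\<bar>" if "m \<ge> M" "n \<ge> M" for m n
        by (meson metric_CauchyD)
      have "dist (fst (p m)) (fst (p n)) < e" if "m \<ge> M" "n \<ge> M" for m n
      proof -
        have "(fst (p m) - fst (p n), snd (p m) - snd (p n)) \<in> A"
          using op(3) p(1) by (metis prod.collapse)
        from cinner_symmetric_diff[OF A(3) this, of z]
        have "\<bar>Im z\<bar> * dist (fst (p m)) (fst (p n)) \<le> dist (x m) (x n)"
          by (simp add: p(2) dist_norm scaleC_simps algebra_simps)
        also have "\<dots> < \<bar>Im z\<bar> * e"
          using M[OF that] by (simp add: mult.commute)
        finally show ?thesis
          using z by simp
      qed
      then show "\<exists>M. \<forall>m\<ge>M. \<forall>n\<ge>M. dist (fst (p m)) (fst (p n)) < e"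
        by blast
    qed
    then obtain f where f: "(\<lambda>n. fst (p n)) \<longlonglongrightarrow> f"
      using Cauchy_convergent convergent_def by blast
    have "(\<lambda>n. x n + z *\<^sub>C fst (p n)) \<longlonglongrightarrow> l + z *\<^sub>C f"
      by (intro tendsto_intros f x)
    then have "(\<lambda>n. (fst (p n), snd (p n))) \<longlonglongrightarrow> (f, l + z *\<^sub>C f)"
      by (intro tendsto_Pair f) (simp add: p(2))
    then have "(f, l + z *\<^sub>C f) \<in> A"
      using closed_sequentially[OF A(2)] p(1) by force
    then show "l \<in> N"
      using NI[of f "l + z *\<^sub>C f"] by simp
  qed
  ultimately obtain q where q: "q \<in> N" "\<And>y. y \<in> N \<Longrightarrow> cinner (h - q) y = 0"
    using closed_subspace_projection by blast
  obtain f k where fk: "(f, k) \<in> A" "q = k - z *\<^sub>C f"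
    using q(1) by (auto simp: N_def)
  have "cinner k' (h - q) = cinner f' (cnj z *\<^sub>C (h - q))" if "(f', k') \<in> A" for f' k'
  proof -
    have "cinner (k' - z *\<^sub>C f') (h - q) = 0"
      using q(2)[OF NI[OF that]] by (metis cinner_commute complex_cnj_zero)
    then show ?thesis
      by (simp add: cinner_diff_left cinner_scaleC_left cinner_scaleC_right)
  qed
  then have "h - q \<in> defect_space A (cnj z)"
    by (auto simp: defect_space_def adjoint_in_def)
  then show ?thesis
    using that fk by (metis add.commute diff_add_cancel)
qed

lemma self_adjointD:
  assumes "self_adjoint_in UNIV B"
  shows "is_operator B" "closed B" "B = adjoint_op B" "UNIV \<subseteq> closure (Domain B)"
  using assms closed_adjoint_op[of B] by (auto simp: self_adjoint_in_def densely_defined_in_def)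

lemma self_adjoint_surj:
  fixes B :: "'a::chilbert_space graph"
  assumes B: "self_adjoint_in UNIV B" and z: "Im z \<noteq> 0"
  obtains f where "(f, h + z *\<^sub>C f) \<in> B"
proof -
  note sa = self_adjointD[OF B]
  obtain f k g where *: "(f, k) \<in> B" "g \<in> defect_space B (cnj z)" "h = k - z *\<^sub>C f + g"
    using range_plus_defect[OF sa(1,2) _ z] sa(3) by blast
  have "(g, cnj z *\<^sub>C g) \<in> B"
    using *(2) sa(3) by (auto simp: defect_space_def)
  then have "\<bar>Im (cnj z)\<bar> * norm g \<le> norm (cnj z *\<^sub>C g - cnj z *\<^sub>C g)"
    by (intro cinner_symmetric_diff[of B]) (use sa in auto)
  then have "g = 0"
    using z by (auto simp: mult_le_0_iff)
  then show ?thesis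
    using * that[of f] by simp
qed

text \<open>
  Writing \<open>k\<^sub>n = h\<^sub>n - \<i> f\<^sub>n\<close>, this sequence is bounded and tends weakly to \<open>0\<close>, since the
  domain of \<open>A\<close> is dense; hence \<open>(f\<^sub>n, k\<^sub>n) \<rightarrow> 0\<close>, whereas its imaginary part is \<open>\<parallel>f\<^sub>n\<parallel>\<^sup>2\<close>.
\<close>

lemma bounded_images_limit_defect:
  assumes A: "UNIV \<subseteq> closure (Domain A)" "A \<subseteq> B" and B: "B \<subseteq> adjoint_op B"
    and g: "g \<in> defect_space A \<i>"
    and f: "\<And>n. (f n, h n) \<in> B" "f \<longlonglongrightarrow> g" and bdd: "\<And>n. norm (h n) \<le> C"
  shows "g = 0"
proof -
  define k where "k n = h n - \<i> *\<^sub>C f n" for n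
  obtain F where F: "\<And>n. norm (f n) \<le> F"
    using f(2) by (meson convergentI convergent_imp_bounded bounded_pos bounded_iff rangeI)
  have kb: "norm (k n) \<le> C + F" for n
    unfolding k_def using norm_triangle_ineq4[of "h n" "\<i> *\<^sub>C f n"] bdd[of n] F[of n]
    by (simp add: norm_scaleC)
  have CF: "0 \<le> C + F"
    using kb[of 0] norm_ge_zero order_trans by blast
  \<comment> \<open>The added 1 keeps \<open>S\<close> positive, so that it can serve as a
    divisor.\<close>
  define S where "S = C + F + 1"
  have S: "0 < S"
    using CF by (simp add: S_def)
  \<comment> \<open>Moving the operator onto \<open>x\<close> leaves only \<open>f n\<close>, which
    converges; the two limits cancel because \<open>g\<close> is an eigenvector of the adjoint of
    \<open>A\<close> at i.\<close>
  have dom: "(\<lambda>n. cinner x (k n)) \<longlonglongrightarrow> 0" if "(x, x') \<in> A" for x x'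
  proof -
    have "cinner x' (f n) = cinner x (h n)" for n
      by (rule adjoint_opD) (use that A(2) B f(1)[of n] in blast)+
    then have "cinner x (k n) = cinner x' (f n) + \<i> * cinner x (f n)" for n
      by (simp add: k_def cinner_simps)
    moreover have "(\<lambda>n. cinner x' (f n) + \<i> * cinner x (f n)) \<longlonglongrightarrow> cinner x' g + \<i> * cinner x g"
      by (intro tendsto_intros f)
    moreover have "cinner x' g = cinner x (\<i> *\<^sub>C g)"
      using adjoint_opD[OF defect_spaceD[OF g] that] .
    ultimately show ?thesis
      by (simp add: cinner_simps)
  qed
  have weak: "(\<lambda>n. cinner g (k n)) \<longlonglongrightarrow> 0"
  proof (rule LIMSEQ_I)
    fix e :: real
    assume "0 < e"
    then have "0 < e / (2 * S)"
      using S by simp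
    then obtain x where x: "x \<in> Domain A" "dist x g < e / (2 * S)"
      using A(1) by (meson UNIV_I closure_approachable subsetD)
    obtain M where M: "cmod (cinner x (k n)) < e / 2" if "n \<ge> M" for n
      using dom x(1) LIMSEQ_D[of "\<lambda>n. cinner x (k n)" 0 "e/2"] \<open>0 < e\<close> by force
    have "norm (cinner g (k n) - 0) < e" if "n \<ge> M" for n
    proof -
      have "cinner g (k n) = cinner x (k n) - cinner (x - g) (k n)"
        by (simp add: cinner_simps)
      then have "norm (cinner g (k n)) \<le> cmod (cinner x (k n)) + norm (x - g) * norm (k n)"
        by (metis add_left_mono cmod_cinner_le norm_triangle_ineq4 order_trans)
      also have "norm (x - g) * norm (k n) \<le> (e / (2 * S)) * S"
        using x(2) kb[of n] S \<open>0 < e\<close> by (intro mult_mono) (auto simp: dist_norm S_def)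
      also have "\<dots> = e / 2"
        using S by simp
      finally show ?thesis
        using M[OF that] by simp
    qed
    then show "\<exists>M. \<forall>n\<ge>M. norm (cinner g (k n) - 0) < e"
      by blast
  qed
  \<comment> \<open>Strong convergence of \<open>f n\<close> against the bounded \<open>k n\<close>
    allows \<open>g\<close> to be replaced by \<open>f n\<close> in the weak limit.\<close>
  have "(\<lambda>n. cinner (f n - g) (k n)) \<longlonglongrightarrow> 0"
  proof (rule Lim_null_comparison)
    show "\<forall>\<^sub>F n in sequentially. norm (cinner (f n - g) (k n)) \<le> norm (f n - g) * (C + F)"
      by (intro always_eventually allI order_trans[OF cmod_cinner_le] mult_left_mono kb) auto
    have "(\<lambda>n. norm (f n - g) * (C + F)) \<longlonglongrightarrow> norm (g - g) * (C + F)"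
      by (intro tendsto_intros f)
    then show "(\<lambda>n. norm (f n - g) * (C + F)) \<longlonglongrightarrow> 0"
      by simp
  qed
  from tendsto_add[OF this weak] have "(\<lambda>n. cinner (f n) (k n)) \<longlonglongrightarrow> 0"
    by (simp add: cinner_simps)
  then have "(\<lambda>n. Im (cinner (f n) (k n))) \<longlonglongrightarrow> 0"
    using tendsto_Im by fastforce
  moreover have "Im (cinner (f n) (k n)) = (norm (f n))\<^sup>2" for n
  proof -
    have "cinner (f n) (h n) = cnj (cinner (f n) (h n))"
      using adjoint_opD[of "f n" "h n" B "f n" "h n"] f(1) B by (metis cinner_commute subsetD)
    then have "Im (cinner (f n) (h n)) = 0"
      by (metis cnj.simps(2) neg_equal_zero)
    then show ?thesis
      by (simp add: k_def cinner_simps cinner_self)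
  qed
  moreover have "(\<lambda>n. (norm (f n))\<^sup>2) \<longlonglongrightarrow> (norm g)\<^sup>2"
    by (intro tendsto_intros f)
  ultimately have "(norm g)\<^sup>2 = 0"
    using LIMSEQ_unique by fastforce
  then show ?thesis
    by simp
qed

section \<open>L-systems\<close>

lemma cinner_eq_1: "norm x = 1 \<Longrightarrow> cinner x x = 1"
  by (simp add: cinner_self)

locale l_sys =
  fixes \<Theta> :: "'a::chilbert_space l_system"
  assumes L: "L_system \<Theta>"
begin

abbreviation "A \<equiv> sym_op \<Theta>"
abbreviation "T \<equiv> main_op \<Theta>"
abbreviation "\<A> \<equiv> state_op \<Theta>"
abbreviation "\<R> \<equiv> Re_op \<A>"
abbreviation "B \<equiv> quasi_kernel_of \<Theta>"
abbreviation "chn \<equiv> channel \<Theta> 1"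
abbreviation "ks \<equiv> channel_adjoint (channel \<Theta>)"

lemma A_sym: "is_operator A" "closed A" "A \<subseteq> adjoint_op A" "densely_defined_in UNIV A"
  and A_dim: "cvec.dim (defect_space A \<i>) = 1" "cvec.dim (defect_space A (- \<i>)) = 1"
  and T_props: "is_operator T" "A \<subseteq> T" "T \<subseteq> adjoint_op A"
  and star: "bounded_plus_minus A \<A>" "extends_op A \<A> T"
    "extends_op A (adjoint_pm \<A>) (adjoint_op T)" "A \<subseteq> adjoint_op T"
  and B_sa: "self_adjoint_in UNIV B"
  and K: "bounded_channel A (channel \<Theta>)"
  and Im_op_eq: "f \<in> Hplus A \<Longrightarrow> Im_op \<A> f = channel \<Theta> (ks f)"
  using L by (auto simp: L_system_def symmetric_op_def deficiency_indices_1_1_def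
      Lambda_class_def star_extension_def)

lemma adjoint_unique: "(f, h) \<in> adjoint_op A \<Longrightarrow> (f, h') \<in> adjoint_op A \<Longrightarrow> h = h'"
  using is_operatorD(5)[OF is_operator_adjoint_op[OF A_sym(4)]] .

lemma HplusI: "(f, h) \<in> adjoint_op A \<Longrightarrow> f \<in> Hplus A"
  by (auto simp: Hplus_def)

lemma Hplus_add: "f \<in> Hplus A \<Longrightarrow> g \<in> Hplus A \<Longrightarrow> f + g \<in> Hplus A"
  and Hplus_diff: "f \<in> Hplus A \<Longrightarrow> g \<in> Hplus A \<Longrightarrow> f - g \<in> Hplus A"
  and Hplus_scale: "f \<in> Hplus A \<Longrightarrow> c *\<^sub>C f \<in> Hplus A"
  using is_operatorD(2-4)[OF is_operator_adjoint_op[OF A_sym(4)]]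
  by (fastforce simp: Hplus_def)+

lemma channel_eq: "channel \<Theta> c x = c * chn x"
proof -
  have "channel \<Theta> (c * 1) = (\<lambda>x. c * chn x)"
    using K unfolding bounded_channel_def by blast
  then show ?thesis
    by simp
qed

lemma chi_Hminus: "chn \<in> Hminus A"
  using K by (simp add: bounded_channel_def)

lemma chi_eq: "chn f = cnj (ks f)"
  by (simp add: channel_adjoint_def)

lemma ks_add: "f \<in> Hplus A \<Longrightarrow> g \<in> Hplus A \<Longrightarrow> ks (f + g) = ks f + ks g"
  and ks_scale: "f \<in> Hplus A \<Longrightarrow> ks (c *\<^sub>C f) = c * ks f"
  using chi_Hminus by (auto simp: Hminus_def channel_adjoint_def)

lemma ks_diff:
  assumes "f \<in> Hplus A" "g \<in> Hplus A"
  shows "ks (f - g) = ks f - ks g"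
  using ks_add[of "f - g" g] Hplus_diff assms by simp

lemma state_op_linear:
  assumes "f \<in> Hplus A"
  shows "g \<in> Hplus A \<Longrightarrow> \<A> (f + g) x = \<A> f x + \<A> g x"
    and "\<A> (c *\<^sub>C f) x = c * \<A> f x"
    and "g \<in> Hplus A \<Longrightarrow> h \<in> Hplus A \<Longrightarrow> \<A> f (g + h) = \<A> f g + \<A> f h"
    and "g \<in> Hplus A \<Longrightarrow> \<A> f (c *\<^sub>C g) = cnj c * \<A> f g"
    and "g \<notin> Hplus A \<Longrightarrow> \<A> f g = 0"
  using star(1) assms unfolding bounded_plus_minus_def Hminus_def by simp_all

lemma state_op_diff:
  assumes "f \<in> Hplus A" "g \<in> Hplus A"
  shows "\<A> (f - g) x = \<A> f x - \<A> g x"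
  using state_op_linear(1)[of "f - g" g x] Hplus_diff assms by simp

lemma Re_op_herm: "\<R> f g = cnj (\<R> g f)"
  by (simp add: Re_op_def adjoint_pm_def add.commute)

lemma Re_op_add: "f \<in> Hplus A \<Longrightarrow> g \<in> Hplus A \<Longrightarrow> x \<in> Hplus A \<Longrightarrow> \<R> (f + g) x = \<R> f x + \<R> g x"
  and Re_op_scale: "f \<in> Hplus A \<Longrightarrow> x \<in> Hplus A \<Longrightarrow> \<R> (c *\<^sub>C f) x = c * \<R> f x"
  by (simp_all add: Re_op_def adjoint_pm_def state_op_linear add_divide_distrib distrib_left)

lemma Re_op_diff:
  assumes "f \<in> Hplus A" "g \<in> Hplus A" "x \<in> Hplus A"
  shows "\<R> (f - g) x = \<R> f x - \<R> g x"
  using Re_op_add[of "f - g" g x] Hplus_diff assms by simp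

lemma Re_op_outside:
  assumes "f \<in> Hplus A" "g \<notin> Hplus A"
  shows "\<R> f g = 0"
proof -
  have "\<A> g f = 0"
    using star(1) assms(2) unfolding bounded_plus_minus_def by simp
  then show ?thesis
    using state_op_linear(5)[OF assms] by (simp add: Re_op_def adjoint_pm_def)
qed

text \<open>The imaginary part is the rank-one form built from \<open>ks\<close>. With this
  splitting every computation with the state-space operator reduces to a hermitian form and one
  scalar functional.\<close>

lemma state_op_decomp:
  assumes "f \<in> Hplus A"
  shows "\<A> f g = \<R> f g + \<i> * ks f * cnj (ks g)"
proof -
  have "Im_op \<A> f g = ks f * cnj (ks g)"
    using Im_op_eq[OF assms] channel_eq chi_eq by simp
  then show ?thesis
    by (simp add: Im_op_def Re_op_def field_simps)
qed

section \<open>Pairings with the main operator and the quasi-kernel\<close>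

lemma main_opD:
  assumes "(f, h) \<in> T" "g \<in> Hplus A"
  shows "\<A> f g = cinner h g"
  using star(2) assms by (auto simp: extends_op_def embed_def)

lemma quasi_kernelD:
  assumes "(f, h) \<in> B" "g \<in> Hplus A"
  shows "\<R> f g = cinner h g"
  using assms by (auto simp: quasi_kernel_def embed_def)

text \<open>The state-space operator and its adjoint both extend \<open>A\<close>, since
  \<open>A\<close> is contained in \<open>T\<close> and in the adjoint of \<open>T\<close>; hence so
  does their mean.\<close>

lemma A_subset_B: "A \<subseteq> B"
proof -
  have "\<R> f = embed A h" if "(f, h) \<in> A" for f h
  proof
    fix g
    have "\<A> f = embed A h" "adjoint_pm \<A> f = embed A h"
      using that star T_props by (auto simp: extends_op_def)
    then show "\<R> f g = embed A h g"
      by (simp add: Re_op_def)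
  qed
  then show ?thesis
    using A_sym(3) by (auto simp: quasi_kernel_def Hplus_def)
qed

lemma B_subset: "B \<subseteq> adjoint_op A"
  using adjoint_op_antimono[OF A_subset_B] self_adjointD(3)[OF B_sa] by simp

lemma main_op_Im:
  assumes "(f, h) \<in> T"
  shows "Im (cinner h f) = (cmod (ks f))\<^sup>2"
proof -
  have f: "f \<in> Hplus A"
    using assms T_props(3) HplusI by blast
  have "cnj (\<R> f f) = \<R> f f"
    by (rule Re_op_herm[symmetric])
  then have "Im (\<R> f f) = 0"
    by (metis cnj.simps(2) neg_equal_zero)
  moreover have "cinner h f = \<R> f f + \<i> * of_real ((cmod (ks f))\<^sup>2)"
    using main_opD[OF assms f] state_op_decomp[OF f, of f] by (simp only: complex_norm_square mult.assoc)
  ultimately show ?thesis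
    by simp
qed

lemma dissipative_main_op: "dissipative T"
  using T_props(1) main_op_Im by (auto simp: dissipative_def)

text \<open>The pairing of the state-space operator at \<open>f\<close> with \<open>s\<close> is
  evaluated twice: through \<open>T\<close>, and through the real part plus the rank-one term, where
  hermiticity moves the real part onto \<open>s\<close>.\<close>

lemma main_quasi_pairing:
  assumes "(f, h) \<in> T" "(s, k) \<in> B"
  shows "\<i> * ks f * cnj (ks s) = cinner h s - cinner f k"
proof -
  have f: "f \<in> Hplus A" and s: "s \<in> Hplus A"
    using assms T_props(3) B_subset HplusI by blast+
  have "\<R> f s = cinner f k"
    using quasi_kernelD[OF assms(2) f] Re_op_herm[of f s] cinner_commute[of f k] by simp
  then show ?thesis
    using main_opD[OF assms(1) s] state_op_decomp[OF f, of s]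
    by (simp add: eq_diff_eq add.commute)
qed

text \<open>This discharges the description operator in \<open>solve_pm\<close>: an exhibited
  solution is the value. For the difference \<open>d\<close> of two solutions,
  \<open>\<R> d d\<close> is real and equals \<open>z\<close> times the squared norm of
  \<open>d\<close>, so \<open>d\<close> vanishes.\<close>

lemma solve_Re_op:
  assumes \<phi>: "\<phi> \<in> Hplus A" "\<And>g. g \<in> Hplus A \<Longrightarrow> \<R> \<phi> g - z * cinner \<phi> g = cnj (ks g)"
    and z: "Im z \<noteq> 0"
  shows "solve_pm A \<R> z chn = \<phi>"
  unfolding solve_pm_def
proof (rule the_equality)
  have "\<R> \<phi> g - z * embed A \<phi> g = chn g" for g
    using \<phi> Re_op_outside chi_Hminus
    by (cases "g \<in> Hplus A") (auto simp: embed_def chi_eq[symmetric] Hminus_def)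
  then show "\<phi> \<in> Hplus A \<and> (\<lambda>g. \<R> \<phi> g - z * embed A \<phi> g) = chn"
    using \<phi>(1) by blast
next
  fix f
  assume f: "f \<in> Hplus A \<and> (\<lambda>g. \<R> f g - z * embed A f g) = chn"
  define d where "d = f - \<phi>"
  have d: "d \<in> Hplus A"
    using f \<phi> Hplus_diff by (simp add: d_def)
  have "\<R> f d - z * embed A f d = chn d"
    using f by metis
  then have "\<R> d d = z * cinner d d"
    using \<phi>(2)[OF d] d f \<phi>(1)
    by (simp add: chi_eq embed_def d_def[symmetric] algebra_simps cinner_diff_left
        Re_op_diff[of f \<phi> d, folded d_def] cinner_diff_left[of f \<phi> d, folded d_def])
  moreover have "Im (\<R> d d) = 0"
    using Re_op_herm[of d d] by (metis cnj.simps(2) neg_equal_zero)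
  ultimately have "d = 0"
    using z by (simp add: cinner_self)
  then show "f = \<phi>"
    by (simp add: d_def)
qed

text \<open>As for the real part, but now the form has imaginary part |ks d|^2, which is
  nonnegative; uniqueness therefore uses that \<open>z\<close> is in the lower half-plane.\<close>

lemma solve_state_op:
  assumes \<phi>: "\<phi> \<in> Hplus A" "\<And>g. g \<in> Hplus A \<Longrightarrow> \<A> \<phi> g - z * cinner \<phi> g = cnj (ks g)"
    and z: "Im z < 0"
  shows "solve_pm A \<A> z chn = \<phi>"
  unfolding solve_pm_def
proof (rule the_equality)
  have "\<A> \<phi> g - z * embed A \<phi> g = chn g" for g
    using \<phi> state_op_linear(5) chi_Hminus
    by (cases "g \<in> Hplus A") (auto simp: embed_def chi_eq[symmetric] Hminus_def)
  then show "\<phi> \<in> Hplus A \<and> (\<lambda>g. \<A> \<phi> g - z * embed A \<phi> g) = chn"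
    using \<phi>(1) by blast
next
  fix f
  assume f: "f \<in> Hplus A \<and> (\<lambda>g. \<A> f g - z * embed A f g) = chn"
  define d where "d = f - \<phi>"
  have d: "d \<in> Hplus A"
    using f \<phi> Hplus_diff by (simp add: d_def)
  have "\<A> f d - z * embed A f d = chn d"
    using f by metis
  then have "\<A> d d = z * cinner d d"
    using \<phi>(2)[OF d] d f \<phi>(1)
    by (simp add: chi_eq embed_def d_def[symmetric] algebra_simps
        state_op_diff[of f \<phi> d, folded d_def] cinner_diff_left[of f \<phi> d, folded d_def])
  moreover have "Im (\<R> d d) = 0"
    using Re_op_herm[of d d] by (metis cnj.simps(2) neg_equal_zero)
  moreover have "\<A> d d = \<R> d d + \<i> * of_real ((cmod (ks d))\<^sup>2)"
    using state_op_decomp[OF d, of d] by (simp only: complex_norm_square mult.assoc)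
  ultimately have "Im z * (norm d)\<^sup>2 = (cmod (ks d))\<^sup>2"
    by (simp add: cinner_self complex_eq_iff)
  then have "0 \<le> Im z * (norm d)\<^sup>2"
    by simp
  then have "d = 0"
    using z by (auto simp: zero_le_mult_iff)
  then show "f = \<phi>"
    by (simp add: d_def)
qed

text \<open>Von Neumann's parametrisation of self-adjoint extensions for indices (1,1).\<close>

lemma quasi_kernel_phase:
  assumes gp: "gp \<in> defect_space A \<i>" "norm gp = 1"
    and gm: "gm \<in> defect_space A (- \<i>)" "norm gm = 1"
  obtains u where "cmod u = 1" "gp - u *\<^sub>C gm \<in> Domain B"
proof -
  note op = is_operatorD[OF is_operator_adjoint_op[OF A_sym(4)]]
  \<comment> \<open>A vector \<open>gp + d *\<^sub>C gm\<close> is sent by the adjoint of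
    \<open>A\<close>, plus i, to 2i times \<open>gp\<close>; solving that equation inside the
    quasi-kernel produces such a vector.\<close>
  obtain f where f: "(f, (2 * \<i>) *\<^sub>C gp + (- \<i>) *\<^sub>C f) \<in> B"
    using self_adjoint_surj[OF B_sa, of "- \<i>"] by auto
  have "(f - gp, ((2 * \<i>) *\<^sub>C gp + (- \<i>) *\<^sub>C f) - \<i> *\<^sub>C gp) \<in> adjoint_op A"
    using f B_subset defect_spaceD[OF gp(1)] by (intro op(3)) auto
  also have "(2 * \<i>) *\<^sub>C gp = \<i> *\<^sub>C gp + \<i> *\<^sub>C gp"
    by (simp flip: scaleC_add_left)
  also have "(\<i> *\<^sub>C gp + \<i> *\<^sub>C gp + (- \<i>) *\<^sub>C f) - \<i> *\<^sub>C gp = (- \<i>) *\<^sub>C (f - gp)"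
    by (simp add: cvec.scale_right_diff_distrib)
  finally have "f - gp \<in> defect_space A (- \<i>)"
    by (simp add: defect_space_def)
  then obtain d where d: "f - gp = d *\<^sub>C gm"
    by (rule one_dim_subspace[OF A_dim(2) subspace_defect_space gm(1), rotated]) (use gm in auto)
  then have f_eq: "f = gp + d *\<^sub>C gm"
    by (simp add: algebra_simps)
  define h where "h = (2 * \<i>) *\<^sub>C gp + (- \<i>) *\<^sub>C f"
  \<comment> \<open>Symmetry of the quasi-kernel on this single vector already forces
    \<open>d\<close> to have modulus one.\<close>
  have "cinner h f = cinner f h"
    using f self_adjointD(3)[OF B_sa] adjoint_opD[of f h B f h] by (simp add: h_def)
  then have "1 = d * cnj d"
    unfolding h_def f_eq
    by (simp add: cinner_simps cinner_eq_1 gp gm algebra_simps)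
  then have "(cmod d)\<^sup>2 = 1"
    by (metis complex_norm_square of_real_eq_1_iff)
  then have "cmod d = 1"
    by (metis abs_norm_cancel real_sqrt_abs real_sqrt_one)
  then have "cmod (- d) = 1"
    by simp
  moreover have "gp - (- d) *\<^sub>C gm \<in> Domain B"
    using f by (auto simp: f_eq)
  ultimately show ?thesis
    using that by blast
qed

end

text \<open>The parameter is complex although von Neumann parameters are nonnegative reals:
  replacing \<open>gm\<close> by a unimodular multiple rotates it, and both negative and nonreal
  values occur below.\<close>

locale l_sys_main = l_sys +
  fixes \<kappa> :: complex and gp gm :: 'a
  assumes gp: "gp \<in> defect_space A \<i>" "norm gp = 1"
    and gm: "gm \<in> defect_space A (- \<i>)" "norm gm = 1"
    and kappa: "cmod \<kappa> < 1"
    and T_vec: "gp - \<kappa> *\<^sub>C gm \<in> Domain T"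
begin

section \<open>The main operator on the deficiency vectors\<close>

lemma gp_Hplus: "gp \<in> Hplus A" and gm_Hplus: "gm \<in> Hplus A"
  using gp gm defect_spaceD HplusI by blast+

lemma combination:
  "(gp - c *\<^sub>C gm, \<i> *\<^sub>C gp + (\<i> * c) *\<^sub>C gm) \<in> adjoint_op A"
proof -
  note op = is_operatorD[OF is_operator_adjoint_op[OF A_sym(4)]]
  have "(gp - c *\<^sub>C gm, \<i> *\<^sub>C gp - c *\<^sub>C (- \<i>) *\<^sub>C gm) \<in> adjoint_op A"
    by (rule op(3)[OF defect_spaceD[OF gp(1)] op(4)[OF defect_spaceD[OF gm(1)]]])
  then show ?thesis
    by (simp add: mult.commute)
qed

lemma T_graph: "(gp - \<kappa> *\<^sub>C gm, \<i> *\<^sub>C gp + (\<i> * \<kappa>) *\<^sub>C gm) \<in> T"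
  using T_vec T_props(3) adjoint_unique[OF combination] by blast

text \<open>This is \<open>main_op_Im\<close> at the defining vector of \<open>T\<close>. The
  vectors \<open>gp\<close> and \<open>gm\<close> need not be orthogonal, but their cross terms are
  real and drop out of the imaginary part.\<close>

lemma norm_ks_T: "ks (gp - \<kappa> *\<^sub>C gm) * cnj (ks (gp - \<kappa> *\<^sub>C gm)) = 1 - \<kappa> * cnj \<kappa>"
proof -
  have "cinner (\<i> *\<^sub>C gp + (\<i> * \<kappa>) *\<^sub>C gm) (gp - \<kappa> *\<^sub>C gm) - cnj (cinner (\<i> *\<^sub>C gp + (\<i> * \<kappa>) *\<^sub>C gm) (gp - \<kappa> *\<^sub>C gm))
      = 2 * \<i> * (1 - \<kappa> * cnj \<kappa>)"
    unfolding cinner_commute[symmetric]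
    by (simp add: cinner_simps cinner_eq_1 gp gm algebra_simps)
  then have "(2 * \<i>) * of_real (Im (cinner (\<i> *\<^sub>C gp + (\<i> * \<kappa>) *\<^sub>C gm) (gp - \<kappa> *\<^sub>C gm))) = (2 * \<i>) * (1 - \<kappa> * cnj \<kappa>)"
    by (simp add: complex_eq_iff)
  then show ?thesis
    unfolding main_op_Im[OF T_graph] complex_norm_square
    by (rule mult_left_cancel[THEN iffD1, rotated]) simp
qed

lemma main_op_bound:
  assumes "(f, k) \<in> T"
  shows "norm f \<le> norm (k + \<i> *\<^sub>C f)"
proof -
  have "(norm f)\<^sup>2 \<le> Im (cinner (k + \<i> *\<^sub>C f) f)"
    using main_op_Im[OF assms] by (simp add: cinner_simps cinner_self)
  also have "\<dots> \<le> norm (k + \<i> *\<^sub>C f) * norm f"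
    by (meson abs_Im_le_cmod abs_le_D1 cmod_cinner_le order_trans)
  finally show ?thesis
    by (cases "f = 0") (auto simp: power2_eq_square)
qed

lemma main_op_surj:
  obtains f where "(f, h - \<i> *\<^sub>C f) \<in> T"
proof -
  note op = is_operatorD[OF T_props(1)]
  obtain f k g where fkg: "(f, k) \<in> A" "g \<in> defect_space A (cnj (- \<i>))" "h = k - (- \<i>) *\<^sub>C f + g"
    by (rule range_plus_defect[OF A_sym(1-3), of "- \<i>" h]) simp
  then have "g \<in> defect_space A \<i>"
    by simp
  then obtain d where d: "g = d *\<^sub>C gp"
    by (rule one_dim_subspace[OF A_dim(1) subspace_defect_space gp(1), rotated]) (use gp in auto)
  \<comment> \<open>T + i maps \<open>gp - \<kappa> *\<^sub>C gm\<close> to 2i times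
    \<open>gp\<close>, whence the factor.\<close>
  define c where "c = d / (2 * \<i>)"
  define f' where "f' = f + c *\<^sub>C (gp - \<kappa> *\<^sub>C gm)"
  have "(f', k + c *\<^sub>C (\<i> *\<^sub>C gp + (\<i> * \<kappa>) *\<^sub>C gm)) \<in> T"
    unfolding f'_def using fkg T_props by (intro op(2) op(4) T_graph) auto
  moreover have "g = (\<i> * c) *\<^sub>C gp + (\<i> * c) *\<^sub>C gp"
    unfolding d by (simp add: c_def flip: scaleC_add_left)
  then have "k + c *\<^sub>C (\<i> *\<^sub>C gp + (\<i> * \<kappa>) *\<^sub>C gm) = h - \<i> *\<^sub>C f'"
    unfolding fkg(3) f'_def by (simp add: scaleC_simps mult_ac)
  ultimately show ?thesis
    using that by simp
qed

text \<open>The transfer function identities in \<open>companion_I\<close> and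
  \<open>coupling\<close> are stated on the resolvent set; this makes the point -i available in
  them.\<close>

lemma resolvent_set_main_op: "- \<i> \<in> resolvent_set T"
proof -
  note op = is_operatorD[OF T_props(1)]
  define R where "R h = (SOME f. (f, h - \<i> *\<^sub>C f) \<in> T)" for h
  have R: "(R h, h - \<i> *\<^sub>C R h) \<in> T" for h
    unfolding R_def using main_op_surj[of h] by (metis someI_ex)
  have eq: "R (k + \<i> *\<^sub>C f) = f" if "(f, k) \<in> T" for f k
  proof -
    define e where "e = R (k + \<i> *\<^sub>C f)"
    have "(e - f, (k + \<i> *\<^sub>C f - \<i> *\<^sub>C e) - k) \<in> T"
      unfolding e_def by (intro op(3) R that)
    from main_op_bound[OF this] show ?thesis
      by (simp add: e_def[symmetric] scaleC_simps)
  qed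
  have "bounded_linear R"
  proof (rule bounded_linear_intro[where K = 1])
    show "R (x + y) = R x + R y" for x y
      using eq[OF op(2)[OF R R], of x y] by (simp add: scaleC_simps)
    show "R (r *\<^sub>R x) = r *\<^sub>R R x" for r x
      using eq[OF op(4)[OF R], of "of_real r" x] by (simp add: scaleR_eq_scaleC scaleC_simps mult.commute)
    show "norm (R x) \<le> norm x * 1" for x
      using main_op_bound[OF R, of x] by simp
  qed
  then show ?thesis
    using R eq by (auto simp: resolvent_set_def intro!: exI[of _ R])
qed

text \<open>T + i is onto, so a vector in the domain of a dissipative extension differs from one in
  the domain of \<open>T\<close> by an eigenvector at -i, which dissipativity excludes.\<close>

lemma maximal_dissipative_main_op: "maximal_dissipative T"
  unfolding maximal_dissipative_def
proof (intro conjI dissipative_main_op allI impI, elim conjE)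
  fix S
  assume S: "dissipative S" "T \<subseteq> S"
  note op = is_operatorD[of S]
  have "(f, h) \<in> T" if "(f, h) \<in> S" for f h
  proof -
    obtain e where e: "(e, (h + \<i> *\<^sub>C f) - \<i> *\<^sub>C e) \<in> T"
      using main_op_surj by blast
    have "(f - e, h - ((h + \<i> *\<^sub>C f) - \<i> *\<^sub>C e)) \<in> S"
      using S e that by (intro op(3)) (auto simp: dissipative_def)
    then have "0 \<le> Im (cinner (h - ((h + \<i> *\<^sub>C f) - \<i> *\<^sub>C e)) (f - e))"
      using S(1) by (auto simp: dissipative_def)
    also have "h - ((h + \<i> *\<^sub>C f) - \<i> *\<^sub>C e) = (- \<i>) *\<^sub>C (f - e)"
      by (simp add: scaleC_simps)
    finally have "f = e"
      by (simp add: cinner_minus_left cinner_scaleC_left cinner_self)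
    then show ?thesis
      using e by simp
  qed
  then show "S = T"
    using S(2) by auto
qed

end

locale l_sys_quasi = l_sys_main +
  assumes B_vec: "gp - gm \<in> Domain B"
begin

abbreviation "\<sigma> \<equiv> ks (gp - gm)"
abbreviation "\<tau> \<equiv> ks (gp - \<kappa> *\<^sub>C gm)"

section \<open>Explicit solutions at i and -i\<close>

lemma B_graph: "(gp - gm, \<i> *\<^sub>C gp + \<i> *\<^sub>C gm) \<in> B"
proof -
  have "(gp - gm, \<i> *\<^sub>C gp + \<i> *\<^sub>C gm) \<in> adjoint_op A"
    using combination[of 1] by simp
  then show ?thesis
    using B_vec B_subset adjoint_unique by blast
qed

text \<open>Together with \<open>norm_ks_T\<close> this determines \<open>ks\<close> on
  \<open>gp\<close> and \<open>gm\<close> up to a common phase, which is the freedom in choosing the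
  channel.\<close>

lemma tau_sigma: "\<tau> * cnj \<sigma> = 2 * (1 - \<kappa>)"
proof -
  have "\<i> * (\<tau> * cnj \<sigma>) = \<i> * (2 * (1 - \<kappa>))"
    using main_quasi_pairing[OF T_graph B_graph]
    by (simp add: cinner_simps cinner_eq_1 gp gm algebra_simps)
  then show ?thesis
    by simp
qed

lemma kappa_neq: "\<kappa> \<noteq> 1" "cnj \<kappa> \<noteq> 1"
proof -
  show "\<kappa> \<noteq> 1"
    using kappa by auto
  then show "cnj \<kappa> \<noteq> 1"
    by (metis complex_cnj_cnj complex_cnj_one)
qed

lemma tau_neq: "\<tau> \<noteq> 0" and sigma_neq: "\<sigma> \<noteq> 0"
  using tau_sigma kappa_neq(1) by auto

lemma ks_gp: "(\<kappa> - 1) * ks gp = \<kappa> * \<sigma> - \<tau>"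
  and ks_gm: "(\<kappa> - 1) * ks gm = \<sigma> - \<tau>"
proof -
  have "\<sigma> = ks gp - ks gm" "\<tau> = ks gp - \<kappa> * ks gm"
    by (simp_all only: ks_diff ks_scale gp_Hplus gm_Hplus Hplus_scale)
  then show "(\<kappa> - 1) * ks gp = \<kappa> * \<sigma> - \<tau>" "(\<kappa> - 1) * ks gm = \<sigma> - \<tau>"
    by algebra+
qed

text \<open>Eliminating \<open>gm\<close> between the quasi-kernel relation and the main operator
  relation shows that \<open>gp\<close> is a multiple of the solution for the real part at
  i.\<close>

lemma Re_op_gp:
  assumes "g \<in> Hplus A"
  shows "(\<kappa> - 1) * (\<R> gp g - \<i> * cinner gp g) = \<i> * \<tau> * cnj (ks g)"
proof -
  note H = gp_Hplus gm_Hplus Hplus_scale Hplus_diff assms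
  have "\<R> gp g - \<R> gm g = \<i> * cinner gp g + \<i> * cinner gm g"
    using quasi_kernelD[OF B_graph assms] by (simp add: Re_op_diff H cinner_simps)
  moreover have "\<R> gp g - \<kappa> * \<R> gm g + \<i> * \<tau> * cnj (ks g) = \<i> * cinner gp g + \<i> * \<kappa> * cinner gm g"
    using main_opD[OF T_graph assms] state_op_decomp[of "gp - \<kappa> *\<^sub>C gm" g]
    by (simp add: Re_op_diff Re_op_scale H cinner_simps)
  ultimately show ?thesis
    by algebra
qed

text \<open>Eliminating \<open>gp\<close> instead shows that \<open>gm\<close> is a multiple of the
  solution for the full operator at -i; this makes W(-i) explicitly computable.\<close>

lemma state_op_gm:
  assumes "g \<in> Hplus A"
  shows "(\<kappa> - 1) * (\<A> gm g + \<i> * cinner gm g) = \<i> * \<sigma> * cnj (ks g)"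
proof -
  note H = gp_Hplus gm_Hplus Hplus_scale Hplus_diff assms
  have "\<A> gp g - \<A> gm g = \<i> * cinner gp g + \<i> * cinner gm g + \<i> * \<sigma> * cnj (ks g)"
    using quasi_kernelD[OF B_graph assms] state_op_decomp[of "gp - gm" g]
    by (simp add: state_op_diff H cinner_simps)
  moreover have "\<A> gp g - \<kappa> * \<A> gm g = \<i> * cinner gp g + \<i> * \<kappa> * cinner gm g"
    using main_opD[OF T_graph assms]
    by (simp add: state_op_diff state_op_linear(2) H cinner_simps)
  ultimately show ?thesis
    by algebra
qed

lemma transfer_fun_minus_i:
  "transfer_fun \<Theta> (- \<i>) * (1 - cnj \<kappa>) = cnj \<kappa> * (1 - \<kappa>)"
proof -
  define c where "c = (\<kappa> - 1) / (\<i> * \<sigma>)"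
  have "\<A> (c *\<^sub>C gm) g - (- \<i>) * cinner (c *\<^sub>C gm) g = cnj (ks g)" if "g \<in> Hplus A" for g
  proof -
    have "\<A> (c *\<^sub>C gm) g - (- \<i>) * cinner (c *\<^sub>C gm) g = c * (\<A> gm g + \<i> * cinner gm g)"
      by (simp add: state_op_linear(2) gm_Hplus cinner_scaleC_left distrib_left)
    also have "\<dots> = ((\<kappa> - 1) * (\<A> gm g + \<i> * cinner gm g)) / (\<i> * \<sigma>)"
      by (simp add: c_def)
    finally have "\<A> (c *\<^sub>C gm) g - (- \<i>) * cinner (c *\<^sub>C gm) g
      = ((\<kappa> - 1) * (\<A> gm g + \<i> * cinner gm g)) / (\<i> * \<sigma>)" .
    then show ?thesis
      using sigma_neq by (simp add: state_op_gm[OF that])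
  qed
  then have "solve_pm A \<A> (- \<i>) chn = c *\<^sub>C gm"
    by (intro solve_state_op) (auto simp: gm_Hplus Hplus_scale)
  then have "transfer_fun \<Theta> (- \<i>) = 1 - 2 * (\<i> * (c * ks gm))"
    by (simp add: transfer_fun_def ks_scale gm_Hplus)
  also have "\<i> * (c * ks gm) = (\<sigma> - \<tau>) / \<sigma>"
    unfolding ks_gm[symmetric] c_def using sigma_neq by simp
  finally have W: "transfer_fun \<Theta> (- \<i>) * \<sigma> = 2 * \<tau> - \<sigma>"
    using sigma_neq by (simp add: field_simps)
  have "cnj \<tau> * \<sigma> = 2 * (1 - cnj \<kappa>)"
    using arg_cong[OF tau_sigma, of cnj] by simp
  \<comment> \<open>Multiplication by \<open>cnj \<tau>\<close> removes the unknown phase: only the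
    products known from \<open>tau_sigma\<close> and \<open>norm_ks_T\<close> remain.\<close>
  then have "(transfer_fun \<Theta> (- \<i>) * (1 - cnj \<kappa>)) * 2 = cnj \<tau> * (transfer_fun \<Theta> (- \<i>) * \<sigma>)"
    by (simp add: mult.left_commute[of "cnj _"])
  also have "\<dots> = 2 * (\<tau> * cnj \<tau>) - cnj \<tau> * \<sigma>"
    unfolding W by (simp add: algebra_simps)
  also have "\<dots> = (cnj \<kappa> * (1 - \<kappa>)) * 2"
    unfolding norm_ks_T \<open>cnj \<tau> * \<sigma> = _\<close> by (simp add: algebra_simps)
  finally show ?thesis
    by simp
qed

text \<open>The first resolvent identity applied to the solution at i. Since \<open>gp\<close> lies
  in the Hilbert space, only the ordinary resolvent vector \<open>f\<close> of the quasi-kernel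
  enters.\<close>

lemma impedance_solution:
  assumes f: "(f, gp + z *\<^sub>C f) \<in> B" and z: "Im z \<noteq> 0"
  defines "c \<equiv> (\<kappa> - 1) / (\<i> * \<tau>)"
  defines "\<phi> \<equiv> c *\<^sub>C (gp + (z - \<i>) *\<^sub>C f)"
  shows "\<phi> \<in> Hplus A" "\<And>g. g \<in> Hplus A \<Longrightarrow> \<R> \<phi> g - z * cinner \<phi> g = cnj (ks g)"
    "impedance_fun \<Theta> z = ks \<phi>"
proof -
  have fH: "f \<in> Hplus A"
    using f B_subset HplusI by blast
  note H = gp_Hplus gm_Hplus Hplus_scale Hplus_add fH
  show 1: "\<phi> \<in> Hplus A"
    by (simp add: \<phi>_def H)
  show 2: "\<R> \<phi> g - z * cinner \<phi> g = cnj (ks g)" if "g \<in> Hplus A" for g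
  proof -
    have "\<R> \<phi> g = c * (\<R> gp g + (z - \<i>) * \<R> f g)"
      by (simp add: \<phi>_def Re_op_add Re_op_scale H that)
    moreover have "\<R> f g = cinner gp g + z * cinner f g"
      using quasi_kernelD[OF f that] by (simp add: cinner_simps)
    moreover have "cinner \<phi> g = c * (cinner gp g + (z - \<i>) * cinner f g)"
      by (simp add: \<phi>_def cinner_add_left cinner_scaleC_left)
    ultimately have "\<R> \<phi> g - z * cinner \<phi> g = c * (\<R> gp g - \<i> * cinner gp g)"
      by algebra
    also have "\<dots> = ((\<kappa> - 1) * (\<R> gp g - \<i> * cinner gp g)) / (\<i> * \<tau>)"
      by (simp add: c_def)
    finally show ?thesis
      using tau_neq by (simp add: Re_op_gp[OF that])
  qed
  show "impedance_fun \<Theta> z = ks \<phi>"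
    using solve_Re_op[OF 1 2 z] by (simp add: impedance_fun_def)
qed

text \<open>Pair the equation for the solution with the solution itself: the right-hand side becomes
  the conjugate of V(z), and the hermitian form contributes nothing to the imaginary part.\<close>

lemma Im_impedance:
  assumes f: "(f, gp + z *\<^sub>C f) \<in> B" and z: "Im z \<noteq> 0"
  shows "Im (impedance_fun \<Theta> z) = Im z * ((cmod ((\<kappa> - 1) / \<tau>))\<^sup>2 * (norm (gp + (z - \<i>) *\<^sub>C f))\<^sup>2)"
proof -
  define \<phi> where "\<phi> = ((\<kappa> - 1) / (\<i> * \<tau>)) *\<^sub>C (gp + (z - \<i>) *\<^sub>C f)"
  note sol = impedance_solution[OF assms, folded \<phi>_def]
  have "\<R> \<phi> \<phi> - z * cinner \<phi> \<phi> = cnj (impedance_fun \<Theta> z)"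
    using sol(2)[OF sol(1)] sol(3) by simp
  moreover have "Im (\<R> \<phi> \<phi>) = 0"
    using Re_op_herm[of \<phi> \<phi>] by (metis cnj.simps(2) neg_equal_zero)
  ultimately have "Im (impedance_fun \<Theta> z) = Im z * (norm \<phi>)\<^sup>2"
    by (simp add: complex_eq_iff cinner_self)
  then show ?thesis
    by (simp add: \<phi>_def norm_scaleC norm_divide norm_mult power_mult_distrib power_divide)
qed

text \<open>Conjugating \<open>Re_op_gp\<close> and using hermiticity expresses \<open>ks\<close> on
  the domain of the quasi-kernel B as a scalar times the inner product of (B + i) f with
  \<open>gp\<close>.\<close>

lemma ks_B:
  assumes "(f, h) \<in> B"
  shows "ks f = cnj ((\<kappa> - 1) / (\<i> * \<tau>)) * (cinner h gp + \<i> * cinner f gp)"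
proof -
  have fH: "f \<in> Hplus A"
    using assms B_subset HplusI by blast
  have "cinner h gp = cnj (\<R> gp f)"
    using quasi_kernelD[OF assms gp_Hplus] Re_op_herm[of f gp] by simp
  then have "(cnj \<kappa> - 1) * (cinner h gp + \<i> * cinner f gp) = - \<i> * cnj \<tau> * ks f"
    using arg_cong[OF Re_op_gp[OF fH], of cnj] cinner_commute[of f gp] by simp
  then show ?thesis
    using tau_neq by (simp add: field_simps)
qed

text \<open>Realness of the parameter makes \<open>c * ks gp\<close> equal to i times
  \<open>c * cnj c\<close>, so a single constant can be factored out; a nonreal parameter would
  leave a real additive constant.\<close>

lemma impedance_formula:
  assumes f: "(f, gp + z *\<^sub>C f) \<in> B" and z: "Im z \<noteq> 0" and k: "\<kappa> = of_real k"
  shows "impedance_fun \<Theta> z = of_real ((1 - k) / (1 + k)) * (z + (1 + z\<^sup>2) * cinner f gp)"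
proof -
  define c where "c = (\<kappa> - 1) / (\<i> * \<tau>)"
  have fH: "f \<in> Hplus A"
    using f B_subset HplusI by blast
  note H = gp_Hplus gm_Hplus Hplus_scale Hplus_add fH
  have k1: "\<bar>k\<bar> < 1"
    using kappa by (simp add: k)
  have kn: "1 + complex_of_real k \<noteq> 0" "1 - complex_of_real k \<noteq> 0"
  proof -
    have "complex_of_real (1 + k) \<noteq> 0" "complex_of_real (1 - k) \<noteq> 0"
      unfolding of_real_eq_0_iff using k1 by linarith+
    then show "1 + complex_of_real k \<noteq> 0" "1 - complex_of_real k \<noteq> 0"
      by simp_all
  qed
  have tt: "\<tau> * cnj \<tau> = (1 - of_real k) * (1 + of_real k)"
    using norm_ks_T by (simp add: k algebra_simps)
  have ts: "cnj \<tau> * \<sigma> = 2 * (1 - of_real k)"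
    using arg_cong[OF tau_sigma, of cnj] by (simp add: k)
  have "\<sigma> * (1 + of_real k) * cnj \<tau> = 2 * \<tau> * cnj \<tau>"
    using tt ts by algebra
  then have s: "\<sigma> * (1 + of_real k) = 2 * \<tau>"
    using tau_neq by simp
  have "c * ks gp = (\<kappa> * \<sigma> - \<tau>) / (\<i> * \<tau>)"
    unfolding ks_gp[symmetric] by (simp add: c_def)
  also have "\<dots> = \<i> * ((1 - of_real k) / (1 + of_real k))"
  proof -
    have "(of_real k * \<sigma> - \<tau>) * (1 + of_real k) = - \<tau> * (1 - of_real k)"
      using s by algebra
    then show ?thesis
      using tau_neq kn by (simp add: k field_simps)
  qed
  finally have c1: "c * ks gp = \<i> * ((1 - of_real k) / (1 + of_real k))" .
  have c2: "c * cnj c = (1 - of_real k) / (1 + of_real k)"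
  proof -
    have "c * cnj c = (1 - of_real k)\<^sup>2 / (\<tau> * cnj \<tau>)"
      using tau_neq by (simp add: c_def k field_simps power2_eq_square)
    then show ?thesis
      unfolding tt using kn by (simp add: power2_eq_square)
  qed
  have "impedance_fun \<Theta> z = c * (ks gp + (z - \<i>) * ks f)"
    using impedance_solution(3)[OF f z] by (simp add: c_def ks_scale ks_add H)
  also have "ks f = cnj c * (cinner (gp + z *\<^sub>C f) gp + \<i> * cinner f gp)"
    using ks_B[OF f] by (simp add: c_def)
  also have "cinner (gp + z *\<^sub>C f) gp = 1 + z * cinner f gp"
    by (simp add: cinner_simps cinner_eq_1 gp)
  finally have "impedance_fun \<Theta> z
      = c * ks gp + (c * cnj c) * ((z - \<i>) * (1 + (z + \<i>) * cinner f gp))"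
    by (simp add: algebra_simps)
  also have "\<dots> = (1 - of_real k) / (1 + of_real k) * (\<i> + (z - \<i>) * (1 + (z + \<i>) * cinner f gp))"
    unfolding c1 c2 by (simp add: algebra_simps)
  also have "\<i> + (z - \<i>) * (1 + (z + \<i>) * cinner f gp) = z + (1 + z\<^sup>2) * cinner f gp"
    by (simp add: algebra_simps power2_eq_square)
  finally show ?thesis
    by simp
qed

end

section \<open>The spectral measure of an isometry\<close>

lemma sum_roots_of_unity:
  fixes d :: int
  assumes "\<bar>d\<bar> < int L"
  shows "(\<Sum>j<L. cis (2 * pi * d / L) ^ j) = (if d = 0 then of_nat L else 0)"
proof (cases "d = 0")
  case False
  have L: "0 < real L"
    using assms by linarith
  have "cis (2 * pi * d / L) \<noteq> 1"
  proof
    assume "cis (2 * pi * d / L) = 1"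
    then have "cos (2 * pi * d / L) = 1"
      by (simp add: complex_eq_iff)
    then obtain n :: int where "2 * pi * d / L = n * 2 * pi"
      using cos_one_2pi_int by auto
    then have "real_of_int d = real_of_int (n * int L)"
      using L by (simp add: field_simps)
    then have "d = n * int L"
      by (simp only: of_int_eq_iff)
    then show False
      using assms False by (simp add: abs_mult)
  qed
  moreover have "cis (2 * pi * d / L) ^ L = cis (2 * pi * d)"
    unfolding Complex.DeMoivre using L by (intro arg_cong[where f = cis]) simp
  then have "cis (2 * pi * d / L) ^ L = 1"
    by (simp only:) (simp add: cis_multiple_2pi)
  ultimately show ?thesis
    using False by (simp add: geometric_sum)
qed simp

text \<open>Inner products of iterates depend only on the difference of the exponents. Summing over
  the roots of unity selects the pairs n = m + k, of which there are N - k.\<close>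

lemma fejer_moments:
  fixes U :: "'a::complex_inner \<Rightarrow> 'a"
  assumes iso: "\<And>x y. cinner (U x) (U y) = cinner x y" and N: "k \<le> N" "0 < N"
  defines "\<omega> \<equiv> \<lambda>j d. cis (2 * pi * of_int d / real (2 * N)) ^ j"
  shows "(\<Sum>j<2 * N. of_real ((norm (\<Sum>n<N. \<omega> j (- int n) *\<^sub>C (U ^^ n) g))\<^sup>2 / (2 * N * N)) * \<omega> j (int k))
    = (real (N - k) / real N) *\<^sub>R cinner ((U ^^ k) g) g"
proof -
  define c where "c n m = cinner ((U ^^ n) g) ((U ^^ m) g)" for n m
  have c_shift: "c (k + m) m = c k 0" for m
  proof (induction m)
    case (Suc m)
    then show ?case
      by (simp add: c_def iso)
  qed simp
  have \<omega>_add: "\<omega> j (a + b) = \<omega> j a * \<omega> j b" for j a b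
    by (simp add: \<omega>_def cis_mult add_divide_distrib distrib_left flip: power_mult_distrib)
  have \<omega>_cnj: "cnj (\<omega> j a) = \<omega> j (- a)" for j a
    by (simp add: \<omega>_def cis_cnj)
  have sq: "of_real ((norm (\<Sum>n<N. \<omega> j (- int n) *\<^sub>C (U ^^ n) g))\<^sup>2)
      = (\<Sum>n<N. \<Sum>m<N. \<omega> j (int m - int n) * c n m)" for j
  proof -
    have "of_real ((norm (\<Sum>n<N. \<omega> j (- int n) *\<^sub>C (U ^^ n) g))\<^sup>2)
        = (\<Sum>n<N. \<Sum>m<N. \<omega> j (- int n) * (\<omega> j (int m) * c n m))"
      unfolding cinner_self[symmetric] cinner_sum_left cinner_sum_right
      by (simp add: cinner_scaleC_left cinner_scaleC_right \<omega>_cnj c_def sum_distrib_left)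
        (rule trans[OF sum.swap], simp add: mult_ac)
    moreover have "\<omega> j (- int n) * (\<omega> j (int m) * c n m) = \<omega> j (int m - int n) * c n m" for n m
      using \<omega>_add[of j "int m" "- int n"] by simp
    ultimately show ?thesis
      by simp
  qed
  have "(\<Sum>j<2 * N. of_real ((norm (\<Sum>n<N. \<omega> j (- int n) *\<^sub>C (U ^^ n) g))\<^sup>2) * \<omega> j (int k))
      = (\<Sum>j<2 * N. \<Sum>n<N. \<Sum>m<N. c n m * \<omega> j (int k + int m - int n))"
  proof -
    have "\<omega> j (int m - int n) * c n m * \<omega> j (int k) = c n m * \<omega> j (int k + int m - int n)" for j n m
      using \<omega>_add[of j "int k" "int m - int n"] by (simp add: add_diff_eq mult_ac)
    then show ?thesis
      unfolding sq sum_distrib_right by (simp only:)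
  qed
  also have "\<dots> = (\<Sum>n<N. \<Sum>j<2 * N. \<Sum>m<N. c n m * \<omega> j (int k + int m - int n))"
    by (rule sum.swap)
  also have "\<dots> = (\<Sum>n<N. \<Sum>m<N. \<Sum>j<2 * N. c n m * \<omega> j (int k + int m - int n))"
    by (intro sum.cong refl sum.swap)
  also have "\<dots> = (\<Sum>n<N. \<Sum>m<N. if k + m = n then 2 * of_nat N * c k 0 else 0)"
  proof (intro sum.cong refl)
    fix n m
    assume "n \<in> {..<N}" "m \<in> {..<N}"
    \<comment> \<open>Frequencies as large as 2N - 1 can occur, since k may equal N; with 2N roots
      none of them is aliased to zero.\<close>
    then have d: "\<bar>int k + int m - int n\<bar> < int (2 * N)"
      using N by auto
    have "(\<Sum>j<2 * N. c n m * \<omega> j (int k + int m - int n))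
        = c n m * (if int k + int m - int n = 0 then of_nat (2 * N) else 0)"
      unfolding \<omega>_def sum_distrib_left[symmetric] sum_roots_of_unity[OF d] ..
    also have "(int k + int m - int n = 0) = (k + m = n)"
      by linarith
    finally show "(\<Sum>j<2 * N. c n m * \<omega> j (int k + int m - int n))
        = (if k + m = n then 2 * of_nat N * c k 0 else 0)"
      using c_shift[of m] by auto
  qed
  also have "\<dots> = (\<Sum>m<N. \<Sum>n<N. if k + m = n then 2 * of_nat N * c k 0 else 0)"
    by (rule sum.swap)
  also have "\<dots> = (\<Sum>m<N. if m < N - k then 2 * of_nat N * c k 0 else 0)"
    by (intro sum.cong refl) auto
  also have "\<dots> = (\<Sum>m\<in>{..<N - k}. 2 * of_nat N * c k 0)"
    by (rule sum.mono_neutral_cong_right) auto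
  also have "\<dots> = of_nat (N - k) * (2 * of_nat N * c k 0)"
    by simp
  finally have main: "(\<Sum>j<2 * N. of_real ((norm (\<Sum>n<N. \<omega> j (- int n) *\<^sub>C (U ^^ n) g))\<^sup>2) * \<omega> j (int k))
    = of_nat (N - k) * (2 * of_nat N * c k 0)" .
  have "(\<Sum>j<2 * N. of_real ((norm (\<Sum>n<N. \<omega> j (- int n) *\<^sub>C (U ^^ n) g))\<^sup>2 / (2 * N * N)) * \<omega> j (int k))
      = (\<Sum>j<2 * N. of_real ((norm (\<Sum>n<N. \<omega> j (- int n) *\<^sub>C (U ^^ n) g))\<^sup>2) * \<omega> j (int k)) / (2 * of_nat N * of_nat N)"
    by (simp add: sum_divide_distrib)
  also have "\<dots> = of_nat (N - k) / of_nat N * c k 0"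
    unfolding main using N by (simp add: field_simps)
  finally show ?thesis
    by (simp add: scaleR_conv_of_real c_def)
qed

text \<open>
  The approximants put mass \<open>\<parallel>\<Sum>n<N. \<omega>\<^sup>-\<^sup>n U\<^sup>n g\<parallel>\<^sup>2 / 2N\<^sup>2\<close> at the arguments of the \<open>2N\<close>-th roots
  of unity \<open>\<omega>\<close>; their \<open>k\<close>-th moment is the Fejer mean \<open>(1 - k/N) (U\<^sup>k g, g)\<close>.
\<close>

lemma isometry_spectral_measure:
  fixes U :: "'a::complex_inner \<Rightarrow> 'a"
  assumes iso: "\<And>x y. cinner (U x) (U y) = cinner x y" and g: "norm g = 1"
  obtains M where "real_distribution M" "\<And>k. (LINT t|M. cis t ^ k) = cinner ((U ^^ k) g) g"
proof -
  \<comment> \<open>\<open>Suc N\<close> plays the role of N, so that no weight divides by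
    zero.\<close>
  define th where "th N j = 2 * pi * real j / real (2 * Suc N)" for N j
  define w where "w N j = (norm (\<Sum>n<Suc N. (cis (2 * pi * of_int (- int n) / real (2 * Suc N)) ^ j) *\<^sub>C (U ^^ n) g))\<^sup>2
    / (2 * Suc N * Suc N)" for N j
  define P where "P N = distr (point_measure {..<2 * Suc N} (w N)) borel (th N)" for N
  have w0: "0 \<le> w N j" for N j
    by (simp add: w_def)
  have cis_th: "cis (th N j) ^ k = cis (2 * pi * of_int (int k) / real (2 * Suc N)) ^ j" for N j k
    unfolding Complex.DeMoivre th_def by (rule arg_cong[where f = cis]) simp
  have mom: "(\<Sum>j<2 * Suc N. of_real (w N j) * cis (th N j) ^ k)
      = (real (Suc N - k) / real (Suc N)) *\<^sub>R cinner ((U ^^ k) g) g" if "k \<le> Suc N" for N k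
    unfolding w_def cis_th using fejer_moments[OF iso that] by simp
  have "complex_of_real (\<Sum>j<2 * Suc N. w N j) = of_real 1" for N
    using mom[of 0 N] by (simp add: cinner_eq_1 g)
  then have w1: "(\<Sum>j<2 * Suc N. w N j) = 1" for N
    unfolding of_real_eq_iff .
  have prob: "prob_space (point_measure {..<2 * Suc N} (w N))" for N
    by (rule prob_space_point_measure) (simp_all only: w0 w1 sum_ennreal ennreal_1 finite_lessThan zero_le)
  have th_meas: "th N \<in> measurable (point_measure {..<2 * Suc N} (w N)) borel" for N
    by (simp add: measurable_point_measure_eq1)
  have rd: "real_distribution (P N)" for N
    unfolding P_def using prob_space.real_distribution_distr[OF prob th_meas] .
  have int_P: "(LINT t|P N. cis t ^ k) = (real (Suc N - k) / real (Suc N)) *\<^sub>R cinner ((U ^^ k) g) g"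
    if "k \<le> Suc N" for N k
  proof -
    have "(LINT t|P N. cis t ^ k) = (LINT j|point_measure {..<2 * Suc N} (w N). cis (th N j) ^ k)"
      unfolding P_def by (rule integral_distr[OF th_meas]) (auto intro!: borel_measurable_continuous_onI continuous_intros)
    also have "\<dots> = (\<Sum>j<2 * Suc N. w N j *\<^sub>R cis (th N j) ^ k)"
      by (rule lebesgue_integral_point_measure_finite) (auto simp: w0)
    finally show ?thesis
      using mom[OF that] by (simp add: scaleR_conv_of_real)
  qed
  have "tight P"
    unfolding tight_def
  proof (intro conjI allI impI rd)
    fix e :: real
    assume "0 < e"
    \<comment> \<open>The angle 0 carries an atom candidate and the interval is open on the left,
      hence the endpoint -1.\<close>
    have "measure (P N) {-1<..2 * pi} = 1" for N
    proof -
      interpret real_distribution "P N"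
        by (rule rd)
      have "th N j \<in> {-1<..2 * pi}" if "j < 2 * Suc N" for j
      proof -
        have "0 \<le> th N j"
          by (simp add: th_def)
        moreover have "real j / real (2 * Suc N) \<le> 1"
          using that by (simp only: divide_le_eq_1) simp
        then have "2 * pi * (real j / real (2 * Suc N)) \<le> 2 * pi * 1"
          by (intro mult_left_mono) auto
        then have "th N j \<le> 2 * pi"
          by (simp only: th_def times_divide_eq_right mult_1_right)
        ultimately show ?thesis
          by simp
      qed
      then have "AE t in P N. t \<in> {-1<..2 * pi}"
        unfolding P_def by (subst AE_distr_iff[OF th_meas]) (auto simp: AE_point_measure)
      then show ?thesis
        using prob_eq_1[of "{-1<..2 * pi}"] by simp
    qed
    moreover have "- 1 < 2 * pi"
      using pi_gt_zero by linarith
    ultimately have "- 1 < 2 * pi \<and> (\<forall>N. 1 - e < measure (P N) {-1<..2 * pi})"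
      using \<open>0 < e\<close> by simp
    then show "\<exists>a b. a < b \<and> (\<forall>N. 1 - e < measure (P N) {a<..b})"
      by blast
  qed
  then obtain r M where r: "strict_mono r" "real_distribution M" "weak_conv_m (P \<circ> id \<circ> r) M"
    using tight_imp_convergent_subsubsequence[of P id] by (auto simp: strict_mono_id)
  have "(LINT t|M. cis t ^ k) = cinner ((U ^^ k) g) g" for k
  proof (rule LIMSEQ_unique)
    show "(\<lambda>n. LINT t|(P \<circ> id \<circ> r) n. cis t ^ k) \<longlonglongrightarrow> (LINT t|M. cis t ^ k)"
    proof (rule weak_conv_imp_integral_bdd_continuous_conv[where B = 1])
      have "isCont cis t" for t
        using continuous_on_cis[OF continuous_on_id, of UNIV] by (simp add: continuous_on_eq_continuous_at)
      then show "isCont (\<lambda>t. cis t ^ k) t" for t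
        by (intro continuous_intros)
    qed (use r rd in \<open>simp_all add: o_def norm_power\<close>)
    have "(\<lambda>N. real (Suc N - k) / real (Suc N)) \<longlonglongrightarrow> 1"
      by real_asymp
    then have "(\<lambda>N. (real (Suc N - k) / real (Suc N)) *\<^sub>R cinner ((U ^^ k) g) g) \<longlonglongrightarrow> 1 *\<^sub>R cinner ((U ^^ k) g) g"
      by (intro tendsto_intros)
    moreover have "\<forall>\<^sub>F N in sequentially. (LINT t|P N. cis t ^ k) = (real (Suc N - k) / real (Suc N)) *\<^sub>R cinner ((U ^^ k) g) g"
      using eventually_ge_at_top[of k] by eventually_elim (simp add: int_P)
    ultimately have "(\<lambda>N. LINT t|P N. cis t ^ k) \<longlonglongrightarrow> cinner ((U ^^ k) g) g"
      by (simp add: tendsto_cong)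
    then show "(\<lambda>n. LINT t|(P \<circ> id \<circ> r) n. cis t ^ k) \<longlonglongrightarrow> cinner ((U ^^ k) g) g"
      using LIMSEQ_subseq_LIMSEQ[OF _ r(1)] by (simp add: o_def)
  qed
  then show ?thesis
    using that r(2) by blast
qed

text \<open>Nonnegative moments suffice: the functions integrated below are polynomials, Cesaro
  limits or power series in \<open>cis t\<close>.\<close>

locale isometry_measure = real_distribution M for M +
  fixes U :: "'a::complex_inner \<Rightarrow> 'a" and g :: 'a
  assumes U_add: "\<And>x y. U (x + y) = U x + U y"
    and U_scale: "\<And>c x. U (c *\<^sub>C x) = c *\<^sub>C U x"
    and U_norm: "\<And>x. norm (U x) = norm x"
    and moments: "\<And>k. (LINT t|M. cis t ^ k) = cinner ((U ^^ k) g) g"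
begin

section \<open>Ergodic averages and power series of the isometry\<close>

lemma U_pow_add: "(U ^^ n) (x + y) = (U ^^ n) x + (U ^^ n) y"
  by (induction n) (simp_all add: U_add)

lemma U_pow_scale: "(U ^^ n) (c *\<^sub>C x) = c *\<^sub>C (U ^^ n) x"
  by (induction n) (simp_all add: U_scale)

lemma U_pow_diff: "(U ^^ n) (x - y) = (U ^^ n) x - (U ^^ n) y"
  using U_pow_add[of n "x - y" y] by simp

lemma U_pow_norm: "norm ((U ^^ n) x) = norm x"
  by (induction n) (simp_all add: U_norm)

lemma cis_pow_measurable [measurable]: "(\<lambda>t. cis t ^ k) \<in> borel_measurable borel"
  by (intro borel_measurable_continuous_onI continuous_intros)

lemma integrable_cis_pow: "integrable M (\<lambda>t. cis t ^ k)"
  by (rule integrable_const_bound[where B = 1]) (auto simp: norm_power)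

text \<open>Up to a small error \<open>r\<close>, the vector \<open>g\<close> has the form x - U x,
  whose iterates telescope to a bounded sum; the averages of the iterates of \<open>r\<close> stay
  small because U preserves norms.\<close>

lemma mean_ergodic:
  assumes "g \<in> closure (range (\<lambda>x. x - U x))"
  shows "(\<lambda>N. (\<Sum>n<N. cinner ((U ^^ n) g) g) / of_nat N) \<longlonglongrightarrow> 0"
proof (rule LIMSEQ_I)
  fix e :: real
  assume e: "0 < e"
  define G where "G = norm g + 1"
  define e' where "e' = e / (2 * G)"
  have ng: "0 < G"
    by (simp add: G_def add_nonneg_pos)
  have e': "0 < e'"
    using e ng by (simp add: e'_def)
  then obtain x where x: "dist (x - U x) g < e'"
    using assms by (auto simp: closure_approachable)
  define r where "r = g - (x - U x)"
  have nr: "norm r < e'"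
    using x by (simp add: r_def dist_norm norm_minus_commute)
  have g_eq: "g = r + (x - U x)"
    by (simp add: r_def)
  have tele: "(\<Sum>n<N. (U ^^ n) (x - U x)) = x - (U ^^ N) x" for N
    by (induction N) (simp_all add: U_pow_diff funpow_swap1)
  have bound: "norm (\<Sum>n<N. (U ^^ n) g) \<le> real N * e' + 2 * norm x" for N
  proof -
    have "(\<Sum>n<N. (U ^^ n) g) = (\<Sum>n<N. (U ^^ n) r) + (x - (U ^^ N) x)"
      by (subst g_eq) (simp add: U_pow_add sum.distrib tele del: add_diff_cancel)
    moreover have "norm (\<Sum>n<N. (U ^^ n) r) \<le> real N * e'"
      using nr by (intro order_trans[OF norm_sum] order_trans[OF sum_bounded_above[where K = e']])
        (auto simp: U_pow_norm)
    moreover have "norm (x - (U ^^ N) x) \<le> 2 * norm x"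
      using norm_triangle_ineq4[of x "(U ^^ N) x"] by (simp add: U_pow_norm)
    ultimately show ?thesis
      by (metis add_mono norm_triangle_le)
  qed
  obtain N0 :: nat where N0: "2 * norm x * norm g / (e / 2) < real N0"
    using reals_Archimedean2 by blast
  show "\<exists>no. \<forall>N\<ge>no. norm ((\<Sum>n<N. cinner ((U ^^ n) g) g) / of_nat N - 0) < e"
  proof (intro exI allI impI)
    fix N
    assume N: "Suc N0 \<le> N"
    have "norm (\<Sum>n<N. cinner ((U ^^ n) g) g) \<le> norm (\<Sum>n<N. (U ^^ n) g) * norm g"
      unfolding cinner_sum_left[symmetric] by (rule cmod_cinner_le)
    also have "\<dots> \<le> (real N * e' + 2 * norm x) * norm g"
      using bound by (intro mult_right_mono) auto
    also have "\<dots> = real N * (e' * norm g) + 2 * norm x * norm g"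
      by (simp add: algebra_simps)
    also have "\<dots> < real N * (e / 2) + real N * (e / 2)"
    proof (intro add_le_less_mono mult_left_mono)
      have "e' * norm g \<le> e' * G"
        using e' by (simp add: G_def)
      also have "\<dots> = e / 2"
        using ng by (simp add: e'_def)
      finally show "e' * norm g \<le> e / 2" .
      have "2 * norm x * norm g < real N0 * (e / 2)"
        using N0 e by (simp add: pos_divide_less_eq)
      also have "\<dots> \<le> real N * (e / 2)"
        using N e by (intro mult_right_mono) auto
      finally show "2 * norm x * norm g < real N * (e / 2)" .
    qed simp
    finally have "norm (\<Sum>n<N. cinner ((U ^^ n) g) g) < real N * e"
      by (simp add: field_simps)
    then show "norm ((\<Sum>n<N. cinner ((U ^^ n) g) g) / of_nat N - 0) < e"
      using N by (simp add: norm_divide divide_less_eq mult.commute)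
  qed
qed

text \<open>The averages of the powers of \<open>cis t\<close> converge boundedly to the indicator
  of \<open>cis t = 1\<close>, so the mass there is the limit in \<open>mean_ergodic\<close>. The
  point 1 of the circle corresponds to infinity on the line.\<close>

lemma no_atom_at_one:
  assumes "g \<in> closure (range (\<lambda>x. x - U x))"
  shows "AE t in M. cis t \<noteq> 1"
proof -
  define S where "S = {t. cis t = 1}"
  have S: "S \<in> sets borel"
    unfolding S_def by (intro borel_closed closed_Collect_eq continuous_intros)
  have "(\<lambda>N. LINT t|M. (\<Sum>n<N. cis t ^ n) / of_nat N) \<longlonglongrightarrow> (LINT t|M. complex_of_real (indicator S t))"
  proof (rule integral_dominated_convergence[where w = "\<lambda>_. 1"])
    show "AE t in M. (\<lambda>N. (\<Sum>n<N. cis t ^ n) / of_nat N) \<longlonglongrightarrow> complex_of_real (indicator S t)"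
    proof (rule AE_I2)
      fix t
      show "(\<lambda>N. (\<Sum>n<N. cis t ^ n) / of_nat N) \<longlonglongrightarrow> complex_of_real (indicator S t)"
      proof (cases "cis t = 1")
        case True
        have "\<forall>\<^sub>F N in sequentially. (\<Sum>n<N. cis t ^ n) / of_nat N = 1"
          using eventually_gt_at_top[of 0] by eventually_elim (simp add: True)
        then show ?thesis
          using True by (simp add: S_def tendsto_eventually)
      next
        case False
        have "(\<lambda>N. (\<Sum>n<N. cis t ^ n) / of_nat N) \<longlonglongrightarrow> 0"
        proof (rule Lim_null_comparison)
          show "\<forall>\<^sub>F N in sequentially. norm ((\<Sum>n<N. cis t ^ n) / of_nat N) \<le> (2 / cmod (cis t - 1)) / real N"
          proof (intro always_eventually allI)
            fix N
            have "cmod (cis t ^ N - 1) \<le> 2"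
              using norm_triangle_ineq4[of "cis t ^ N" 1] by (simp add: norm_power)
            then have "cmod (\<Sum>n<N. cis t ^ n) \<le> 2 / cmod (cis t - 1)"
              using False by (simp add: geometric_sum norm_divide divide_right_mono)
            then show "norm ((\<Sum>n<N. cis t ^ n) / of_nat N) \<le> (2 / cmod (cis t - 1)) / real N"
              by (simp only: norm_divide norm_of_nat divide_right_mono of_nat_0_le_iff)
          qed
          show "(\<lambda>N. (2 / cmod (cis t - 1)) / real N) \<longlonglongrightarrow> 0"
            by real_asymp
        qed
        then show ?thesis
          using False by (simp add: S_def)
      qed
    qed
    show "AE t in M. norm ((\<Sum>n<N. cis t ^ n) / of_nat N) \<le> 1" for N
    proof (rule AE_I2)
      fix t
      have "cmod (\<Sum>n<N. cis t ^ n) \<le> real N"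
        by (rule order_trans[OF norm_sum]) (simp add: norm_power)
      then show "norm ((\<Sum>n<N. cis t ^ n) / of_nat N) \<le> 1"
        by (cases "N = 0") (simp_all add: norm_divide)
    qed
  qed (use S in auto)
  moreover have "(LINT t|M. (\<Sum>n<N. cis t ^ n) / of_nat N) = (\<Sum>n<N. cinner ((U ^^ n) g) g) / of_nat N" for N
    by (simp add: Bochner_Integration.integral_sum integrable_cis_pow moments)
  ultimately have "(\<lambda>N. (\<Sum>n<N. cinner ((U ^^ n) g) g) / of_nat N) \<longlonglongrightarrow> (LINT t|M. complex_of_real (indicator S t))"
    by (simp only:)
  then have "(LINT t|M. complex_of_real (indicator S t)) = 0"
    using mean_ergodic[OF assms] by (rule LIMSEQ_unique)
  then have "prob S = 0"
    using S by simp
  then show ?thesis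
    using S prob_eq_0[of S] by (simp add: S_def)
qed

text \<open>The equation for \<open>y\<close> says that it is (1 - vU)^(-1) g; the geometric series
  is integrated term by term, and its partial sums telescope.\<close>

lemma integral_resolvent:
  assumes v: "cmod v < 1" and y: "g = y - v *\<^sub>C U y"
  shows "(LINT t|M. 1 / (1 - v * cis t)) = cinner y g"
proof (rule LIMSEQ_unique)
  have nv: "cmod (v * cis t) < 1" for t
    using v by (simp add: norm_mult)
  show "(\<lambda>N. LINT t|M. (\<Sum>n<N. (v * cis t) ^ n)) \<longlonglongrightarrow> (LINT t|M. 1 / (1 - v * cis t))"
  proof (rule integral_dominated_convergence[where w = "\<lambda>_. 1 / (1 - cmod v)"])
    show "(\<lambda>t. 1 / (1 - v * cis t)) \<in> borel_measurable M"
      using cis_pow_measurable[of 1] by simp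
    show "(\<lambda>t. \<Sum>n<N. (v * cis t) ^ n) \<in> borel_measurable M" for N
      using cis_pow_measurable[of 1] by simp
    show "AE t in M. (\<lambda>N. \<Sum>n<N. (v * cis t) ^ n) \<longlonglongrightarrow> 1 / (1 - v * cis t)"
      using geometric_sums[OF nv] by (simp add: sums_def)
    show "AE t in M. norm (\<Sum>n<N. (v * cis t) ^ n) \<le> 1 / (1 - cmod v)" for N
    proof (rule AE_I2)
      fix t
      have "norm (\<Sum>n<N. (v * cis t) ^ n) \<le> (\<Sum>n<N. cmod v ^ n)"
        by (rule order_trans[OF norm_sum]) (simp add: norm_power norm_mult)
      also have "\<dots> \<le> (\<Sum>n. cmod v ^ n)"
        using v by (intro sum_le_suminf summable_geometric) auto
      finally show "norm (\<Sum>n<N. (v * cis t) ^ n) \<le> 1 / (1 - cmod v)"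
        using v by (simp add: suminf_geometric)
    qed
  qed simp
  have part: "(\<Sum>n<N. v ^ n *\<^sub>C (U ^^ n) g) = y - v ^ N *\<^sub>C (U ^^ N) y" for N
  proof (induction N)
    case (Suc N)
    have "(U ^^ N) g = (U ^^ N) y - v *\<^sub>C (U ^^ Suc N) y"
      by (subst y) (simp add: U_pow_diff U_pow_scale funpow_swap1)
    then show ?case
      using Suc by (simp add: cvec.scale_right_diff_distrib mult.commute)
  qed simp
  have "(LINT t|M. (\<Sum>n<N. (v * cis t) ^ n)) = cinner y g - cinner (v ^ N *\<^sub>C (U ^^ N) y) g" for N
  proof -
    have "(LINT t|M. (\<Sum>n<N. (v * cis t) ^ n)) = (\<Sum>n<N. v ^ n * cinner ((U ^^ n) g) g)"
      by (simp add: power_mult_distrib Bochner_Integration.integral_sum integrable_cis_pow moments)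
    also have "\<dots> = cinner (\<Sum>n<N. v ^ n *\<^sub>C (U ^^ n) g) g"
      by (simp add: cinner_sum_left cinner_scaleC_left)
    finally show ?thesis
      by (simp add: part cinner_diff_left)
  qed
  moreover have "(\<lambda>N. cinner (v ^ N *\<^sub>C (U ^^ N) y) g) \<longlonglongrightarrow> 0"
  proof (rule Lim_null_comparison)
    show "\<forall>\<^sub>F N in sequentially. norm (cinner (v ^ N *\<^sub>C (U ^^ N) y) g) \<le> cmod v ^ N * (norm y * norm g)"
      using cmod_cinner_le by (intro always_eventually allI order_trans[OF cmod_cinner_le])
        (simp add: norm_scaleC norm_power U_pow_norm)
    have "(\<lambda>N. cmod v ^ N * (norm y * norm g)) \<longlonglongrightarrow> 0 * (norm y * norm g)"
      using v by (intro tendsto_intros LIMSEQ_power_zero) auto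
    then show "(\<lambda>N. cmod v ^ N * (norm y * norm g)) \<longlonglongrightarrow> 0"
      by simp
  qed
  then have "(\<lambda>N. cinner y g - cinner (v ^ N *\<^sub>C (U ^^ N) y) g) \<longlonglongrightarrow> cinner y g - 0"
    by (intro tendsto_intros)
  ultimately show "(\<lambda>N. LINT t|M. (\<Sum>n<N. (v * cis t) ^ n)) \<longlonglongrightarrow> cinner y g"
    by simp
qed

end

section \<open>Resolvent and Cayley transform of a self-adjoint operator\<close>

text \<open>Meaningful for self-adjoint \<open>B\<close> and nonreal \<open>z\<close>, where
  \<open>resolvent_graph\<close> and \<open>resolvent_unique\<close> apply; elsewhere the choice is
  arbitrary.\<close>

definition resolvent :: "'a::complex_inner graph \<Rightarrow> complex \<Rightarrow> 'a \<Rightarrow> 'a" where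
  "resolvent B z h = (SOME f. (f, h + z *\<^sub>C f) \<in> B)"

locale self_adjoint =
  fixes B :: "'a::chilbert_space graph"
  assumes sa: "self_adjoint_in UNIV B"
begin

section \<open>Resolvent of a self-adjoint operator\<close>

lemmas B_op = is_operatorD[OF self_adjointD(1)[OF sa]]

lemma B_herm: "(f, h) \<in> B \<Longrightarrow> (g, k) \<in> B \<Longrightarrow> cinner h g = cinner f k"
  using self_adjointD(3)[OF sa] adjoint_opD by blast

lemma resolvent_graph: "Im z \<noteq> 0 \<Longrightarrow> (resolvent B z h, h + z *\<^sub>C resolvent B z h) \<in> B"
  unfolding resolvent_def by (rule self_adjoint_surj[OF sa]) (auto intro: someI)

lemma resolvent_unique:
  assumes "(f, h + z *\<^sub>C f) \<in> B" "Im z \<noteq> 0"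
  shows "f = resolvent B z h"
proof -
  have "(f - resolvent B z h, (h + z *\<^sub>C f) - (h + z *\<^sub>C resolvent B z h)) \<in> B"
    using assms resolvent_graph by (intro B_op(3))
  from cinner_symmetric_diff[OF _ this, of z] show ?thesis
    using assms(2) self_adjointD(3)[OF sa] by (simp add: scaleC_simps mult_le_0_iff)
qed

lemma norm_resolvent_le:
  assumes "Im z \<noteq> 0"
  shows "\<bar>Im z\<bar> * norm (resolvent B z h) \<le> norm h"
  using cinner_symmetric_diff[OF _ resolvent_graph[OF assms], of z h] self_adjointD(3)[OF sa] by simp

lemma resolvent_add: "Im z \<noteq> 0 \<Longrightarrow> resolvent B z (x + y) = resolvent B z x + resolvent B z y"
  using B_op(2)[OF resolvent_graph[of z x] resolvent_graph[of z y]]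
  by (intro resolvent_unique[symmetric]) (simp_all add: scaleC_add_right ac_simps)

lemma resolvent_scale: "Im z \<noteq> 0 \<Longrightarrow> resolvent B z (c *\<^sub>C x) = c *\<^sub>C resolvent B z x"
  using B_op(4)[OF resolvent_graph[of z x], of c]
  by (intro resolvent_unique[symmetric]) (simp_all add: scaleC_simps mult.commute)

lemma resolvent_identity:
  assumes "Im z \<noteq> 0" "Im w \<noteq> 0"
  shows "resolvent B z h = resolvent B w h + (z - w) *\<^sub>C resolvent B z (resolvent B w h)"
proof -
  define f where "f = resolvent B w h"
  define e where "e = resolvent B z f"
  have "(f + (z - w) *\<^sub>C e, (h + w *\<^sub>C f) + (z - w) *\<^sub>C (f + z *\<^sub>C e)) \<in> B"
    unfolding e_def f_def by (intro B_op(2) B_op(4) resolvent_graph assms)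
  also have "(h + w *\<^sub>C f) + (z - w) *\<^sub>C (f + z *\<^sub>C e) = h + z *\<^sub>C (f + (z - w) *\<^sub>C e)"
    by (simp add: scaleC_simps algebra_simps)
  finally show ?thesis
    using resolvent_unique[OF _ assms(1)] unfolding e_def f_def by metis
qed

lemma resolvent_tendsto:
  assumes "0 < Im w"
  shows "((\<lambda>z. resolvent B z h) \<longlongrightarrow> resolvent B w h) (at w)"
proof -
  define C where "C = norm (resolvent B w h) * (2 / Im w)"
  have "(Im \<longlongrightarrow> Im w) (at w)"
    by (intro tendsto_intros)
  \<comment> \<open>Staying above half of \<open>Im w\<close> gives the resolvents near
    \<open>w\<close> a common norm bound.\<close>
  then have "\<forall>\<^sub>F z in at w. Im w / 2 < Im z"
    using assms by (intro order_tendstoD) auto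
  then have "\<forall>\<^sub>F z in at w. norm (resolvent B z h - resolvent B w h) \<le> cmod (z - w) * C"
  proof eventually_elim
    case (elim z)
    then have z: "0 < Im z"
      using assms by linarith
    have "Im w / 2 * norm (resolvent B z (resolvent B w h)) \<le> Im z * norm (resolvent B z (resolvent B w h))"
      using elim by (intro mult_right_mono) auto
    also have "\<dots> \<le> norm (resolvent B w h)"
      using norm_resolvent_le[of z "resolvent B w h"] z by simp
    finally have "norm (resolvent B z (resolvent B w h)) \<le> C"
      using assms by (simp add: C_def field_simps)
    moreover have "resolvent B z h - resolvent B w h = (z - w) *\<^sub>C resolvent B z (resolvent B w h)"
      using resolvent_identity[of z w h] z assms by (metis add_diff_cancel_left' less_irrefl)
    ultimately show ?case
      by (simp add: norm_scaleC mult_left_mono)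
  qed
  moreover have "((\<lambda>z. cmod (z - w) * C) \<longlongrightarrow> cmod (w - w) * C) (at w)"
    by (intro tendsto_intros)
  then have "((\<lambda>z. cmod (z - w) * C) \<longlongrightarrow> 0) (at w)"
    by simp
  ultimately have "((\<lambda>z. resolvent B z h - resolvent B w h) \<longlongrightarrow> 0) (at w)"
    by (rule Lim_null_comparison)
  then show ?thesis
    by (simp add: Lim_null[symmetric])
qed

lemma resolvent_holomorphic: "(\<lambda>z. cinner (resolvent B z h) k) holomorphic_on {z. 0 < Im z}"
proof (rule holomorphic_onI)
  fix w
  assume "w \<in> {z. 0 < Im z}"
  then have w: "0 < Im w"
    by simp
  have "(Im \<longlongrightarrow> Im w) (at w)"
    by (intro tendsto_intros)
  then have "\<forall>\<^sub>F z in at w. 0 < Im z \<and> z \<noteq> w"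
    using w by (intro eventually_conj order_tendstoD eventually_neq_at_within)
  then have "\<forall>\<^sub>F z in at w. cinner (resolvent B z (resolvent B w h)) k
      = (cinner (resolvent B z h) k - cinner (resolvent B w h) k) / (z - w)"
  proof eventually_elim
    case (elim z)
    then show ?case
      using resolvent_identity[of z w h] w by (simp add: cinner_add_left cinner_scaleC_left)
  qed
  moreover have "((\<lambda>z. cinner (resolvent B z (resolvent B w h)) k)
      \<longlongrightarrow> cinner (resolvent B w (resolvent B w h)) k) (at w)"
    by (intro tendsto_intros resolvent_tendsto w)
  ultimately have "((\<lambda>z. (cinner (resolvent B z h) k - cinner (resolvent B w h) k) / (z - w))
      \<longlongrightarrow> cinner (resolvent B w (resolvent B w h)) k) (at w)"
    using tendsto_cong by fast
  then have "((\<lambda>z. cinner (resolvent B z h) k) has_field_derivative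
      cinner (resolvent B w (resolvent B w h)) k) (at w)"
    by (simp add: has_field_derivative_iff)
  then show "(\<lambda>z. cinner (resolvent B z h) k) field_differentiable at w within {z. 0 < Im z}"
    using field_differentiable_at_within field_differentiable_def by blast
qed

lemma cinner_resolvent_cnj:
  assumes "Im z \<noteq> 0"
  shows "cinner (resolvent B z h) h = cnj (cinner (resolvent B (cnj z) h) h)"
proof -
  have "Im (cnj z) \<noteq> 0"
    using assms by simp
  from B_herm[OF resolvent_graph[OF assms, of h] resolvent_graph[OF this, of h]]
  have "cinner h (resolvent B (cnj z) h) = cinner (resolvent B z h) h"
    by (simp add: cinner_simps)
  then show ?thesis
    by (metis cinner_commute)
qed

text \<open>This is (B - i)(B + i)^(-1), written so that it is visibly defined on the whole
  space.\<close>

definition cayley :: "'a \<Rightarrow> 'a" where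
  "cayley h = h - (2 * \<i>) *\<^sub>C resolvent B (- \<i>) h"

lemma cayley_add: "cayley (x + y) = cayley x + cayley y"
  and cayley_scale: "cayley (c *\<^sub>C x) = c *\<^sub>C cayley x"
  by (simp_all add: cayley_def resolvent_add resolvent_scale scaleC_simps mult.commute)

lemma cayley_isometry: "cinner (cayley h) (cayley k) = cinner h k"
proof -
  define f e where "f = resolvent B (- \<i>) h" and "e = resolvent B (- \<i>) k"
  have "cinner (h + (- \<i>) *\<^sub>C f) e = cinner f (k + (- \<i>) *\<^sub>C e)"
    unfolding f_def e_def by (rule B_herm[OF resolvent_graph resolvent_graph]) simp_all
  then have "cinner h e - cinner f k = 2 * \<i> * cinner f e"
    by (simp add: cinner_simps algebra_simps)
  then have "2 * \<i> * (cinner h e - cinner f k) + 4 * cinner f e = 0"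
    by simp
  then show ?thesis
    unfolding cayley_def f_def[symmetric] e_def[symmetric]
    by (simp add: cinner_simps algebra_simps)
qed

lemma cayley_norm: "norm (cayley h) = norm h"
proof -
  have "complex_of_real ((norm (cayley h))\<^sup>2) = of_real ((norm h)\<^sup>2)"
    unfolding cinner_self[symmetric] by (rule cayley_isometry)
  then show ?thesis
    unfolding of_real_eq_iff by (simp add: power2_eq_iff_nonneg)
qed

text \<open>One minus the Cayley transform is 2i (B + i)^(-1), whose range contains the dense domain
  of \<open>B\<close>.\<close>

lemma cayley_range_dense: "g \<in> closure (range (\<lambda>x. x - cayley x))"
proof -
  have "f \<in> range (\<lambda>x. x - cayley x)" if "(f, h) \<in> B" for f h
  proof
    define c where "c = 1 / (2 * \<i>)"
    have c: "(2 * \<i>) * c = 1"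
      by (simp add: c_def)
    have "f = resolvent B (- \<i>) (h + \<i> *\<^sub>C f)"
      using that by (intro resolvent_unique) auto
    then have "f = (2 * \<i>) *\<^sub>C c *\<^sub>C resolvent B (- \<i>) (h + \<i> *\<^sub>C f)"
      by (simp only: scaleC_scaleC c scaleC_one)
    then show "f = c *\<^sub>C (h + \<i> *\<^sub>C f) - cayley (c *\<^sub>C (h + \<i> *\<^sub>C f))"
      unfolding cayley_def by (subst resolvent_scale) simp_all
  qed simp
  then have "closure (Domain B) \<subseteq> closure (range (\<lambda>x. x - cayley x))"
    by (intro closure_mono) auto
  then show ?thesis
    using self_adjointD(4)[OF sa] by blast
qed

text \<open>With v = (z + i)/(z - i) and U the Cayley transform, 1 - vU equals -2i/(z - i) times (B
  - z)(B + i)^(-1). Inverting gives the prefactor of \<open>y\<close>, and (B + i)(B - z)^(-1) = 1 +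
  (z + i)(B - z)^(-1) gives its second factor.\<close>

lemma cayley_resolvent:
  fixes g :: 'a
  assumes "Im z < 0"
  defines "y \<equiv> (\<i> / 2 * (z - \<i>)) *\<^sub>C (g + (z + \<i>) *\<^sub>C resolvent B z g)"
  shows "g = y - ((z + \<i>) / (z - \<i>)) *\<^sub>C cayley y"
proof -
  define f where "f = resolvent B z g"
  define h where "h = g + (z + \<i>) *\<^sub>C f"
  have zi: "z - \<i> \<noteq> 0"
    using assms(1) by (auto simp: complex_eq_iff)
  have "(f, h + (- \<i>) *\<^sub>C f) \<in> B"
    using resolvent_graph[of z g] assms(1) by (simp add: h_def f_def scaleC_simps)
  then have "f = resolvent B (- \<i>) h"
    by (rule resolvent_unique) simp
  then have "cayley y = (\<i> / 2 * (z - \<i>)) *\<^sub>C (h - (2 * \<i>) *\<^sub>C f)"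
    unfolding y_def f_def[symmetric] h_def[symmetric] cayley_scale by (simp add: cayley_def)
  then have "((z + \<i>) / (z - \<i>)) *\<^sub>C cayley y = (\<i> / 2 * (z + \<i>)) *\<^sub>C (h - (2 * \<i>) *\<^sub>C f)"
    using zi by (simp add: mult.commute)
  moreover have "y = (\<i> / 2 * (z - \<i>)) *\<^sub>C h"
    by (simp add: y_def h_def f_def)
  ultimately have "y - ((z + \<i>) / (z - \<i>)) *\<^sub>C cayley y
      = (\<i> / 2 * (z - \<i>) - \<i> / 2 * (z + \<i>)) *\<^sub>C h + (\<i> / 2 * (z + \<i>) * (2 * \<i>)) *\<^sub>C f"
    by (simp add: cvec.scale_left_diff_distrib cvec.scale_right_diff_distrib)
  also have "\<i> / 2 * (z - \<i>) - \<i> / 2 * (z + \<i>) = 1"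
    by (simp add: field_simps)
  also have "\<i> / 2 * (z + \<i>) * (2 * \<i>) = - (z + \<i>)"
    by (simp add: field_simps)
  finally have eq: "y - ((z + \<i>) / (z - \<i>)) *\<^sub>C cayley y = 1 *\<^sub>C h + (- (z + \<i>)) *\<^sub>C f" .
  show ?thesis
    unfolding eq cvec.scale_minus_left by (simp add: h_def)
qed

end

section \<open>The impedance function as a Herglotz function\<close>

text \<open>Junk value \<open>0\<close> where \<open>cis t = 1\<close>; this is a null set of the spectral measure.\<close>

definition cayley_line :: "real \<Rightarrow> real" where
  "cayley_line t = Re (\<i> * (1 + cis t) / (1 - cis t))"

lemma cayley_line_measurable [measurable]: "cayley_line \<in> borel_measurable borel"
proof -
  have [measurable]: "cis \<in> borel_measurable borel"
    by (intro borel_measurable_continuous_onI continuous_intros)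
  show ?thesis
    unfolding cayley_line_def by measurable
qed

lemma cayley_line_eq:
  assumes "cis t \<noteq> 1"
  shows "of_real (cayley_line t) * (1 - cis t) = \<i> * (1 + cis t)"
proof -
  define x where "x = \<i> * (1 + cis t) / (1 - cis t)"
  have u: "cnj (cis t) = 1 / cis t"
    by (simp add: cis_cnj divide_inverse)
  have "cnj x = - \<i> * (1 + 1 / cis t) / (1 - 1 / cis t)"
    by (simp add: x_def u del: cis_cnj)
  also have "\<dots> = x"
    using assms by (simp add: x_def divide_simps) (simp add: algebra_simps)
  finally have "x \<in> \<real>"
    by (simp add: Reals_cnj_iff)
  then have "of_real (cayley_line t) = x"
    by (simp add: cayley_line_def x_def[symmetric])
  then show ?thesis
    using assms by (simp add: x_def)
qed

text \<open>With u = \<open>cis t\<close> and w = (z - i)/(z + i) the left side is i(u + w)/(u - w),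
  the Herglotz kernel of the disc. The conjugates appear because the power series for the resolvent
  is used at \<open>cnj z\<close>, in the lower half-plane.\<close>

lemma cayley_kernel:
  assumes t: "cis t \<noteq> 1" and z: "0 < Im z"
  defines "s \<equiv> complex_of_real (cayley_line t)"
  shows "\<i> * (2 * cnj (1 / (1 - (cnj z + \<i>) / (cnj z - \<i>) * cis t)) - 1) = (1 + s * z) / (s - z)"
proof -
  define u where "u = cis t"
  define w where "w = (z - \<i>) / (z + \<i>)"
  have zi: "z + \<i> \<noteq> 0"
    using z by (auto simp: complex_eq_iff)
  have u0: "u \<noteq> 0" "cnj u = 1 / u" "cmod u = 1" "u \<noteq> 1"
    using t by (auto simp: u_def cis_cnj divide_inverse)
  have "cmod (z - \<i>) < cmod (z + \<i>)"
    using z by (simp add: cmod_def real_sqrt_less_iff power2_eq_square algebra_simps)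
  then have "cmod w < 1"
    using zi by (simp add: w_def norm_divide)
  then have uw: "u - w \<noteq> 0"
    using u0 by auto
  have sz: "s - z \<noteq> 0"
    using z by (auto simp: s_def complex_eq_iff)
  have su: "s * (1 - u) = \<i> * (1 + u)"
    unfolding s_def u_def by (rule cayley_line_eq[OF t])
  have wz: "w * (z + \<i>) = z - \<i>"
    using zi by (simp add: w_def)
  have "cnj (1 / (1 - (cnj z + \<i>) / (cnj z - \<i>) * cis t)) = 1 / (1 - w * (1 / u))"
    by (simp add: w_def u_def[symmetric] u0(2))
  also have "\<dots> = u / (u - w)"
    using u0 uw by (simp add: field_simps)
  finally have X: "cnj (1 / (1 - (cnj z + \<i>) / (cnj z - \<i>) * cis t)) = u / (u - w)" .
  have "\<i> * (2 * cnj (1 / (1 - (cnj z + \<i>) / (cnj z - \<i>) * cis t)) - 1) = \<i> * (u + w) / (u - w)"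
    unfolding X using uw by (simp add: field_simps)
  also have "\<dots> = (1 + s * z) / (s - z)"
  proof -
    have 1: "(u + w) * (z + \<i>) = u * (z + \<i>) + (z - \<i>)"
      "(u - w) * (z + \<i>) = u * (z + \<i>) - (z - \<i>)"
      by (simp_all only: distrib_right left_diff_distrib wz)
    have 2: "(s - z) * (1 - u) = \<i> * (1 + u) - z * (1 - u)"
      "(1 + s * z) * (1 - u) = (1 - u) + z * (\<i> * (1 + u))"
      unfolding su[symmetric] by (simp_all add: algebra_simps)
    \<comment> \<open>The common factor \<open>(z + \<i>) * (1 - u)\<close> clears both Cayley
      transforms, \<open>w\<close> of \<open>z\<close> and \<open>u\<close> of \<open>s\<close>, and
      leaves a polynomial identity.\<close>
    have "(\<i> * (u + w) * (s - z)) * ((z + \<i>) * (1 - u)) = \<i> * ((u + w) * (z + \<i>)) * ((s - z) * (1 - u))"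
      by (simp add: mult_ac)
    also have "\<dots> = ((1 + s * z) * (1 - u)) * ((u - w) * (z + \<i>))"
      unfolding 1 2 by (simp add: algebra_simps)
    also have "\<dots> = ((1 + s * z) * (u - w)) * ((z + \<i>) * (1 - u))"
      by (simp add: mult_ac)
    finally have "\<i> * (u + w) * (s - z) = (1 + s * z) * (u - w)"
      using zi u0 by simp
    then show ?thesis
      using uw sz by (simp add: frac_eq_eq)
  qed
  finally show ?thesis .
qed

text \<open>At i the integral kernel collapses to i/(1 + t^2), so the normalisation of the measure
  is visible in one value. This is how membership in a class determines a parameter.\<close>

lemma M_functions_at_i:
  assumes "M \<in> M_functions m"
  shows "M \<i> = \<i> * of_real m"
proof -
  obtain \<mu> :: "real measure" where \<mu>: "has_bochner_integral \<mu> (\<lambda>t. 1 / (1 + t\<^sup>2)) m"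
    "has_bochner_integral \<mu> (\<lambda>t. 1 / (of_real t - \<i>) - of_real t / (1 + (of_real t)\<^sup>2)) (M \<i>)"
    using assms by (auto simp: M_functions_def)
  have "1 / (complex_of_real t - \<i>) - of_real t / (1 + (of_real t)\<^sup>2) = \<i> * of_real (1 / (1 + t\<^sup>2))" for t
  proof -
    have "complex_of_real t - \<i> \<noteq> 0"
      by (auto simp: complex_eq_iff)
    moreover have "1 + (complex_of_real t)\<^sup>2 = (of_real t - \<i>) * (of_real t + \<i>)"
      by (simp add: algebra_simps power2_eq_square)
    moreover have "complex_of_real t + \<i> \<noteq> 0"
      by (auto simp: complex_eq_iff)
    ultimately show ?thesis
      by (simp add: divide_simps)
  qed
  then have "has_bochner_integral \<mu> (\<lambda>t. \<i> * of_real (1 / (1 + t\<^sup>2))) (M \<i>)"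
    using \<mu>(2) by simp
  moreover have "has_bochner_integral \<mu> (\<lambda>t. \<i> * of_real (1 / (1 + t\<^sup>2))) (\<i> * of_real m)"
    by (intro has_bochner_integral_mult_right has_bochner_integral_of_real \<mu>(1))
  ultimately show ?thesis
    by (rule has_bochner_integral_eq)
qed

context l_sys_quasi
begin

sublocale B: self_adjoint B
  by standard (rule B_sa)

section \<open>Growth and integral representation of the impedance function\<close>

lemma gp_not_in_Domain: "gp \<notin> Domain B"
proof
  assume "gp \<in> Domain B"
  then have "(gp, \<i> *\<^sub>C gp) \<in> B"
    using B_subset adjoint_unique defect_spaceD[OF gp(1)] by blast
  from cinner_symmetric_diff[OF _ this, of \<i>] show False
    using self_adjointD(3)[OF B_sa] gp(2) by simp
qed

lemma Im_impedance_pos: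
  assumes "0 < Im z"
  shows "0 < Im (impedance_fun \<Theta> z)"
proof -
  have z: "Im z \<noteq> 0"
    using assms by simp
  define f where "f = resolvent B z gp"
  have f: "(f, gp + z *\<^sub>C f) \<in> B"
    unfolding f_def by (rule B.resolvent_graph[OF z])
  have "gp + (z - \<i>) *\<^sub>C f \<noteq> 0"
  proof
    assume "gp + (z - \<i>) *\<^sub>C f = 0"
    then have "gp = (\<i> - z) *\<^sub>C f"
      by (simp add: cvec.scale_left_diff_distrib eq_neg_iff_add_eq_0[symmetric])
    then show False
      using gp_not_in_Domain B.B_op(4)[OF f, of "\<i> - z"] by auto
  qed
  then show ?thesis
    unfolding Im_impedance[OF f z] using assms tau_neq kappa_neq by simp
qed

text \<open>Such decay would make \<open>gp\<close> a limit of vectors \<open>F n\<close> in the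
  domain of the quasi-kernel with bounded images, which \<open>bounded_images_limit_defect\<close>
  excludes for a unit vector.\<close>

lemma Im_impedance_unbounded:
  assumes "\<And>y. 0 < y \<Longrightarrow> Im (impedance_fun \<Theta> (\<i> * of_real y)) \<le> C / y"
  shows False
proof -
  define K where "K = cmod ((\<kappa> - 1) / \<tau>)"
  have K: "0 < K"
    using tau_neq kappa_neq by (simp add: K_def)
  define D where "D = sqrt C / K"
  define Y where "Y n = real (Suc n)" for n
  define f where "f n = resolvent B (\<i> * of_real (Y n)) gp" for n
  have Y: "1 \<le> Y n" for n
    by (simp add: Y_def)
  have ImY: "Im (\<i> * of_real (Y n)) = Y n" for n
    by simp
  have Y0: "Y n \<noteq> 0" for n
    using Y[of n] by simp
  have f: "(f n, gp + (\<i> * of_real (Y n)) *\<^sub>C f n) \<in> B" for n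
    unfolding f_def using Y0 by (intro B.resolvent_graph) simp
  have fn: "Y n * norm (f n) \<le> 1" for n
    using B.norm_resolvent_le[of "\<i> * of_real (Y n)" gp] Y[of n] by (simp add: f_def gp)
  have D: "norm (gp + (\<i> * of_real (Y n) - \<i>) *\<^sub>C f n) \<le> D / Y n" for n
  proof -
    define a where "a = norm (gp + (\<i> * of_real (Y n) - \<i>) *\<^sub>C f n)"
    have "Y n * (K\<^sup>2 * a\<^sup>2) \<le> C / Y n"
      using Im_impedance[OF f] assms[of "Y n"] Y[of n] by (simp add: K_def a_def)
    then have "(Y n * K * a)\<^sup>2 \<le> C"
      using Y[of n] by (simp add: field_simps power2_eq_square)
    then have "Y n * K * a \<le> sqrt C"
      by (rule real_le_rsqrt)
    then show ?thesis
      unfolding a_def[symmetric] D_def using Y[of n] K by (simp add: field_simps)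
  qed
  have D0: "0 \<le> D"
    using D[of 0] by (simp add: Y_def) (metis norm_ge_zero order_trans)
  define F where "F n = (\<i> - \<i> * of_real (Y n)) *\<^sub>C f n" for n
  have gF: "gp - F n = gp + (\<i> * of_real (Y n) - \<i>) *\<^sub>C f n" for n
    by (simp add: F_def cvec.scale_left_diff_distrib)
  have "(\<lambda>n. gp - F n) \<longlonglongrightarrow> 0"
  proof (rule Lim_null_comparison)
    show "\<forall>\<^sub>F n in sequentially. norm (gp - F n) \<le> D / Y n"
      unfolding gF using D by simp
    show "(\<lambda>n. D / Y n) \<longlonglongrightarrow> 0"
      unfolding Y_def by real_asymp
  qed
  from tendsto_diff[OF tendsto_const[of gp] this] have lim: "F \<longlonglongrightarrow> gp"
    by simp
  have FB: "(F n, (\<i> - \<i> * of_real (Y n)) *\<^sub>C (gp + (\<i> * of_real (Y n)) *\<^sub>C f n)) \<in> B" for n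
    unfolding F_def by (rule B.B_op(4)[OF f])
  \<comment> \<open>The scalar grows at most like \<open>Y n\<close>, while the vector splits into a
    part bounded by \<open>D / Y n\<close> and i times \<open>f n\<close>, of norm at most
    \<open>1 / Y n\<close>.\<close>
  have bdd: "norm ((\<i> - \<i> * of_real (Y n)) *\<^sub>C (gp + (\<i> * of_real (Y n)) *\<^sub>C f n)) \<le> D + 1" for n
  proof -
    have eq: "gp + (\<i> * of_real (Y n)) *\<^sub>C f n = (gp + (\<i> * of_real (Y n) - \<i>) *\<^sub>C f n) + \<i> *\<^sub>C f n"
      by (simp add: cvec.scale_left_diff_distrib)
    have "norm (gp + (\<i> * of_real (Y n)) *\<^sub>C f n) \<le> D / Y n + norm (f n)"
      unfolding eq using norm_triangle_ineq[of "gp + (\<i> * of_real (Y n) - \<i>) *\<^sub>C f n" "\<i> *\<^sub>C f n"] D[of n]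
      by (simp add: norm_scaleC)
    moreover have "\<i> - \<i> * of_real (Y n) = \<i> * of_real (1 - Y n)"
      by (simp add: algebra_simps)
    then have "cmod (\<i> - \<i> * of_real (Y n)) \<le> Y n"
      using Y[of n] by (simp only: norm_mult norm_of_real) simp
    ultimately have "norm ((\<i> - \<i> * of_real (Y n)) *\<^sub>C (gp + (\<i> * of_real (Y n)) *\<^sub>C f n))
        \<le> Y n * (D / Y n + norm (f n))"
      unfolding norm_scaleC using Y[of n] by (intro mult_mono) auto
    also have "\<dots> \<le> D + 1"
      using fn[of n] Y0[of n] by (simp add: distrib_left)
    finally show ?thesis .
  qed
  have "gp = 0"
    using A_sym(4) self_adjointD(3)[OF B_sa]
    by (intro bounded_images_limit_defect[OF _ A_subset_B _ gp(1) FB lim bdd])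
      (auto simp: densely_defined_in_def)
  then show False
    using gp(2) by simp
qed

lemma impedance_fun_at_i:
  assumes k: "\<kappa> = of_real k"
  shows "impedance_fun \<Theta> \<i> = \<i> * of_real ((1 - k) / (1 + k))"
  using impedance_formula[OF B.resolvent_graph _ k, of \<i>] by simp

text \<open>The spectral measure represents V as the integral of m (1 + sz)/(s - z), with s =
  \<open>cayley_line t\<close>. Since (1 + sz)/(s - z) = (1 + s^2)(1/(s - z) - s/(1 + s^2)), the
  required measure is the push-forward to the line with density m (1 + s^2).\<close>

lemma impedance_M_functions:
  assumes k: "\<kappa> = of_real k"
  shows "impedance_fun \<Theta> \<in> M_functions ((1 - k) / (1 + k))"
proof -
  define m where "m = (1 - k) / (1 + k)"
  have k1: "\<bar>k\<bar> < 1"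
    using kappa by (simp add: k)
  then have m: "0 < m"
    by (simp add: m_def)
  obtain M where M: "real_distribution M" "\<And>k. (LINT t|M. cis t ^ k) = cinner ((B.cayley ^^ k) gp) gp"
    using isometry_spectral_measure[OF B.cayley_isometry gp(2)] by blast
  interpret real_distribution M
    by (rule M(1))
  interpret isometry_measure M B.cayley gp
    by standard (simp_all add: B.cayley_add B.cayley_scale B.cayley_norm M(2))
  have atom: "AE t in M. cis t \<noteq> 1"
    by (rule no_atom_at_one[OF B.cayley_range_dense])
  define \<mu> where "\<mu> = density (distr M borel cayley_line) (\<lambda>s. ennreal (m * (1 + s\<^sup>2)))"
  have line [measurable]: "cayley_line \<in> measurable M borel"
    using cayley_line_measurable by simp
  have integral_\<mu>: "has_bochner_integral \<mu> F x"
    if "F \<in> borel_measurable borel"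
      "has_bochner_integral M (\<lambda>t. (m * (1 + (cayley_line t)\<^sup>2)) *\<^sub>R F (cayley_line t)) x"
    for F :: "real \<Rightarrow> 'c::{banach, second_countable_topology}" and x
    unfolding \<mu>_def
    using that m by (intro has_bochner_integral_density has_bochner_integral_distr) auto
  have const_integral: "has_bochner_integral M (\<lambda>t. c) c" for c :: "'c::{banach, second_countable_topology}"
    using prob_space by (simp add: has_bochner_integral_iff)
  have formula: "impedance_fun \<Theta> z = of_real m * (z + (1 + z\<^sup>2) * cinner (resolvent B z gp) gp)"
    if "0 < Im z" for z
    using impedance_formula[OF B.resolvent_graph _ k] that by (simp add: m_def)
  have herglotz: "has_bochner_integral \<mu>
      (\<lambda>t. 1 / (of_real t - z) - of_real t / (1 + (of_real t)\<^sup>2)) (impedance_fun \<Theta> z)"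
    if z: "0 < Im z" for z
  proof (rule integral_\<mu>)
    show "(\<lambda>t. 1 / (complex_of_real t - z) - of_real t / (1 + (of_real t)\<^sup>2)) \<in> borel_measurable borel"
      by measurable
    define v where "v = (cnj z + \<i>) / (cnj z - \<i>)"
    define y where "y = (\<i> / 2 * (cnj z - \<i>)) *\<^sub>C (gp + (cnj z + \<i>) *\<^sub>C resolvent B (cnj z) gp)"
    define q where "q = cinner (resolvent B (cnj z) gp) gp"
    have "cmod (cnj z + \<i>) < cmod (cnj z - \<i>)"
      using z by (simp add: cmod_def real_sqrt_less_iff power2_eq_square algebra_simps)
    moreover have "cnj z - \<i> \<noteq> 0"
      using z by (auto simp: complex_eq_iff)
    ultimately have v: "cmod v < 1"
      by (simp add: v_def norm_divide)
    have "(LINT t|M. 1 / (1 - v * cis t)) = cinner y gp"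
    proof (rule integral_resolvent[OF v])
      show "gp = y - v *\<^sub>C B.cayley y"
        unfolding v_def y_def by (rule B.cayley_resolvent) (use z in simp)
    qed
    moreover have "integrable M (\<lambda>t. 1 / (1 - v * cis t))"
    proof (rule integrable_const_bound)
      show "(\<lambda>t. 1 / (1 - v * cis t)) \<in> borel_measurable M"
        using cis_pow_measurable[of 1] by simp
      show "AE t in M. norm (1 / (1 - v * cis t)) \<le> 1 / (1 - cmod v)"
      proof (rule AE_I2)
        fix t
        have "1 - cmod v \<le> cmod (1 - v * cis t)"
          using norm_triangle_ineq2[of 1 "v * cis t"] by (simp add: norm_mult)
        then show "norm (1 / (1 - v * cis t)) \<le> 1 / (1 - cmod v)"
          using v by (simp add: norm_divide frac_le)
      qed
    qed
    ultimately have "has_bochner_integral M (\<lambda>t. 1 / (1 - v * cis t)) (cinner y gp)"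
      by (simp add: has_bochner_integral_iff)
    then have "has_bochner_integral M (\<lambda>t. of_real m * (\<i> * (2 * cnj (1 / (1 - v * cis t)) - 1)))
        (of_real m * (\<i> * (2 * cnj (cinner y gp) - 1)))"
      by (intro has_bochner_integral_mult_right has_bochner_integral_diff has_bochner_integral_cnj
          const_integral)
    also have "of_real m * (\<i> * (2 * cnj (cinner y gp) - 1)) = impedance_fun \<Theta> z"
    proof -
      have "cinner y gp = \<i> / 2 * (cnj z - \<i>) * (1 + (cnj z + \<i>) * q)"
        by (simp add: y_def q_def cinner_add_left cinner_scaleC_left cinner_eq_1 gp)
      from arg_cong[OF this, of cnj] have eq: "cnj (cinner y gp) = - \<i> / 2 * (z + \<i>) * (1 + (z - \<i>) * cnj q)"
        by simp
      have "\<i> * (2 * cnj (cinner y gp) - 1) = z + (1 + z\<^sup>2) * cnj q"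
        unfolding eq by (simp add: field_simps power2_eq_square)
      moreover have "cinner (resolvent B z gp) gp = cnj q"
        using z unfolding q_def by (intro B.cinner_resolvent_cnj) simp
      ultimately show ?thesis
        unfolding formula[OF z] by simp
    qed
    finally have int: "has_bochner_integral M (\<lambda>t. of_real m * (\<i> * (2 * cnj (1 / (1 - v * cis t)) - 1)))
      (impedance_fun \<Theta> z)" .
    \<comment> \<open>Only almost everywhere: at \<open>cis t = 1\<close> the function
      \<open>cayley_line\<close> has its default value.\<close>
    have ae: "AE t in M. of_real m * (\<i> * (2 * cnj (1 / (1 - v * cis t)) - 1))
      = (m * (1 + (cayley_line t)\<^sup>2)) *\<^sub>R (1 / (complex_of_real (cayley_line t) - z)
          - of_real (cayley_line t) / (1 + (of_real (cayley_line t))\<^sup>2))"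
      using atom
    proof eventually_elim
      case (elim t)
      define s where "s = complex_of_real (cayley_line t)"
      have "s - z \<noteq> 0"
        using z by (auto simp: s_def complex_eq_iff)
      moreover have "1 + s\<^sup>2 \<noteq> 0"
      proof -
        have "1 + (cayley_line t)\<^sup>2 \<noteq> 0"
          by (simp add: add_nonneg_eq_0_iff)
        then have "complex_of_real (1 + (cayley_line t)\<^sup>2) \<noteq> 0"
          unfolding of_real_eq_0_iff .
        then show ?thesis
          by (simp add: s_def)
      qed
      ultimately have "1 / (s - z) - s / (1 + s\<^sup>2) = (1 * (1 + s\<^sup>2) - s * (s - z)) / ((s - z) * (1 + s\<^sup>2))"
        by (intro diff_frac_eq)
      also have "1 * (1 + s\<^sup>2) - s * (s - z) = 1 + s * z"
        by (simp add: algebra_simps power2_eq_square)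
      finally have "(1 + s\<^sup>2) * (1 / (s - z) - s / (1 + s\<^sup>2)) = (1 + s * z) / (s - z)"
        using \<open>1 + s\<^sup>2 \<noteq> 0\<close> by simp
      then show ?case
        using cayley_kernel[OF elim z] by (simp add: v_def s_def scaleR_conv_of_real mult.assoc)
    qed
    have "(\<lambda>t. (m * (1 + (cayley_line t)\<^sup>2)) *\<^sub>R (1 / (complex_of_real (cayley_line t) - z)
        - of_real (cayley_line t) / (1 + (of_real (cayley_line t))\<^sup>2))) \<in> borel_measurable M"
      by measurable
    then show "has_bochner_integral M (\<lambda>t. (m * (1 + (cayley_line t)\<^sup>2)) *\<^sub>R
        (1 / (complex_of_real (cayley_line t) - z)
          - of_real (cayley_line t) / (1 + (of_real (cayley_line t))\<^sup>2))) (impedance_fun \<Theta> z)"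
      using has_bochner_integral_cong_AE[OF borel_measurable_has_bochner_integral[OF int] _ ae] int by blast
  qed
  have norm: "has_bochner_integral \<mu> (\<lambda>t. 1 / (1 + t\<^sup>2)) m"
  proof (rule integral_\<mu>)
    have "1 + s\<^sup>2 \<noteq> 0" for s :: real
      by (simp add: add_nonneg_eq_0_iff)
    then have "(\<lambda>t. (m * (1 + (cayley_line t)\<^sup>2)) *\<^sub>R (1 / (1 + (cayley_line t)\<^sup>2))) = (\<lambda>t. m)"
      by simp
    then show "has_bochner_integral M (\<lambda>t. (m * (1 + (cayley_line t)\<^sup>2)) *\<^sub>R (1 / (1 + (cayley_line t)\<^sup>2))) m"
      using const_integral by simp
  qed measurable
  \<comment> \<open>At iy the imaginary part of the kernel is y/(t^2 + y^2), at most 1/y; a finite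
    measure would thus give the decay just excluded.\<close>
  have "emeasure \<mu> UNIV = \<infinity>"
  proof (rule ccontr)
    assume fin: "emeasure \<mu> UNIV \<noteq> \<infinity>"
    interpret \<mu>: finite_measure \<mu>
      by standard (use fin in \<open>simp add: \<mu>_def\<close>)
    show False
    proof (rule Im_impedance_unbounded)
      fix y :: real
      assume y: "0 < y"
      define F where "F t = 1 / (complex_of_real t - \<i> * of_real y) - of_real t / (1 + (of_real t)\<^sup>2)" for t
      have "has_bochner_integral \<mu> F (impedance_fun \<Theta> (\<i> * of_real y))"
        unfolding F_def using y by (intro herglotz) simp
      then have I: "has_bochner_integral \<mu> (\<lambda>t. Im (F t)) (Im (impedance_fun \<Theta> (\<i> * of_real y)))"
        by (rule has_bochner_integral_Im)
      have "Im (F t) \<le> 1 / y" for t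
      proof -
        have "of_real t / (1 + (complex_of_real t)\<^sup>2) = of_real (t / (1 + t\<^sup>2))"
          by simp
        then have "Im (F t) = y / (t\<^sup>2 + y\<^sup>2)"
          unfolding F_def by (simp only: minus_complex.sel Im_complex_of_real)
            (simp add: Im_divide power2_eq_square)
        also have "\<dots> \<le> y / y\<^sup>2"
          using y by (intro divide_left_mono mult_pos_pos add_nonneg_pos) auto
        finally show ?thesis
          using y by (simp add: power2_eq_square)
      qed
      then have "(LINT t|\<mu>. Im (F t)) \<le> (LINT t|\<mu>. 1 / y)"
        using I by (intro integral_mono) (auto simp: has_bochner_integral_iff)
      then show "Im (impedance_fun \<Theta> (\<i> * of_real y)) \<le> measure \<mu> (space \<mu>) / y"
        using I by (simp add: has_bochner_integral_iff)
    qed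
  qed
  moreover have "impedance_fun \<Theta> holomorphic_on {z. 0 < Im z}"
  proof (rule holomorphic_transform)
    show "(\<lambda>z. of_real m * (z + (1 + z\<^sup>2) * cinner (resolvent B z gp) gp)) holomorphic_on {z. 0 < Im z}"
      by (intro holomorphic_intros B.resolvent_holomorphic)
  qed (simp add: formula)
  moreover have "sets \<mu> = sets borel"
    by (simp add: \<mu>_def)
  ultimately show ?thesis
    unfolding M_functions_def m_def[symmetric] using herglotz norm Im_impedance_pos by blast
qed

end

lemma transfer_fun_at_minus_i:
  assumes "l_sys_quasi \<Theta> (of_real k) gp gm"
  shows "transfer_fun \<Theta> (- \<i>) = of_real k"
proof -
  interpret l_sys_quasi \<Theta> "of_real k" gp gm
    by (rule assms)
  show ?thesis
    using transfer_fun_minus_i kappa_neq by simp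
qed

section \<open>Coupling\<close>

lemma l_sys_mainI:
  assumes "L_system \<Theta>" "von_neumann_vectors (sym_op \<Theta>) (main_op \<Theta>) \<kappa> gp gm"
  shows "l_sys_main \<Theta> (of_real \<kappa>) gp gm"
  using assms by unfold_locales (auto simp: von_neumann_vectors_def scaleR_eq_scaleC)

lemma hypothesis_I_quasi:
  assumes "L_system \<Theta>" "hypothesis_I_with \<Theta> \<kappa> gp gm"
  shows "l_sys_quasi \<Theta> (of_real \<kappa>) gp gm"
proof -
  interpret l_sys_main \<Theta> "of_real \<kappa>" gp gm
    using assms by (intro l_sys_mainI) (simp_all add: hypothesis_I_with_def)
  show ?thesis
    using assms(2) by unfold_locales (simp add: hypothesis_I_with_def)
qed

lemma hypothesis_II_quasi:
  assumes "L_system \<Theta>" "hypothesis_II_with \<Theta> \<kappa> gp gm"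
  shows "l_sys_quasi \<Theta> (of_real (- \<kappa>)) gp (- gm)"
proof -
  interpret l_sys_main \<Theta> "of_real \<kappa>" gp gm
    using assms by (intro l_sys_mainI) (simp_all add: hypothesis_II_with_def)
  show ?thesis
    using assms(2) gp gm kappa T_vec cvec.subspace_neg[OF subspace_defect_space]
    by unfold_locales (auto simp: hypothesis_II_with_def)
qed

lemma (in l_sys_quasi) hypothesis_I_withI:
  assumes "\<kappa> = of_real k" "0 \<le> k"
  shows "hypothesis_I_with \<Theta> k gp gm"
  using maximal_dissipative_main_op T_props gp gm kappa T_vec B_vec assms
  by (simp add: hypothesis_I_with_def von_neumann_vectors_def scaleR_eq_scaleC)

lemma adjoint_direct_sum:
  assumes "(g1, h1) \<in> adjoint_op A1" "(g2, h2) \<in> adjoint_op A2"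
  shows "((g1, g2), (h1, h2)) \<in> adjoint_op (direct_sum_op A1 A2)"
  using assms by (auto simp: adjoint_op_iff direct_sum_op_def cinner_prod_def)

lemma direct_sum_symmetric:
  assumes "symmetric_op A1" "symmetric_op A2"
  shows "direct_sum_op A1 A2 \<subseteq> adjoint_op (direct_sum_op A1 A2)"
    and "densely_defined_in UNIV (direct_sum_op A1 A2)"
proof -
  show "direct_sum_op A1 A2 \<subseteq> adjoint_op (direct_sum_op A1 A2)"
    using assms adjoint_direct_sum unfolding symmetric_op_def
    by (fastforce simp: direct_sum_op_def)
  have "Domain (direct_sum_op A1 A2) = Domain A1 \<times> Domain A2"
    by (auto simp: direct_sum_op_def)
  then show "densely_defined_in UNIV (direct_sum_op A1 A2)"
    using assms by (auto simp: symmetric_op_def densely_defined_in_def closure_Times)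
qed

text \<open>The symmetric operator of the coupling extends the direct sum by the single direction
  \<open>l\<close>, so beyond the deficiency condition for the sum only the pairing with
  \<open>l\<close> has to be checked.\<close>

lemma coupling_defect_space:
  assumes sym: "symmetric_op A1" "symmetric_op A2"
    and l: "(l, l') \<in> adjoint_op (direct_sum_op A1 A2)"
    and G: "G \<in> defect_space (direct_sum_op A1 A2) z" "cinner l' G = cinner l (z *\<^sub>C G)"
  shows "G \<in> defect_space (coupling_sym_op A1 A2 l) z"
  unfolding defect_space_def mem_Collect_eq adjoint_op_iff
proof (intro allI impI)
  define A where "A = direct_sum_op A1 A2"
  note dir = direct_sum_symmetric[OF sym, folded A_def]
  note op = is_operatorD[OF is_operator_adjoint_op[OF dir(2)]]
  fix f h
  assume "(f, h) \<in> coupling_sym_op A1 A2 l"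
  then obtain f0 h0 x where *: "(f, h) \<in> adjoint_op A" "f = f0 + x" "(f0, h0) \<in> A" "x \<in> cvec.span {l}"
    unfolding coupling_sym_op_def restrict_op_def A_def by blast
  then obtain c where c: "f = f0 + c *\<^sub>C l"
    by (auto simp: cvec.span_singleton)
  have "(f, h0 + c *\<^sub>C l') \<in> adjoint_op A"
    unfolding c using * dir(1) l by (intro op(2) op(4)) (auto simp: A_def)
  then have "h = h0 + c *\<^sub>C l'"
    using op(5) *(1) by blast
  moreover have "cinner h0 G = cinner f0 (z *\<^sub>C G)"
    using adjoint_opD[OF defect_spaceD[OF G(1)]] *(3) by (simp add: A_def)
  ultimately show "cinner h G = cinner f (z *\<^sub>C G)"
    using G(2) by (simp add: c cinner_add_left cinner_scaleC_left)
qed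

text \<open>The parameters multiply by construction of the main operator. What must be verified is
  that the two coupling vectors are unit deficiency vectors of the extended symmetric
  operator.\<close>

lemma coupling_I_hypothesis_I:
  fixes \<Theta>1 :: "'a::chilbert_space l_system" and \<Theta>2 :: "'b::chilbert_space l_system"
  assumes coup: "coupling_I \<Theta>1 \<Theta>2 \<Theta>" and L12: "L_system \<Theta>1" "L_system \<Theta>2"
  obtains \<kappa>1 \<kappa>2 gp1 gm1 gp2 gm2 Gp Gm
  where "hypothesis_I_with \<Theta>1 \<kappa>1 gp1 gm1" "hypothesis_I_with \<Theta>2 \<kappa>2 gp2 gm2"
    "hypothesis_I_with \<Theta> (\<kappa>1 * \<kappa>2) Gp Gm"
proof -
  from coup obtain \<kappa>1 \<kappa>2 gp1 gm1 gp2 gm2 \<alpha> \<beta> l Gp Gm where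
    H: "hypothesis_I_with \<Theta>1 \<kappa>1 gp1 gm1" "hypothesis_I_with \<Theta>2 \<kappa>2 gp2 gm2"
    and angles: "coupling_angles \<kappa>1 \<kappa>2 \<alpha> \<beta>"
    and l: "l = coupling_vector \<kappa>1 \<kappa>2 \<alpha> gp1 gm1 gp2 gm2"
    and G: "Gp = (cos \<alpha> *\<^sub>R gp1, - (sin \<alpha> *\<^sub>R gp2))" "Gm = (cos \<beta> *\<^sub>R gm1, - (sin \<beta> *\<^sub>R gm2))"
    and L: "L_system \<Theta>"
    and \<Theta>: "sym_op \<Theta> = coupling_sym_op (sym_op \<Theta>1) (sym_op \<Theta>2) l"
      "main_op \<Theta> = coupling_main_op (sym_op \<Theta>1) (sym_op \<Theta>2) l (Gp - (\<kappa>1 * \<kappa>2) *\<^sub>R Gm)"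
      "Gp - Gm \<in> Domain (quasi_kernel_of \<Theta>)"
    unfolding coupling_I_def Let_def by blast
  interpret S1: l_sys_quasi \<Theta>1 "of_real \<kappa>1" gp1 gm1
    using L12(1) H(1) by (rule hypothesis_I_quasi)
  interpret S2: l_sys_quasi \<Theta>2 "of_real \<kappa>2" gp2 gm2
    using L12(2) H(2) by (rule hypothesis_I_quasi)
  interpret S: l_sys \<Theta>
    by standard (rule L)
  have \<kappa>: "0 \<le> \<kappa>1" "\<kappa>1 < 1" "0 \<le> \<kappa>2" "\<kappa>2 < 1"
    using H by (auto simp: hypothesis_I_with_def von_neumann_vectors_def)
  have sym: "symmetric_op S1.A" "symmetric_op S2.A"
    using L12 by (auto simp: L_system_def)
  define A where "A = direct_sum_op S1.A S2.A"
  \<comment> \<open>The angles are chosen so that the cases \<open>\<kappa>2 = 0\<close> and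
    \<open>\<kappa>2 \<noteq> 0\<close> take this one form, in which only sines and cosines
    remain.\<close>
  have l_eq: "l = (sin \<alpha> *\<^sub>R gp1 - sin \<beta> *\<^sub>R gm1, cos \<alpha> *\<^sub>R gp2 - cos \<beta> *\<^sub>R gm2)"
    using angles by (auto simp: l coupling_vector_def coupling_angles_def scaleR_diff_right split: if_splits)
  have in_adjoint: "(a *\<^sub>R x - b *\<^sub>R y, \<i> *\<^sub>C (a *\<^sub>R x + b *\<^sub>R y)) \<in> adjoint_op B"
    if "x \<in> defect_space B \<i>" "y \<in> defect_space B (- \<i>)" for a b :: real and x y and B :: "'c::complex_inner graph"
  proof -
    note sub = subspace_adjoint_op[of B]
    have "of_real a *\<^sub>C (x, \<i> *\<^sub>C x) - of_real b *\<^sub>C (y, (- \<i>) *\<^sub>C y) \<in> adjoint_op B"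
      using that by (intro cvec.subspace_diff[OF sub] cvec.subspace_scale[OF sub] defect_spaceD)
    then show ?thesis
      by (simp add: scaleC_prod_def scaleR_eq_scaleC scaleC_add_right mult.commute)
  qed
  define l' where "l' = (\<i> *\<^sub>C (sin \<alpha> *\<^sub>R gp1 + sin \<beta> *\<^sub>R gm1), \<i> *\<^sub>C (cos \<alpha> *\<^sub>R gp2 + cos \<beta> *\<^sub>R gm2))"
  have l': "(l, l') \<in> adjoint_op A"
    unfolding l_eq l'_def A_def
    by (intro adjoint_direct_sum in_adjoint S1.gp S1.gm S2.gp S2.gm)
  have pair: "(a *\<^sub>R x, - (b *\<^sub>R y)) \<in> defect_space A z"
    if "x \<in> defect_space S1.A z" "y \<in> defect_space S2.A z" for a b :: real and x y z
  proof -
    have "of_real a *\<^sub>C x \<in> defect_space S1.A z" "- (of_real b *\<^sub>C y) \<in> defect_space S2.A z"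
      using that by (auto intro!: cvec.subspace_scale cvec.subspace_neg subspace_defect_space)
    then show ?thesis
      unfolding A_def defect_space_def mem_Collect_eq
      by (auto simp: scaleC_prod_def scaleR_eq_scaleC intro!: adjoint_direct_sum)
  qed
  have GA: "Gp \<in> defect_space A \<i>" "Gm \<in> defect_space A (- \<i>)"
    unfolding G by (intro pair S1.gp S1.gm S2.gp S2.gm)+
  have Gp: "Gp \<in> defect_space S.A \<i>"
    unfolding \<Theta>(1)
  proof (rule coupling_defect_space[OF sym l'[unfolded A_def] GA(1)[unfolded A_def]])
    \<comment> \<open>The products of \<open>sin \<alpha>\<close> and \<open>cos \<alpha>\<close>
      from the two components cancel; the mixed terms agree on both sides.\<close>
    show "cinner l' Gp = cinner l (\<i> *\<^sub>C Gp)"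
      unfolding l'_def l_eq G
      by (simp add: cinner_prod_def scaleC_prod_def cinner_simps cinner_eq_1 S1.gp S2.gp algebra_simps)
  qed
  have Gm: "Gm \<in> defect_space S.A (- \<i>)"
    unfolding \<Theta>(1)
  proof (rule coupling_defect_space[OF sym l'[unfolded A_def] GA(2)[unfolded A_def]])
    show "cinner l' Gm = cinner l ((- \<i>) *\<^sub>C Gm)"
      unfolding l'_def l_eq G
      by (simp add: cinner_prod_def scaleC_prod_def cinner_simps cinner_eq_1 S1.gm S2.gm algebra_simps)
  qed
  have nG: "norm Gp = 1" "norm Gm = 1"
    by (simp_all add: G norm_prod_def S1.gp S1.gm S2.gp S2.gm)
  define t where "t = Gp - (\<kappa>1 * \<kappa>2) *\<^sub>R Gm"
  have "t \<in> Domain (adjoint_op A)"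
    using in_adjoint[OF GA, of 1 "\<kappa>1 * \<kappa>2"] by (auto simp: t_def)
  moreover have "0 \<in> Domain (coupling_sym_op S1.A S2.A l)"
    using is_operatorD(1)[OF S.A_sym(1)] by (auto simp: \<Theta>(1))
  then have "t \<in> {f + x | f x. f \<in> Domain (coupling_sym_op S1.A S2.A l) \<and> x \<in> cvec.span {t}}"
    by (intro CollectI exI[of _ 0] exI[of _ t]) (simp add: cvec.span_base)
  ultimately have "t \<in> Domain (main_op \<Theta>)"
    unfolding \<Theta>(2) coupling_main_op_def restrict_op_def t_def[symmetric] A_def[symmetric] by blast
  moreover have "cmod (of_real (\<kappa>1 * \<kappa>2)) < 1"
    using \<kappa> mult_right_mono[of \<kappa>1 1 \<kappa>2] by (simp add: norm_mult)
  ultimately interpret S: l_sys_quasi \<Theta> "of_real (\<kappa>1 * \<kappa>2)" Gp Gm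
    using Gp Gm nG \<Theta>(3) by unfold_locales (simp_all add: t_def scaleR_eq_scaleC)
  have "hypothesis_I_with \<Theta> (\<kappa>1 * \<kappa>2) Gp Gm"
    using \<kappa> by (intro S.hypothesis_I_withI) auto
  then show ?thesis
    using that H by blast
qed

section \<open>Comparison of parameters and phases\<close>

lemma moebius_inj:
  fixes a b :: real
  assumes "(1 - a) / (1 + a) = (1 - b) / (1 + b)" "- 1 < a" "- 1 < b"
  shows "a = b"
  using assms by (simp add: field_simps)

text \<open>V(i) of the given system identifies the parameter with that of its class. Comparing
  W(-i) for both systems gives k = - \<nu> k, which determines \<nu> only when k is nonzero.\<close>

lemma companion_parameter:
  assumes L: "L_system \<Theta>" and II: "hypothesis_II \<Theta>" and comp: "companion_I \<Theta> \<Theta>' \<nu>"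
    and V: "impedance_fun \<Theta> \<in> M_inv_class \<kappa>" "0 \<le> \<kappa>" "\<kappa> < 1"
    and H': "hypothesis_I_with \<Theta>' \<kappa>' gp' gm'"
  shows "\<kappa>' = \<kappa>" "\<kappa> \<noteq> 0 \<Longrightarrow> \<nu> = -1"
proof -
  from comp II obtain k gp gm where H: "hypothesis_I_with \<Theta>' k gp gm" "hypothesis_II_with \<Theta> k gp gm"
    and L': "L_system \<Theta>'"
    and W: "\<And>z. z \<in> resolvent_set (main_op \<Theta>) \<Longrightarrow> transfer_fun \<Theta>' z = \<nu> * transfer_fun \<Theta> z"
    unfolding companion_I_def by blast
  have k: "0 \<le> k" "k < 1" "0 \<le> \<kappa>'" "\<kappa>' < 1"
    using H H' by (auto simp: hypothesis_I_with_def von_neumann_vectors_def)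
  interpret S: l_sys_quasi \<Theta> "of_real (- k)" gp "- gm"
    using L H(2) by (rule hypothesis_II_quasi)
  interpret S': l_sys_quasi \<Theta>' "of_real k" gp gm
    using L' H(1) by (rule hypothesis_I_quasi)
  interpret S'': l_sys_quasi \<Theta>' "of_real \<kappa>'" gp' gm'
    using L' H' by (rule hypothesis_I_quasi)
  have "\<i> * complex_of_real ((1 - - k) / (1 + - k)) = \<i> * of_real ((1 + \<kappa>) / (1 - \<kappa>))"
    using S.impedance_fun_at_i[OF refl] M_functions_at_i V(1) unfolding M_inv_class_def by metis
  then have "(1 - - k) / (1 + - k) = (1 - - \<kappa>) / (1 + - \<kappa>)"
    by (simp only: mult_cancel_left of_real_eq_iff) simp
  from moebius_inj[OF this] have k_eq: "k = \<kappa>"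
    using k V by simp
  \<comment> \<open>\<open>companion_I\<close> and the caller may choose different vectors for the
    companion; V(i) does not depend on them, so the parameters agree.\<close>
  have "\<i> * complex_of_real ((1 - k) / (1 + k)) = \<i> * of_real ((1 - \<kappa>') / (1 + \<kappa>'))"
    using S'.impedance_fun_at_i[OF refl] S''.impedance_fun_at_i[OF refl] by metis
  then have "(1 - k) / (1 + k) = (1 - \<kappa>') / (1 + \<kappa>')"
    by (simp only: mult_cancel_left of_real_eq_iff) simp
  from moebius_inj[OF this] show "\<kappa>' = \<kappa>"
    using k k_eq by simp
  show "\<nu> = -1" if "\<kappa> \<noteq> 0"
  proof -
    have "complex_of_real k = \<nu> * of_real (- k)"
      using W[OF S.resolvent_set_main_op] transfer_fun_at_minus_i[OF S'.l_sys_quasi_axioms]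
        transfer_fun_at_minus_i[OF S.l_sys_quasi_axioms] by simp
    then have "(\<nu> + 1) * of_real k = 0"
      by (simp add: algebra_simps eq_neg_iff_add_eq_0)
    then show ?thesis
      using that k_eq by (simp add: eq_neg_iff_add_eq_0)
  qed
qed

theorem corollary6p8:
  fixes \<Theta>1 :: "'a::chilbert_space l_system"
    and \<Theta>2 :: "'b::chilbert_space l_system"
    and \<Theta> :: "('a \<times> 'b) l_system"
    and \<kappa>1 \<kappa>2 :: real
  assumes "minimal_L_system \<Theta>1" and "minimal_L_system \<Theta>2"
    and "hypothesis_II \<Theta>1" and "hypothesis_II \<Theta>2"
    and "coupling \<Theta>1 \<Theta>2 \<Theta>"
    and "0 \<le> \<kappa>1" and "\<kappa>1 < 1" and "0 \<le> \<kappa>2" and "\<kappa>2 < 1"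
    and "impedance_fun \<Theta>1 \<in> M_inv_class \<kappa>1"
    and "impedance_fun \<Theta>2 \<in> M_inv_class \<kappa>2"
  shows "hypothesis_I \<Theta> \<and> impedance_fun \<Theta> \<in> M_class (\<kappa>1 * \<kappa>2)"
proof -
  from assms(5) obtain \<Theta>1' \<Theta>2' \<Theta>' \<nu>1 \<nu>2 where
    comp: "companion_I \<Theta>1 \<Theta>1' \<nu>1" "companion_I \<Theta>2 \<Theta>2' \<nu>2"
    and coup: "coupling_I \<Theta>1' \<Theta>2' \<Theta>'"
    and L: "L_system \<Theta>" and ops: "sym_op \<Theta> = sym_op \<Theta>'" "main_op \<Theta> = main_op \<Theta>'"
    and W: "\<And>z. z \<in> resolvent_set (main_op \<Theta>) \<Longrightarrow>
      transfer_fun \<Theta> z = inverse (\<nu>1 * \<nu>2) * transfer_fun \<Theta>' z"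
    unfolding coupling_def by blast
  have L': "L_system \<Theta>1'" "L_system \<Theta>2'" "L_system \<Theta>'"
    using comp coup by (auto simp: companion_I_def coupling_I_def Let_def)
  obtain k1 k2 gp1 gm1 gp2 gm2 Gp Gm where
    H: "hypothesis_I_with \<Theta>1' k1 gp1 gm1" "hypothesis_I_with \<Theta>2' k2 gp2 gm2"
    and H': "hypothesis_I_with \<Theta>' (k1 * k2) Gp Gm"
    by (rule coupling_I_hypothesis_I[OF coup L'(1,2)])
  have L12: "L_system \<Theta>1" "L_system \<Theta>2"
    using assms(1,2) by (simp_all add: minimal_L_system_def)
  note par1 = companion_parameter[OF L12(1) assms(3) comp(1) assms(10,6,7) H(1)]
  note par2 = companion_parameter[OF L12(2) assms(4) comp(2) assms(11,8,9) H(2)]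
  define K where "K = \<kappa>1 * \<kappa>2"
  have K0: "0 \<le> K"
    using assms(6,8) by (simp add: K_def)
  interpret S': l_sys_quasi \<Theta>' "of_real K" Gp Gm
    using hypothesis_I_quasi[OF L'(3) H'] by (simp add: par1(1) par2(1) K_def)
  interpret S: l_sys \<Theta>
    by standard (rule L)
  \<comment> \<open>The coupling shares its operators with the Hypothesis I coupling but has its own
    quasi-kernel, so initially only the modulus of \<open>u\<close> is known.\<close>
  obtain u where u: "cmod u = 1" "Gp - u *\<^sub>C Gm \<in> Domain S.B"
    by (rule S.quasi_kernel_phase[of Gp Gm]) (use S'.gp S'.gm ops in simp_all)
  have uu: "cnj u * u = 1"
    using u(1) by (metis complex_norm_square mult.commute of_real_1 one_power2)
  \<comment> \<open>Moving \<open>u\<close> into the second vector must leave the domain of the main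
    operator unchanged, so the parameter absorbs the inverse phase.\<close>
  interpret S: l_sys_quasi \<Theta> "of_real K * cnj u" Gp "u *\<^sub>C Gm"
  proof unfold_locales
    show "u *\<^sub>C Gm \<in> defect_space S.A (- \<i>)"
      using S'.gm ops by (auto intro: cvec.subspace_scale[OF subspace_defect_space])
    show "Gp - (of_real K * cnj u) *\<^sub>C u *\<^sub>C Gm \<in> Domain S.T"
      using S'.T_vec ops by (simp add: mult.assoc uu)
  qed (use S'.gp S'.gm S'.kappa u ops in \<open>simp_all add: norm_scaleC norm_mult\<close>)
  \<comment> \<open>If \<open>K = 0\<close>, the phase of \<open>Gm\<close> is free; otherwise \<open>W(-\<i>)\<close> forces \<open>u = 1\<close>.\<close>
  have "of_real K * cnj u = complex_of_real K"
  proof (cases "K = 0")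
    case False
    then have "\<nu>1 = -1" "\<nu>2 = -1"
      using par1(2) par2(2) by (auto simp: K_def)
    then have "transfer_fun \<Theta> (- \<i>) = of_real K"
      using W[OF S.resolvent_set_main_op] transfer_fun_at_minus_i[OF S'.l_sys_quasi_axioms] by simp
    \<comment> \<open>This is the relation between W(-i) and the parameter for W(-i) = K. Dividing
      by K leaves 1 - Ku = u - K, that is (1 + K)(1 - u) = 0.\<close>
    then have "of_real K * (1 - of_real K * u) = of_real K * (u * (1 - of_real K * cnj u))"
      using S.transfer_fun_minus_i by (simp add: mult.assoc)
    then have "1 - of_real K * u = u * (1 - of_real K * cnj u)"
      using False by simp
    also have "\<dots> = u - of_real K * (cnj u * u)"
      by (simp add: algebra_simps)
    finally have "(1 + of_real K) * u = (1 + of_real K) * 1"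
      unfolding uu by algebra
    moreover have "1 + complex_of_real K \<noteq> 0"
      using K0 by (simp add: complex_eq_iff)
    ultimately have "u = 1"
      by (simp only: mult_cancel_left) simp
    then show ?thesis
      by simp
  qed simp
  then have "hypothesis_I_with \<Theta> K Gp (u *\<^sub>C Gm)" "impedance_fun \<Theta> \<in> M_functions ((1 - K) / (1 + K))"
    using K0 by (intro S.hypothesis_I_withI S.impedance_M_functions; simp)+
  then show ?thesis
    unfolding hypothesis_I_def M_class_def K_def by blast
qed

end
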